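(* Let $\mathrm{M}$ be a loopless matroid on a finite ground set $E$, let $\mathcal{G}$ be a building set of its lattice of flats $\mathcal{L}$ such that $(\mathrm{M},\mathcal{G})$ is irreducible, and let $\vartriangleleft$ be a total order on $E$ such that $(\mathrm{M},\mathcal{G})$ is $\vartriangleleft$-complete. Let $\gamma(\mathrm{M},\mathcal{G})(t)$ be the $\gamma$-polynomial of the Chow polynomial $\mathrm{H}(\mathrm{M},\mathcal{G})(t)$. Then \[ \gamma(\mathrm{M},\mathcal{G})(t)=\sum_{\mathcal{S}\in \mathcal{N}(\mathrm{M},\mathcal{G})^{\max}_{\mathrm{stable}}} t^{\mathrm{des}(\mathcal{S})}, \] where descents are taken with respect to $\vartriangleleft$. In particular, $\gamma(\mathrm{M},\mathcal{G})(t)$ has nonnegative coefficients.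
   Context: $\mathcal{L}=\mathcal{L}(\mathrm{M})$ is the lattice of flats ordered by inclusion, with $\hat0=\varnothing$, $\hat1=E$, join $F\vee G=\operatorname{cl}_{\mathrm{M}}(F\cup G)$, and $F\vee e=\operatorname{cl}_{\mathrm{M}}(F\cup\{e\})$ for $e\in E$. A building set is a subset $\mathcal{G}\subseteq\mathcal{L}\setminus\{\hat0\}$ such that for every $F\neq\hat0$, with $\max\mathcal{G}_{\leqslant F}$ the maximal elements of $\{G\in\mathcal{G}:G\leqslant F\}$, the join map $\prod_{G\in\max\mathcal{G}_{\leqslant F}}[\hat0,G]\to[\hat0,F]$ is a poset isomorphism. $(\mathrm{M},\mathcal{G})$ is irreducible if $E\in\mathcal{G}$. A subset $\mathcal{S}\subseteq\mathcal{G}$ is nested if for every antichain $A\subseteq\mathcal{S}$ and every $\{S_1,\dots,S_k\}\subseteq A$ with $k\geqslant2$, $S_1\vee\dots\vee S_k\notin\mathcal{G}$; a maximal nested set is one maximal under inclusion among all nested subsets of $\mathcal{G}$. Chow ring: $\mathrm{CH}(\mathrm{M},\mathcal{G})=\mathbb{Q}[x_G:G\in\mathcal{G}]/(I+J)$, where $I$ is generated by monomials $x_{G_1}\cdots x_{G_k}$ with $\{G_1,\dots,G_k\}$ not nested, and $J$ by the linear forms $\sum_{G\in\mathcal{G},G\geqslant a}x_G$ for each atom $a$ of $\mathcal{L}$. The Chow polynomial $\mathrm{H}(\mathrm{M},\mathcal{G})(t)=\sum_i\dim\mathrm{CH}^i(\mathrm{M},\mathcal{G})t^i$ is palindromic of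 some degree $d$, so uniquely $\mathrm{H}(\mathrm{M},\mathcal{G})(t)=\sum_{i=0}^{\lfloor d/2\rfloor}\gamma_it^i(1+t)^{d-2i}$; the $\gamma$-polynomial is $\sum_i\gamma_it^i$. Completeness: for flats $F\leqslant G$, write $G\setminus F=\{e_1\vartriangleleft\dots\vartriangleleft e_k\}$ and $F_i=\operatorname{cl}_{\mathrm{M}}(F\cup\{e_1,\dots,e_i\})$; $C_\vartriangleleft(F,G)=\{F,F_1,\dots,F_k=G\}$. Let $\mathcal{G}_F=\{F\vee H:H\in\mathcal{G}\}\setminus\{F\}$ and $\mathcal{G}_F^G=\mathcal{G}_F\cap[F,G]$. $(\mathrm{M},\mathcal{G})$ is $\vartriangleleft$-complete if $C_\vartriangleleft(F,G)\subseteq\mathcal{G}_F^G\cup\{F\}$ for all $F\in\mathcal{L}$, $G\in\mathcal{G}$ with $F\leqslant G$. Descents: for a nested set $\mathcal{S}$ and $G\in\mathcal{S}$, $J^G=\bigvee\{H\in\mathcal{S}:H<G\}$. For a maximal nested set $\mathcal{S}$ one has $\operatorname{rk}G-\operatorname{rk}J^G=1$ for every $G\in\mathcal{S}$, and one sets $\lambda_{\mathcal{S}}(G)=\min_\vartriangleleft\{e\in E: J^G\vee e=G\}$. For $G\in\mathcal{S}$ not maximal in $\mathcal{S}$, the set $\{H\in\mathcal{S}:H>G\}$ has a unique minimum $p(G)$ (the parent; $G$ is a child of $p(G)$). $G\in\mathcal{S}$ is a descent if $G$ is not maximal in $\mathcal{S}$ and $\lambda_{\mathcal{S}}(p(G))\vartriangleleft\lambda_{\mathcal{S}}(G)$.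 A descent is a bottom descent if it is minimal in $\mathcal{S}$, and a double descent if it is not minimal in $\mathcal{S}$ and all its children are descents. $\mathrm{Des}(\mathcal{S})$ is the set of descents, $\mathrm{des}(\mathcal{S})=|\mathrm{Des}(\mathcal{S})|$, and $\mathcal{N}(\mathrm{M},\mathcal{G})^{\max}_{\mathrm{stable}}$ is the set of maximal nested sets with no bottom descent and no double descent. *)

theory Defs
  imports "HOL-Library.Poly_Mapping" "HOL-Library.FuncSet"
          "HOL-Computational_Algebra.Polynomial"
begin

definition matroid :: "'a set \<Rightarrow> ('a set \<Rightarrow> bool) \<Rightarrow> bool" where
  "matroid E indep \<longleftrightarrow> finite E \<and>
     (\<forall>X. indep X \<longrightarrow> X \<subseteq> E) \<and> indep {} \<and>
     (\<forall>X Y. indep X \<and> Y \<subseteq> X \<longrightarrow> indep Y) \<and>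
     (\<forall>X Y. indep X \<and> indep Y \<and> card X < card Y \<longrightarrow>
        (\<exists>e \<in> Y - X. indep (insert e X)))"

definition loopless :: "'a set \<Rightarrow> ('a set \<Rightarrow> bool) \<Rightarrow> bool" where
  "loopless E indep \<longleftrightarrow> (\<forall>e \<in> E. indep {e})"

definition mrank :: "('a set \<Rightarrow> bool) \<Rightarrow> 'a set \<Rightarrow> nat" where
  "mrank indep X = Max {card I | I. I \<subseteq> X \<and> indep I}"

definition mcl :: "'a set \<Rightarrow> ('a set \<Rightarrow> bool) \<Rightarrow> 'a set \<Rightarrow> 'a set" where
  "mcl E indep X = {e \<in> E. mrank indep (insert e X) = mrank indep X}"

definition flat :: "'a set \<Rightarrow> ('a set \<Rightarrow> bool) \<Rightarrow> 'a set \<Rightarrow> bool" where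
  "flat E indep F \<longleftrightarrow> F \<subseteq> E \<and> mcl E indep F = F"

definition fjoin :: "'a set \<Rightarrow> ('a set \<Rightarrow> bool) \<Rightarrow> 'a set set \<Rightarrow> 'a set" where
  "fjoin E indep X = mcl E indep (\<Union>X)"

definition atom :: "'a set \<Rightarrow> ('a set \<Rightarrow> bool) \<Rightarrow> 'a set \<Rightarrow> bool" where
  "atom E indep A \<longleftrightarrow> flat E indep A \<and> A \<noteq> mcl E indep {} \<and>
     (\<forall>F. flat E indep F \<and> F \<subseteq> A \<longrightarrow> F = mcl E indep {} \<or> F = A)"

definition maxG_below :: "'a set set \<Rightarrow> 'a set \<Rightarrow> 'a set set" where
  "maxG_below \<G> F = {G \<in> \<G>. G \<subseteq> F \<and> \<not> (\<exists>H \<in> \<G>. H \<subseteq> F \<and> G \<subset> H)}"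

definition building_set :: "'a set \<Rightarrow> ('a set \<Rightarrow> bool) \<Rightarrow> 'a set set \<Rightarrow> bool" where
  "building_set E indep \<G> \<longleftrightarrow>
     (\<forall>G \<in> \<G>. flat E indep G \<and> G \<noteq> mcl E indep {}) \<and>
     (\<forall>F. flat E indep F \<and> F \<noteq> mcl E indep {} \<longrightarrow>
        (let M = maxG_below \<G> F;
             D = (\<Pi>\<^sub>E G \<in> M. {H. flat E indep H \<and> H \<subseteq> G});
             \<phi> = (\<lambda>f. fjoin E indep (f ` M))
         in bij_betw \<phi> D {H. flat E indep H \<and> H \<subseteq> F} \<and>
            (\<forall>f \<in> D. \<forall>g \<in> D. (\<forall>G \<in> M. f G \<subseteq> g G) \<longleftrightarrow> \<phi> f \<subseteq> \<phi> g)))"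

definition antichain_sets :: "'a set set \<Rightarrow> bool" where
  "antichain_sets A \<longleftrightarrow> (\<forall>X \<in> A. \<forall>Y \<in> A. X \<subseteq> Y \<longrightarrow> X = Y)"

definition nested :: "'a set \<Rightarrow> ('a set \<Rightarrow> bool) \<Rightarrow> 'a set set \<Rightarrow> 'a set set \<Rightarrow> bool" where
  "nested E indep \<G> S \<longleftrightarrow> S \<subseteq> \<G> \<and>
     (\<forall>A \<subseteq> S. antichain_sets A \<longrightarrow>
        (\<forall>B \<subseteq> A. finite B \<and> card B \<ge> 2 \<longrightarrow> fjoin E indep B \<notin> \<G>))"

definition max_nested :: "'a set \<Rightarrow> ('a set \<Rightarrow> bool) \<Rightarrow> 'a set set \<Rightarrow> 'a set set \<Rightarrow> bool" where
  "max_nested E indep \<G> S \<longleftrightarrow> nested E indep \<G> S \<and>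
     (\<forall>T. nested E indep \<G> T \<and> S \<subseteq> T \<longrightarrow> T = S)"

text \<open>Polynomials over \<open>\<rat>\<close> in variables \<open>x_G\<close> indexed by flats:
  a monomial is a finitely supported exponent vector, a polynomial is a
  finitely supported map from monomials to coefficients.\<close>
type_synonym 'a cpoly = "('a set \<Rightarrow>\<^sub>0 nat) \<Rightarrow>\<^sub>0 rat"

definition cscale :: "rat \<Rightarrow> 'a cpoly \<Rightarrow> 'a cpoly" where
  "cscale c p = Poly_Mapping.map ((*) c) p"

definition cvar :: "'a set \<Rightarrow> 'a cpoly" where
  "cvar G = Poly_Mapping.single (Poly_Mapping.single G 1) 1"

definition mdeg :: "('a set \<Rightarrow>\<^sub>0 nat) \<Rightarrow> nat" where
  "mdeg m = (\<Sum>G \<in> Poly_Mapping.keys m. Poly_Mapping.lookup m G)"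

definition chow_gens :: "'a set \<Rightarrow> ('a set \<Rightarrow> bool) \<Rightarrow> 'a set set \<Rightarrow> 'a cpoly set" where
  "chow_gens E indep \<G> =
     {(\<Prod>G \<in> T. cvar G) | T. T \<subseteq> \<G> \<and> \<not> nested E indep \<G> T} \<union>
     {(\<Sum>G \<in> {G \<in> \<G>. A \<subseteq> G}. cvar G) | A. atom E indep A}"

definition chow_ideal :: "'a set \<Rightarrow> ('a set \<Rightarrow> bool) \<Rightarrow> 'a set set \<Rightarrow> 'a cpoly set" where
  "chow_ideal E indep \<G> = module.span cscale
     {Poly_Mapping.single m 1 * g | m g. Poly_Mapping.keys m \<subseteq> \<G> \<and> g \<in> chow_gens E indep \<G>}"

definition hom_part :: "'a set set \<Rightarrow> nat \<Rightarrow> 'a cpoly set" where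
  "hom_part \<G> i = module.span cscale
     {Poly_Mapping.single m 1 | m. Poly_Mapping.keys m \<subseteq> \<G> \<and> mdeg m = i}"

text \<open>\<open>dim CH^i = dim (P_i / (P_i \<inter> (I+J)))\<close>, computed as a difference of
  dimensions of finite-dimensional \<open>\<rat>\<close>-vector spaces (I+J is homogeneous).\<close>
definition chow_dim :: "'a set \<Rightarrow> ('a set \<Rightarrow> bool) \<Rightarrow> 'a set set \<Rightarrow> nat \<Rightarrow> nat" where
  "chow_dim E indep \<G> i =
     vector_space.dim cscale (hom_part \<G> i) -
     vector_space.dim cscale (hom_part \<G> i \<inter> chow_ideal E indep \<G>)"

definition chow_poly :: "'a set \<Rightarrow> ('a set \<Rightarrow> bool) \<Rightarrow> 'a set set \<Rightarrow> rat poly" where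
  "chow_poly E indep \<G> = Abs_poly (\<lambda>i. of_nat (chow_dim E indep \<G> i))"

text \<open>The \<open>\<gamma>\<close>-polynomial of a palindromic polynomial of (palindromic) degree
  \<open>d = degree H\<close>: the unique \<open>\<gamma>\<close> with \<open>H = \<Sum>\<^sub>i \<gamma>\<^sub>i t^i (1+t)^(d-2i)\<close>.\<close>
definition gamma_poly :: "rat poly \<Rightarrow> rat poly" where
  "gamma_poly H = (THE g. degree g \<le> degree H div 2 \<and>
      H = (\<Sum>i \<le> degree H div 2.
             smult (coeff g i) (monom 1 i * [:1, 1:] ^ (degree H - 2 * i))))"

definition cchain :: "'a set \<Rightarrow> ('a set \<Rightarrow> bool) \<Rightarrow> ('a \<Rightarrow> 'a \<Rightarrow> bool)
                      \<Rightarrow> 'a set \<Rightarrow> 'a set \<Rightarrow> 'a set set" where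
  "cchain E indep lt F G = insert F
     {mcl E indep (F \<union> {e' \<in> G - F. lt e' e \<or> e' = e}) | e. e \<in> G - F}"

definition G_F :: "'a set \<Rightarrow> ('a set \<Rightarrow> bool) \<Rightarrow> 'a set set \<Rightarrow> 'a set \<Rightarrow> 'a set set" where
  "G_F E indep \<G> F = {mcl E indep (F \<union> H) | H. H \<in> \<G>} - {F}"

definition lt_complete :: "'a set \<Rightarrow> ('a set \<Rightarrow> bool) \<Rightarrow> 'a set set \<Rightarrow> ('a \<Rightarrow> 'a \<Rightarrow> bool) \<Rightarrow> bool" where
  "lt_complete E indep \<G> lt \<longleftrightarrow>
     (\<forall>F G. flat E indep F \<and> G \<in> \<G> \<and> F \<subseteq> G \<longrightarrow>
        cchain E indep lt F G \<subseteq>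
          insert F {K \<in> G_F E indep \<G> F. F \<subseteq> K \<and> K \<subseteq> G})"

definition strict_total_on :: "'a set \<Rightarrow> ('a \<Rightarrow> 'a \<Rightarrow> bool) \<Rightarrow> bool" where
  "strict_total_on E lt \<longleftrightarrow>
     (\<forall>x \<in> E. \<not> lt x x) \<and>
     (\<forall>x \<in> E. \<forall>y \<in> E. \<forall>z \<in> E. lt x y \<and> lt y z \<longrightarrow> lt x z) \<and>
     (\<forall>x \<in> E. \<forall>y \<in> E. x \<noteq> y \<longrightarrow> lt x y \<or> lt y x)"

definition Jset :: "'a set \<Rightarrow> ('a set \<Rightarrow> bool) \<Rightarrow> 'a set set \<Rightarrow> 'a set \<Rightarrow> 'a set" where
  "Jset E indep S G = fjoin E indep {H \<in> S. H \<subset> G}"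

definition lt_min :: "('a \<Rightarrow> 'a \<Rightarrow> bool) \<Rightarrow> 'a set \<Rightarrow> 'a" where
  "lt_min lt X = (THE x. x \<in> X \<and> (\<forall>y \<in> X. y \<noteq> x \<longrightarrow> lt x y))"

definition lab :: "'a set \<Rightarrow> ('a set \<Rightarrow> bool) \<Rightarrow> ('a \<Rightarrow> 'a \<Rightarrow> bool) \<Rightarrow> 'a set set \<Rightarrow> 'a set \<Rightarrow> 'a" where
  "lab E indep lt S G =
     lt_min lt {e \<in> E. mcl E indep (insert e (Jset E indep S G)) = G}"

definition is_max_in :: "'a set set \<Rightarrow> 'a set \<Rightarrow> bool" where
  "is_max_in S G \<longleftrightarrow> G \<in> S \<and> \<not> (\<exists>H \<in> S. G \<subset> H)"

definition is_min_in :: "'a set set \<Rightarrow> 'a set \<Rightarrow> bool" where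
  "is_min_in S G \<longleftrightarrow> G \<in> S \<and> \<not> (\<exists>H \<in> S. H \<subset> G)"

definition parent :: "'a set set \<Rightarrow> 'a set \<Rightarrow> 'a set" where
  "parent S G = (THE H. H \<in> S \<and> G \<subset> H \<and> (\<forall>H' \<in> S. G \<subset> H' \<longrightarrow> H \<subseteq> H'))"

definition descent :: "'a set \<Rightarrow> ('a set \<Rightarrow> bool) \<Rightarrow> ('a \<Rightarrow> 'a \<Rightarrow> bool) \<Rightarrow> 'a set set \<Rightarrow> 'a set \<Rightarrow> bool" where
  "descent E indep lt S G \<longleftrightarrow> G \<in> S \<and> \<not> is_max_in S G \<and>
     lt (lab E indep lt S (parent S G)) (lab E indep lt S G)"

definition Des :: "'a set \<Rightarrow> ('a set \<Rightarrow> bool) \<Rightarrow> ('a \<Rightarrow> 'a \<Rightarrow> bool) \<Rightarrow> 'a set set \<Rightarrow> 'a set set" where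
  "Des E indep lt S = {G. descent E indep lt S G}"

definition children :: "'a set set \<Rightarrow> 'a set \<Rightarrow> 'a set set" where
  "children S G = {H \<in> S. \<not> is_max_in S H \<and> parent S H = G}"

definition bottom_descent where
  "bottom_descent E indep lt S G \<longleftrightarrow> descent E indep lt S G \<and> is_min_in S G"

definition double_descent where
  "double_descent E indep lt S G \<longleftrightarrow> descent E indep lt S G \<and> \<not> is_min_in S G \<and>
     (\<forall>H \<in> children S G. descent E indep lt S H)"

definition stable_max_nested ::
  "'a set \<Rightarrow> ('a set \<Rightarrow> bool) \<Rightarrow> 'a set set \<Rightarrow> ('a \<Rightarrow> 'a \<Rightarrow> bool) \<Rightarrow> 'a set set set" where
  "stable_max_nested E indep \<G> lt = {S. max_nested E indep \<G> S \<and>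
     (\<forall>G \<in> S. \<not> bottom_descent E indep lt S G \<and> \<not> double_descent E indep lt S G)}"

end

theory Submission
  imports Defs
begin

text \<open>The monomials with nested support whose exponents satisfy
  \<open>m X < rk X - rk J\<^sup>X\<close> form a basis of the Chow ring (Feichtner and Yuzvinsky). They span by
  straightening: \<open>x\<^sub>T h\<^sub>B\<^sup>n\<close> lies in the ideal as soon as \<open>n \<ge> rk B - rk (\<Or>T)\<close>, where
  \<open>h\<^sub>B\<close> is the sum of the variables above \<open>B\<close>. The corresponding monomials in the \<open>h\<^sub>B\<close> are
  independent because each of them is detected, triangularly with respect to the total rank, by a
  functional that vanishes on the ideal: a product over a chain of flats of Hall-Rado type
  indicator functions.

  Hence the Hilbert series is a sum over nested sets. Deleting the top element of a nested set
  leaves a flat \<open>J\<close> that splits into factors, so the sum is recursive. Completeness provides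
  for every \<open>J < G\<close> a chain whose last proper member is a hyperplane \<open>H\<close> of \<open>G\<close> that differs from
  \<open>J\<close> in a single factor; splitting off \<open>H\<close> turns the recursion into one over maximal nested sets
  weighted by \<open>t\<close> for descents and \<open>1 + t\<close> for the other nodes with a child that is not a descent,
  and a descent without such a child gets weight 0. In a maximal nested set every node has at most
  one child that is not a descent, whence the exponent of \<open>1 + t\<close> is \<open>rk E - 1 - 2 des\<close>.\<close>

section \<open>Rank, closure and flats of a loopless matroid\<close>

text \<open>The recursion rests on two companion series, [n] = 1 + t + ... + t^(n-1) and t[n-1],
  with [n+1] = (1+t)[n] - t[n-1]. The first belongs to a tree as it stands, the second to a tree
  whose root becomes a descent under a parent, so the two identities are proved in one induction.
  Its step restricts one factor to the trees whose root label lies below that of the new root, hence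
  both identities carry an arbitrary condition on the root label. The negative term cancels exactly
  on these trees, which is why no signs survive. For the independence, the functionals are
  prescribed on monomials in the \<open>h_B\<close>, where the monomial relations of the ideal are
  not visible. What can be checked there is the quadratic relation (h_A - h_C)(h_B - h_C) = 0 for C
  the join of A and B; Moebius inversion turns it into the vanishing of products of variables of
  incomparable flats. This happens in the ring of the maximal building set, into which the given
  ring is mapped by sending \<open>x_G\<close> to the sum of the variables of all flats that have G
  as a factor.\<close>

locale loopless_matroid =
  fixes E :: "'a set" and indep :: "'a set \<Rightarrow> bool"
  assumes mat: "matroid E indep" and loopl: "loopless E indep"
begin

abbreviation rk :: "'a set \<Rightarrow> nat" where "rk \<equiv> mrank indep"
abbreviation cl :: "'a set \<Rightarrow> 'a set" where "cl \<equiv> mcl E indep"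
abbreviation flt :: "'a set \<Rightarrow> bool" where "flt \<equiv> flat E indep"

lemma finE: "finite E"
  and indep_sub: "indep X \<Longrightarrow> X \<subseteq> E"
  and indep_empty: "indep {}"
  and indep_mono: "indep Y \<Longrightarrow> X \<subseteq> Y \<Longrightarrow> indep X"
  and indep_aug: "indep X \<Longrightarrow> indep Y \<Longrightarrow> card X < card Y \<Longrightarrow> \<exists>e\<in>Y - X. indep (insert e X)"
  using mat unfolding matroid_def by blast+

lemma indep_fin: "indep X \<Longrightarrow> finite X"
  using indep_sub finE finite_subset by blast

lemma rk_set: "finite {card I | I. I \<subseteq> X \<and> indep I}" "{card I | I. I \<subseteq> X \<and> indep I} \<noteq> {}"
proof -
  have "{card I | I. I \<subseteq> X \<and> indep I} \<subseteq> {..card E}"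
    using indep_sub finE card_mono by fastforce
  then show "finite {card I | I. I \<subseteq> X \<and> indep I}" using finite_subset by blast
  show "{card I | I. I \<subseteq> X \<and> indep I} \<noteq> {}" using indep_empty by blast
qed

lemma rk_basis: "\<exists>I. I \<subseteq> X \<and> indep I \<and> card I = rk X"
  using Max_in[OF rk_set, of X] unfolding mrank_def by auto

lemma indep_le_rk: "I \<subseteq> X \<Longrightarrow> indep I \<Longrightarrow> card I \<le> rk X"
  unfolding mrank_def by (rule Max_ge[OF rk_set(1)]) auto

lemma rk_mono: "X \<subseteq> Y \<Longrightarrow> rk X \<le> rk Y"
  using rk_basis[of X] indep_le_rk[of _ Y] by (metis subset_trans)

lemma rk_le_card: "finite X \<Longrightarrow> rk X \<le> card X"
  using rk_basis[of X] card_mono by metis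

lemma rk_indep: "indep I \<Longrightarrow> rk I = card I"
  using indep_le_rk[of I I] rk_le_card[of I] indep_fin[of I] by simp

lemma indep_extend: "indep I \<Longrightarrow> I \<subseteq> X \<Longrightarrow> \<exists>B. I \<subseteq> B \<and> B \<subseteq> X \<and> indep B \<and> card B = rk X"
proof (induction "rk X - card I" arbitrary: I rule: less_induct)
  case less
  show ?case
  proof (cases "card I = rk X")
    case True then show ?thesis using less by blast
  next
    case False
    obtain Y where Y: "Y \<subseteq> X" "indep Y" "card Y = rk X" using rk_basis by blast
    have lt: "card I < card Y" using False indep_le_rk[OF less.prems(2,1)] Y by simp
    obtain e where e: "e \<in> Y - I" "indep (insert e I)" using indep_aug[OF less.prems(1) Y(2) lt] by blast
    have "card (insert e I) = Suc (card I)" using e indep_fin[OF less.prems(1)] by simp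
    then have "rk X - card (insert e I) < rk X - card I" using lt Y(3) by simp
    then show ?thesis using less.hyps[of "insert e I"] e Y less.prems by blast
  qed
qed

text \<open>A basis \<open>I\<close> of the intersection, extended to a basis \<open>B\<close> of
  the union, is all of \<open>B \<inter> X \<inter> Y\<close>; counting \<open>B\<close> inside
  \<open>X\<close> and inside \<open>Y\<close> gives the bound.\<close>

lemma rk_submod: "rk (X \<union> Y) + rk (X \<inter> Y) \<le> rk X + rk Y"
proof -
  obtain I where I: "I \<subseteq> X \<inter> Y" "indep I" "card I = rk (X \<inter> Y)" using rk_basis by blast
  obtain B where B: "I \<subseteq> B" "B \<subseteq> X \<union> Y" "indep B" "card B = rk (X \<union> Y)"
    using indep_extend[of I "X \<union> Y"] I by blast
  have fB: "finite B" using B indep_fin by blast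
  have "B \<inter> X \<inter> (B \<inter> Y) = I"
  proof
    have "card (B \<inter> (X \<inter> Y)) \<le> card I"
      using indep_le_rk[of "B \<inter> (X \<inter> Y)" "X \<inter> Y"] indep_mono[OF B(3)] I(3) by auto
    then have "I = B \<inter> (X \<inter> Y)" using card_seteq[of "B \<inter> (X \<inter> Y)" I] fB I B by auto
    then show "B \<inter> X \<inter> (B \<inter> Y) \<subseteq> I" by blast
  qed (use I B in auto)
  moreover have "B \<inter> X \<union> B \<inter> Y = B" using B by blast
  ultimately have "card B + card I = card (B \<inter> X) + card (B \<inter> Y)"
    using card_Un_Int[of "B \<inter> X" "B \<inter> Y"] fB by simp
  moreover have "card (B \<inter> X) \<le> rk X" "card (B \<inter> Y) \<le> rk Y"
    by (auto intro!: indep_le_rk indep_mono[OF B(3)])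
  ultimately show ?thesis using B I by simp
qed

lemma rk_empty [simp]: "rk {} = 0"
  using rk_indep[OF indep_empty] by simp

lemma rk_singleton: "e \<in> E \<Longrightarrow> rk {e} = 1"
  using loopl rk_indep[of "{e}"] unfolding loopless_def by simp

lemma rk_Un_le: "rk (X \<union> Y) \<le> rk X + rk Y"
  using rk_submod[of X Y] by simp

lemma rk_insert_le: "rk (insert e X) \<le> Suc (rk X)"
  using rk_Un_le[of "{e}" X] rk_le_card[of "{e}"] by simp

lemma cl_sub: "cl X \<subseteq> E" unfolding mcl_def by blast

lemma cl_ext: "X \<subseteq> E \<Longrightarrow> X \<subseteq> cl X" unfolding mcl_def by (auto simp: insert_absorb)

lemma in_cl: "e \<in> cl X \<longleftrightarrow> e \<in> E \<and> rk (insert e X) = rk X" unfolding mcl_def by blast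

lemma rk_insert_notin: "e \<in> E \<Longrightarrow> e \<notin> cl X \<Longrightarrow> rk (insert e X) = Suc (rk X)"
  using rk_insert_le[of e X] rk_mono[of X "insert e X"] in_cl by fastforce

lemma cl_mono: assumes "X \<subseteq> Y" shows "cl X \<subseteq> cl Y"
proof
  fix e assume "e \<in> cl X"
  then have e: "e \<in> E" "rk (insert e X) = rk X" by (auto simp: in_cl)
  have 1: "insert e X \<union> Y = insert e Y" "X \<subseteq> insert e X \<inter> Y" using assms by auto
  have "rk (insert e Y) + rk (insert e X \<inter> Y) \<le> rk (insert e X) + rk Y"
    using rk_submod[of "insert e X" Y] unfolding 1(1) .
  moreover have "rk X \<le> rk (insert e X \<inter> Y)" using 1(2) rk_mono by blast
  ultimately have "rk (insert e Y) \<le> rk Y" using e by simp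
  then show "e \<in> cl Y" using e rk_mono[of Y "insert e Y"] by (simp add: in_cl subset_insertI)
qed

lemma rk_Un_cl_sub: "finite C \<Longrightarrow> C \<subseteq> cl X \<Longrightarrow> rk (X \<union> C) = rk X"
proof (induction C rule: finite_induct)
  case (insert c C)
  have "c \<in> cl (X \<union> C)" using insert cl_mono[of X "X \<union> C"] by auto
  then show ?case using insert by (auto simp: in_cl)
qed simp

lemma rk_cl [simp]: "rk (cl X) = rk X"
proof -
  \<comment> \<open>\<open>X\<close> is not assumed to lie in \<open>E\<close>, so
    \<open>X \<subseteq> cl X\<close> may fail; a basis of \<open>X\<close> does lie in
    \<open>E\<close> and hence in \<open>cl X\<close>.\<close>
  obtain I where I: "I \<subseteq> X" "indep I" "card I = rk X" using rk_basis by blast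
  have "rk (X \<union> cl X) = rk X" using rk_Un_cl_sub[of "cl X" X] cl_sub finE finite_subset by blast
  moreover have "rk (cl X) \<le> rk (X \<union> cl X)" by (rule rk_mono) simp
  moreover have "I \<subseteq> cl X" using cl_ext[OF indep_sub[OF I(2)]] cl_mono[OF I(1)] by blast
  then have "rk X \<le> rk (cl X)" using indep_le_rk[of I "cl X"] I by simp
  ultimately show ?thesis by simp
qed

lemma cl_cl [simp]: "cl (cl X) = cl X"
proof
  show "cl (cl X) \<subseteq> cl X"
  proof
    fix e assume e: "e \<in> cl (cl X)"
    have 1: "rk (X \<union> (insert e (cl X))) = rk (insert e (cl X))" 
    proof -
      have "rk (insert e (cl X)) = rk X" using e by (simp add: in_cl)
      moreover have "rk ((X \<union> cl X) \<union> {e}) = rk (X \<union> cl X)"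
      proof (rule rk_Un_cl_sub)
        show "{e} \<subseteq> cl (X \<union> cl X)" using e cl_mono[of "cl X" "X \<union> cl X"] by blast
      qed simp
      moreover have "rk (X \<union> cl X) = rk X" using rk_Un_cl_sub[of "cl X" X] cl_sub finE finite_subset by blast
      ultimately show ?thesis by (simp add: Un_commute)
    qed
    have "rk (insert e X) \<le> rk (X \<union> (insert e (cl X)))" by (rule rk_mono) auto
    also have "\<dots> = rk X" using 1 e by (simp add: in_cl)
    finally show "e \<in> cl X" using e rk_mono[of X "insert e X"] by (simp add: in_cl subset_insertI)
  qed
qed (rule cl_ext[OF cl_sub])

lemma flat_cl [simp]: "flt (cl X)" unfolding flat_def using cl_sub by simp

lemma flat_sub: "flt F \<Longrightarrow> F \<subseteq> E" and flat_eq: "flt F \<Longrightarrow> cl F = F"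
  unfolding flat_def by auto

lemma flat_fin: "flt F \<Longrightarrow> finite F" using flat_sub finE finite_subset by blast

lemma fin_flats: "finite {F. flt F}"
  by (rule finite_subset[of _ "Pow E"]) (use flat_sub finE in auto)

lemma cl_least: "X \<subseteq> F \<Longrightarrow> flt F \<Longrightarrow> cl X \<subseteq> F"
  using cl_mono flat_eq by blast

lemma cl_sub_iff: "X \<subseteq> E \<Longrightarrow> flt F \<Longrightarrow> cl X \<subseteq> F \<longleftrightarrow> X \<subseteq> F"
  using cl_least cl_ext by blast

lemma flat_Int: assumes "flt F" "flt G" shows "flt (F \<inter> G)"
proof -
  have "cl (F \<inter> G) \<subseteq> F \<inter> G" using cl_least[of "F \<inter> G"] assms by blast
  then show ?thesis unfolding flat_def using cl_ext[of "F \<inter> G"] flat_sub[OF assms(1)] by blast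
qed

text \<open>Looplessness makes \<open>{}\<close> the bottom flat, so that it can stand for
  \<open>mcl E indep {}\<close> of the definitions from here on.\<close>

lemma cl_empty [simp]: "cl {} = {}"
  using rk_singleton in_cl by fastforce

lemma flat_empty [simp]: "flt {}" using flat_cl[of "{}"] by simp

lemma flat_E [simp]: "flt E" unfolding flat_def using cl_ext[of E] cl_sub by blast

lemma rk_flat_mono: assumes "flt F" "flt G" "F \<subset> G" shows "rk F < rk G"
proof -
  obtain e where e: "e \<in> G" "e \<notin> F" using assms by blast
  have "rk (insert e F) = Suc (rk F)" using rk_insert_notin[of e F] e assms flat_eq flat_sub by blast
  moreover have "rk (insert e F) \<le> rk G" using e assms by (intro rk_mono) auto
  ultimately show ?thesis by simp
qed

lemma flat_eqI: "flt F \<Longrightarrow> flt G \<Longrightarrow> F \<subseteq> G \<Longrightarrow> rk G \<le> rk F \<Longrightarrow> F = G"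
  using rk_flat_mono[of F G] by fastforce

lemma rk_flat_pos: "flt F \<Longrightarrow> F \<noteq> {} \<Longrightarrow> 0 < rk F"
  using rk_flat_mono[of "{}" F] by (simp add: psubset_eq)

lemma rk_insert_flat: "flt F \<Longrightarrow> e \<in> E \<Longrightarrow> e \<notin> F \<Longrightarrow> rk (insert e F) = Suc (rk F)"
  using rk_insert_notin[of e F] flat_eq by simp

lemma cl_Un_cl: assumes "X \<subseteq> E" "Y \<subseteq> E" shows "cl (cl X \<union> Y) = cl (X \<union> Y)"
proof
  have "cl X \<union> Y \<subseteq> cl (X \<union> Y)" using cl_mono[of X "X \<union> Y"] cl_ext[of "X \<union> Y"] assms by blast
  then show "cl (cl X \<union> Y) \<subseteq> cl (X \<union> Y)" using cl_least by simp
  show "cl (X \<union> Y) \<subseteq> cl (cl X \<union> Y)" by (rule cl_mono) (use cl_ext assms in blast)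
qed

lemma rk_Un_cl: assumes "X \<subseteq> E" "Y \<subseteq> E" shows "rk (cl X \<union> Y) = rk (X \<union> Y)"
  using cl_Un_cl[OF assms] rk_cl by metis

lemma ex_cover: assumes "flt J" "flt G" "J \<subset> G"
  shows "\<exists>H. flt H \<and> J \<subset> H \<and> H \<subseteq> G \<and> rk H = Suc (rk J)"
proof -
  obtain e where e: "e \<in> G" "e \<notin> J" using assms by blast
  have eE: "e \<in> E" and JE: "J \<subseteq> E" using e assms flat_sub by blast+
  have "insert e J \<subseteq> cl (insert e J)" using cl_ext eE JE by blast
  moreover have "cl (insert e J) \<subseteq> G" using e assms by (intro cl_least) auto
  moreover have "rk (cl (insert e J)) = Suc (rk J)" using rk_insert_flat assms e eE by simp
  ultimately show ?thesis using e by (intro exI[of _ "cl (insert e J)"]) auto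
qed

lemma ex_hyperplane: assumes "flt J" "flt G" "J \<subset> G"
  shows "\<exists>H. flt H \<and> J \<subseteq> H \<and> H \<subset> G \<and> rk G = Suc (rk H)"
  using assms
proof (induction "rk G - rk J" arbitrary: J rule: less_induct)
  case less
  obtain H where H: "flt H" "J \<subset> H" "H \<subseteq> G" "rk H = Suc (rk J)" using ex_cover[OF less.prems] by blast
  show ?case
  proof (cases "H = G")
    case True then show ?thesis using H less.prems by (intro exI[of _ J]) auto
  next
    case False
    then have "H \<subset> G" using H by blast
    moreover have "rk G - rk H < rk G - rk J" using H rk_flat_mono[OF less.prems] by simp
    ultimately obtain K where "flt K \<and> H \<subseteq> K \<and> K \<subset> G \<and> rk G = Suc (rk K)"
      using less.hyps[of H] H less.prems by blast
    then show ?thesis using H by blast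
  qed
qed

lemma hyperplane_insert: assumes "flt H" "flt G" "H \<subset> G" "rk G = Suc (rk H)" "e \<in> G" "e \<notin> H"
  shows "cl (insert e H) = G"
proof (rule flat_eqI)
  show "cl (insert e H) \<subseteq> G" using assms by (intro cl_least) auto
  show "rk G \<le> rk (cl (insert e H))" using assms rk_insert_flat[of H e] flat_sub[of G] by (simp add: subset_iff)
qed (use assms in auto)

end

section \<open>Factors of a flat with respect to a building set\<close>

locale building_set_matroid = loopless_matroid +
  fixes \<G> :: "'a set set"
  assumes build: "building_set E indep \<G>"
begin

abbreviation factors :: "'a set \<Rightarrow> 'a set set" where "factors \<equiv> maxG_below \<G>"

lemma G_flat: "G \<in> \<G> \<Longrightarrow> flt G" and G_ne: "G \<in> \<G> \<Longrightarrow> G \<noteq> {}"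
  using conjunct1[OF build[unfolded building_set_def]] by auto

lemma G_sub: "G \<in> \<G> \<Longrightarrow> G \<subseteq> E" using G_flat flat_sub by blast

lemma finG: "finite \<G>" by (rule finite_subset[of _ "Pow E"]) (use G_sub finE in auto)

lemma factors_G: "K \<in> factors F \<Longrightarrow> K \<in> \<G>" and factors_sub: "K \<in> factors F \<Longrightarrow> K \<subseteq> F"
  unfolding maxG_below_def by auto

lemma factors_flat: "K \<in> factors F \<Longrightarrow> flt K" and factors_ne: "K \<in> factors F \<Longrightarrow> K \<noteq> {}"
  using factors_G G_flat G_ne by auto

lemma fin_factors: "finite (factors F)" by (rule finite_subset[OF _ finG]) (use factors_G in auto)

lemma factors_empty [simp]: "factors {} = {}" using factors_ne factors_sub by fastforce

lemma ex_factor: assumes "G \<in> \<G>" "G \<subseteq> F" shows "\<exists>K\<in>factors F. G \<subseteq> K"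
proof -
  have "finite {H \<in> \<G>. H \<subseteq> F}" using finG by simp
  then obtain K where K: "K \<in> {H \<in> \<G>. H \<subseteq> F}" "G \<subseteq> K" "\<And>H. H \<in> {H \<in> \<G>. H \<subseteq> F} \<Longrightarrow> K \<subseteq> H \<Longrightarrow> K = H"
    using finite_has_maximal2[of "{H \<in> \<G>. H \<subseteq> F}" G] assms by auto
  then show ?thesis unfolding maxG_below_def by blast
qed

lemma factors_of_G [simp]: assumes "G \<in> \<G>" shows "factors G = {G}"
  using assms unfolding maxG_below_def by auto

definition below_prod :: "'a set \<Rightarrow> ('a set \<Rightarrow> 'a set) set" where
  "below_prod F = (\<Pi>\<^sub>E G \<in> factors F. {H. flt H \<and> H \<subseteq> G})"

lemma building_iso:
  assumes "flt F" "F \<noteq> {}"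
  shows "bij_betw (\<lambda>f. cl (\<Union>(f ` factors F))) (below_prod F) {H. flt H \<and> H \<subseteq> F}"
    and "f \<in> below_prod F \<Longrightarrow> g \<in> below_prod F \<Longrightarrow>
      (\<forall>G\<in>factors F. f G \<subseteq> g G) \<longleftrightarrow> cl (\<Union>(f ` factors F)) \<subseteq> cl (\<Union>(g ` factors F))"
proof -
  note c = conjunct2[OF build[unfolded building_set_def Let_def fjoin_def], rule_format, of F,
      folded below_prod_def]
  have F: "flt F \<and> F \<noteq> cl {}" using assms by simp
  show "bij_betw (\<lambda>f. cl (\<Union>(f ` factors F))) (below_prod F) {H. flt H \<and> H \<subseteq> F}"
    by (rule conjunct1[OF c[OF F]])
  show "f \<in> below_prod F \<Longrightarrow> g \<in> below_prod F \<Longrightarrow>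
      (\<forall>G\<in>factors F. f G \<subseteq> g G) \<longleftrightarrow> cl (\<Union>(f ` factors F)) \<subseteq> cl (\<Union>(g ` factors F))"
    using conjunct2[OF c[OF F]] by simp
qed

text \<open>Surjectivity of the join map: \<open>X\<close> is the join of pieces \<open>f K\<close>
  below the factors, and each piece already lies in \<open>X \<inter> K\<close>.\<close>

lemma flat_decomp_raw: assumes F: "flt F" and X: "flt X" "X \<subseteq> F"
  shows "X = cl (\<Union>K\<in>factors F. X \<inter> K)"
proof (cases "F = {}")
  case True then show ?thesis using X by simp
next
  case False
  have "X \<in> (\<lambda>f. cl (\<Union>(f ` factors F))) ` below_prod F"
    using bij_betw_imp_surj_on[OF building_iso(1)[OF F False]] X by simp
  then obtain f where f: "f \<in> below_prod F" "cl (\<Union>(f ` factors F)) = X" by blast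
  have "f K \<subseteq> X \<inter> K" if K: "K \<in> factors F" for K
  proof -
    have "\<Union>(f ` factors F) \<subseteq> E" using f(1) flat_sub unfolding below_prod_def by (auto dest!: PiE_mem)
    then have "f K \<subseteq> X" using cl_ext f(2) K by blast
    then show ?thesis using f(1) K unfolding below_prod_def by (auto dest: PiE_mem)
  qed
  then have "X \<subseteq> cl (\<Union>K\<in>factors F. X \<inter> K)"
    using f(2) cl_mono[of "\<Union>(f ` factors F)" "\<Union>K\<in>factors F. X \<inter> K"] by blast
  moreover have "cl (\<Union>K\<in>factors F. X \<inter> K) \<subseteq> X" by (rule cl_least) (use X in auto)
  ultimately show ?thesis by blast
qed

text \<open>Injectivity of the join map: the tuple with \<open>K \<inter> K'\<close> in coordinate
  \<open>K\<close> and the one with it in coordinate \<open>K'\<close>, both empty elsewhere, have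
  the same join.\<close>

lemma factors_disjoint:
  assumes F: "flt F" and K: "K \<in> factors F" "K' \<in> factors F" "K \<noteq> K'"
  shows "K \<inter> K' = {}"
proof -
  have ne: "F \<noteq> {}" using K(1) by auto
  have inj: "inj_on (\<lambda>f. cl (\<Union>(f ` factors F))) (below_prod F)"
    using bij_betw_imp_inj_on[OF building_iso(1)[OF F ne]] .
  define u where "u = (\<lambda>L. \<lambda>G\<in>factors F. if G = L then K \<inter> K' else {})"
  have kk: "flt (K \<inter> K')" using K flat_Int factors_flat by blast
  have "u K \<in> below_prod F" "u K' \<in> below_prod F" unfolding below_prod_def u_def using kk by auto
  moreover have "\<Union>(u K ` factors F) = K \<inter> K'" "\<Union>(u K' ` factors F) = K \<inter> K'"
    unfolding u_def using K by (auto split: if_splits)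
  ultimately have "u K = u K'" using inj_onD[OF inj, of "u K" "u K'"] by simp
  then have "u K K = u K' K" by simp
  then show ?thesis using K unfolding u_def by simp
qed

text \<open>A point of \<open>F\<close> spans a flat of rank 1. By the decomposition this flat meets
  some factor, and having rank 1 it lies inside that factor.\<close>

lemma Union_factors: assumes F: "flt F" shows "\<Union>(factors F) = F"
proof
  show "\<Union>(factors F) \<subseteq> F" using factors_sub by blast
  show "F \<subseteq> \<Union>(factors F)"
  proof
    fix e assume e: "e \<in> F"
    have eE: "e \<in> E" using e F flat_sub by blast
    have sub: "cl {e} \<subseteq> F" using e F by (intro cl_least) auto
    have "cl {e} \<noteq> {}" using cl_ext[of "{e}"] eE by auto
    then have "cl (\<Union>K\<in>factors F. cl {e} \<inter> K) \<noteq> {}" using flat_decomp_raw[OF F flat_cl sub] by simp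
    then have "(\<Union>K\<in>factors F. cl {e} \<inter> K) \<noteq> {}" using cl_empty by metis
    then obtain K where K: "K \<in> factors F" "cl {e} \<inter> K \<noteq> {}" by blast
    have "cl {e} \<inter> K = cl {e}"
    proof (rule flat_eqI)
      show "flt (cl {e} \<inter> K)" by (rule flat_Int[OF flat_cl factors_flat[OF K(1)]])
      then show "rk (cl {e}) \<le> rk (cl {e} \<inter> K)" using rk_flat_pos[OF _ K(2)] rk_singleton[OF eE] by simp
    qed auto
    then show "e \<in> \<Union>(factors F)" using K cl_ext[of "{e}"] eE by blast
  qed
qed

lemma G_in_one_factor:
  assumes "flt F" "K \<in> factors F" "G \<in> \<G>" "G \<subseteq> F" "G \<inter> K \<noteq> {}" shows "G \<subseteq> K"
proof -
  obtain K' where "K' \<in> factors F" "G \<subseteq> K'" using ex_factor assms by blast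
  then show ?thesis using factors_disjoint[OF assms(1), of K K'] assms by blast
qed

lemma flat_decomp: "flt F \<Longrightarrow> X \<subseteq> F \<Longrightarrow> X = (\<Union>K\<in>factors F. X \<inter> K)"
  using Union_factors by blast

lemma Union_factors_Int:
  assumes F: "flt F" and f: "\<And>K. K \<in> factors F \<Longrightarrow> f K \<subseteq> K" and K: "K \<in> factors F"
  shows "(\<Union>L\<in>factors F. f L) \<inter> K = f K"
  using factors_disjoint[OF F] f K by blast

text \<open>The join map reflects the order: the closure \<open>X\<close> of the union is also the
  join of its own traces \<open>X \<inter> K\<close>, so these traces are contained in the
  \<open>f K\<close> and the closure adds nothing. Joins of pieces in distinct factors are thus
  plain unions.\<close>

lemma flat_Union_factors:
  assumes F: "flt F" and f: "\<And>K. K \<in> factors F \<Longrightarrow> flt (f K)" "\<And>K. K \<in> factors F \<Longrightarrow> f K \<subseteq> K"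
  shows "flt (\<Union>K\<in>factors F. f K)"
proof (cases "F = {}")
  case False
  define X where "X = cl (\<Union>K\<in>factors F. f K)"
  have X: "flt X" unfolding X_def by simp
  have "(\<Union>K\<in>factors F. f K) \<subseteq> F" using f(2) factors_sub by blast
  then have XF: "X \<subseteq> F" unfolding X_def using F by (rule cl_least)
  define g where "g = (\<lambda>K\<in>factors F. X \<inter> K)"
  define f' where "f' = (\<lambda>K\<in>factors F. f K)"
  have D: "f' \<in> below_prod F" "g \<in> below_prod F" unfolding below_prod_def f'_def g_def using f X XF factors_flat flat_Int by auto
  have "cl (\<Union>(f' ` factors F)) = X" unfolding f'_def X_def by simp
  moreover have "cl (\<Union>(g ` factors F)) = X" unfolding g_def using flat_decomp_raw[OF F X XF] by simp
  ultimately have "\<forall>K\<in>factors F. g K \<subseteq> f' K" using building_iso(2)[OF F False D(2,1)] by simp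
  then have "\<forall>K\<in>factors F. X \<inter> K \<subseteq> f K" unfolding g_def f'_def by simp
  then have "X \<subseteq> (\<Union>K\<in>factors F. f K)" by (subst flat_decomp[OF F XF]) (rule UN_mono, auto)
  moreover have "(\<Union>K\<in>factors F. f K) \<subseteq> E" by (rule UN_least) (rule flat_sub[OF f(1)])
  then have "(\<Union>K\<in>factors F. f K) \<subseteq> X" unfolding X_def by (rule cl_ext)
  ultimately have "X = (\<Union>K\<in>factors F. f K)" by (rule equalityI)
  then show ?thesis using X by simp
qed simp

text \<open>Because they meet, both sets lie in the same factor of their join; this factor is then
  the join itself.\<close>

lemma G_Un: assumes "G \<in> \<G>" "H \<in> \<G>" "G \<inter> H \<noteq> {}" shows "cl (G \<union> H) \<in> \<G>"
proof -
  let ?F = "cl (G \<union> H)"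
  have sub: "G \<union> H \<subseteq> ?F" by (rule cl_ext) (use assms G_sub in blast)
  obtain K where K: "K \<in> factors ?F" "G \<subseteq> K" using ex_factor assms(1) sub by blast
  have "H \<subseteq> K" using G_in_one_factor[OF flat_cl K(1) assms(2)] sub K assms(3) by blast
  then have "?F \<subseteq> K" by (intro cl_least) (use K factors_flat in auto)
  then have "?F = K" using factors_sub K by blast
  then show ?thesis using K factors_G by simp
qed

lemma factors_subflat:
  assumes F: "flt F" and X: "X \<subseteq> F"
  shows "factors X = (\<Union>K\<in>factors F. factors (X \<inter> K))"
proof
  show "factors X \<subseteq> (\<Union>K\<in>factors F. factors (X \<inter> K))"
  proof
    fix L assume L: "L \<in> factors X"
    then obtain K where K: "K \<in> factors F" "L \<subseteq> K" using ex_factor X factors_G factors_sub by (meson subset_trans)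
    then have "L \<in> factors (X \<inter> K)" using L unfolding maxG_below_def by simp
    then show "L \<in> (\<Union>K\<in>factors F. factors (X \<inter> K))" using K by blast
  qed
  show "(\<Union>K\<in>factors F. factors (X \<inter> K)) \<subseteq> factors X"
  proof
    fix L assume "L \<in> (\<Union>K\<in>factors F. factors (X \<inter> K))"
    then obtain K where K: "K \<in> factors F" "L \<in> factors (X \<inter> K)" by blast
    have "H \<subseteq> K" if "H \<in> \<G>" "H \<subseteq> X" "L \<subset> H" for H
      using G_in_one_factor[OF F K(1) that(1)] that X factors_sub[OF K(2)] factors_ne[OF K(2)] by blast
    then show "L \<in> factors X" using K(2) unfolding maxG_below_def by simp (meson)
  qed
qed

text \<open>Subadditivity gives one inequality. For the other, a flat below \<open>F\<close> is
  lowered inside one factor at a time: replacing its trace there by a hyperplane of the trace gives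
  a strictly smaller flat, so the rank falls at least as fast as the sum of the ranks of the
  traces.\<close>

lemma rk_factors: assumes F: "flt F" shows "rk F = (\<Sum>K\<in>factors F. rk K)"
proof -
  have lower: "(\<Sum>K\<in>factors F. rk (X \<inter> K)) \<le> rk X" if "flt X" "X \<subseteq> F" for X
    using that
  proof (induction "card X" arbitrary: X rule: less_induct)
    case less
    show ?case
    proof (cases "X = {}")
      case False
      then obtain K where K: "K \<in> factors F" "X \<inter> K \<noteq> {}"
        using Union_factors[OF F] less.prems(2) by blast
      have XK: "flt (X \<inter> K)" using K factors_flat less.prems flat_Int by blast
      obtain Y where Y: "flt Y" "Y \<subset> X \<inter> K" "rk (X \<inter> K) = Suc (rk Y)"
        using ex_hyperplane[OF flat_empty XK] K by blast
      define f where "f = (\<lambda>L. if L = K then Y else X \<inter> L)"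
      define X' where "X' = (\<Union>L\<in>factors F. f L)"
      have fl: "f L \<subseteq> L" if "L \<in> factors F" for L unfolding f_def using Y by auto
      have flt: "flt (f L)" if "L \<in> factors F" for L
        unfolding f_def using Y that less.prems factors_flat flat_Int by auto
      have X': "flt X'" unfolding X'_def by (rule flat_Union_factors[OF F]) (use fl flt in auto)
      have int: "X' \<inter> L = f L" if "L \<in> factors F" for L
        unfolding X'_def by (rule Union_factors_Int[OF F]) (use fl that in auto)
      have "X' \<subseteq> X" unfolding X'_def f_def using Y by auto
      moreover have "X' \<inter> K \<noteq> X \<inter> K" using int[OF K(1)] Y unfolding f_def by auto
      ultimately have sub: "X' \<subset> X" by blast
      have "(\<Sum>L\<in>factors F. rk (X' \<inter> L)) \<le> rk X'"
        using less.hyps[of X'] sub X' less.prems psubset_card_mono[OF flat_fin[OF less.prems(1)] sub] by blast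
      moreover have "(\<Sum>L\<in>factors F. rk (X \<inter> L)) = Suc (\<Sum>L\<in>factors F. rk (X' \<inter> L))"
      proof -
        have "(\<Sum>L\<in>factors F. rk (X \<inter> L)) = rk (X \<inter> K) + (\<Sum>L\<in>factors F - {K}. rk (X \<inter> L))"
          using sum.remove[OF fin_factors K(1)] .
        moreover have "(\<Sum>L\<in>factors F. rk (X' \<inter> L)) = rk (X' \<inter> K) + (\<Sum>L\<in>factors F - {K}. rk (X' \<inter> L))"
          using sum.remove[OF fin_factors K(1)] .
        moreover have "(\<Sum>L\<in>factors F - {K}. rk (X \<inter> L)) = (\<Sum>L\<in>factors F - {K}. rk (X' \<inter> L))"
          by (rule sum.cong) (use int in \<open>auto simp: f_def\<close>)
        ultimately show ?thesis using int[OF K(1)] Y by (simp add: f_def)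
      qed
      moreover have "rk X' < rk X" using rk_flat_mono sub X' less.prems by blast
      ultimately show ?thesis by simp
    qed simp
  qed
  have "(\<Sum>K\<in>factors F. rk K) = (\<Sum>K\<in>factors F. rk (F \<inter> K))"
    by (rule sum.cong) (use factors_sub in \<open>auto simp: Int_absorb1\<close>)
  then have 1: "(\<Sum>K\<in>factors F. rk K) \<le> rk F" using lower[OF F] by simp
  have "rk (\<Union>\<A>) \<le> (\<Sum>K\<in>\<A>. rk K)" if "finite \<A>" for \<A> :: "'a set set"
    using that
  proof (induction \<A> rule: finite_induct)
    case (insert A \<A>)
    then show ?case using rk_Un_le[of A "\<Union>\<A>"] by simp
  qed simp
  from this[OF fin_factors] have "rk F \<le> (\<Sum>K\<in>factors F. rk K)" using Union_factors[OF F] by metis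
  then show ?thesis using 1 by simp
qed

end

section \<open>Nested sets with a given join\<close>

context building_set_matroid
begin

abbreviation nst :: "'a set set \<Rightarrow> bool" where "nst \<equiv> nested E indep \<G>"

lemma nst_G: "nst S \<Longrightarrow> X \<in> S \<Longrightarrow> X \<in> \<G>" unfolding nested_def by blast

lemma nst_fin: "nst S \<Longrightarrow> finite S" using finG finite_subset unfolding nested_def by blast

lemma nstI:
  assumes "S \<subseteq> \<G>" "\<And>B. B \<subseteq> S \<Longrightarrow> antichain_sets B \<Longrightarrow> 2 \<le> card B \<Longrightarrow> cl (\<Union>B) \<notin> \<G>"
  shows "nst S"
  unfolding nested_def fjoin_def
proof (intro conjI allI impI)
  fix A B assume "A \<subseteq> S" "antichain_sets A" "B \<subseteq> A" "finite B \<and> card B \<ge> 2"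
  moreover from this have "antichain_sets B" unfolding antichain_sets_def by blast
  ultimately show "cl (\<Union>B) \<notin> \<G>" using assms(2)[of B] by auto
qed (rule assms(1))

lemma nstD: assumes "nst S" "B \<subseteq> S" "antichain_sets B" "2 \<le> card B" shows "cl (\<Union>B) \<notin> \<G>"
  using assms card_ge_0_finite[of B] unfolding nested_def fjoin_def by auto

lemma nst_empty: "nst {}" by (rule nstI) auto

lemma nst_subset: assumes "nst S" "T \<subseteq> S" shows "nst T"
  by (rule nstI) (use assms nst_G nstD in \<open>blast+\<close>)

lemma antichain_pair: "\<not> X \<subseteq> Y \<Longrightarrow> \<not> Y \<subseteq> X \<Longrightarrow> antichain_sets {X, Y} \<and> card {X, Y} = 2"
  unfolding antichain_sets_def by (auto simp: card_insert_if)

lemma nst_comparable: assumes "nst S" "X \<in> S" "Y \<in> S" "X \<inter> Y \<noteq> {}" shows "X \<subseteq> Y \<or> Y \<subseteq> X"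
proof (rule ccontr)
  assume "\<not> (X \<subseteq> Y \<or> Y \<subseteq> X)"
  then have "antichain_sets {X, Y}" "card {X, Y} = 2" using antichain_pair[of X Y] by blast+
  then have "cl (\<Union>{X, Y}) \<notin> \<G>" using nstD[OF assms(1), of "{X, Y}"] assms by auto
  then show False using G_Un[of X Y] nst_G[OF assms(1)] assms by auto
qed

text \<open>The nested sets whose join is the flat \<open>F\<close>: the maximal elements of a nested set are exactly
  the factors of its join.\<close>

definition NS :: "'a set \<Rightarrow> 'a set set set" where
  "NS F = {S. nst S \<and> factors F \<subseteq> S \<and> S \<subseteq> Pow F}"

lemma NS_nst: "S \<in> NS F \<Longrightarrow> nst S" and NS_factors: "S \<in> NS F \<Longrightarrow> factors F \<subseteq> S"
  and NS_Pow: "S \<in> NS F \<Longrightarrow> S \<subseteq> Pow F"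
  unfolding NS_def by auto

lemma NS_G: "S \<in> NS F \<Longrightarrow> X \<in> S \<Longrightarrow> X \<in> \<G>" using NS_nst nst_G by blast

lemma NS_fin: "S \<in> NS F \<Longrightarrow> finite S" using NS_nst nst_fin by blast

lemma fin_NS: "finite (NS F)"
proof (rule finite_subset)
  show "NS F \<subseteq> Pow \<G>" using NS_G by blast
qed (use finG in simp)

lemma Union_NS: assumes "flt F" "S \<in> NS F" shows "\<Union>S = F"
  using Union_factors[OF assms(1)] NS_factors[OF assms(2)] NS_Pow[OF assms(2)] by blast

lemma NS_empty: "NS {} = {{}}"
proof -
  have "S = {}" if "S \<in> NS {}" for S using NS_G[OF that] NS_Pow[OF that] G_ne by blast
  moreover have "{} \<in> NS {}" unfolding NS_def using nst_empty by simp
  ultimately show ?thesis by blast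
qed

text \<open>The members of \<open>S\<close> below a factor \<open>K\<close> of the join must span
  \<open>K\<close>, since the flats spanned in the various factors have as union a flat containing
  all of \<open>S\<close>. The maximal ones among them form an antichain with join \<open>K\<close>
  in \<open>\<G>\<close>, so nestedness leaves only one, namely \<open>K\<close> itself.\<close>

lemma nst_NS: assumes S: "nst S" shows "S \<in> NS (cl (\<Union>S))"
proof -
  let ?J = "cl (\<Union>S)"
  have SE: "\<Union>S \<subseteq> E" using nst_G[OF S] G_sub by blast
  have sub: "X \<subseteq> ?J" if "X \<in> S" for X using cl_ext[OF SE] that by blast
  have "K \<in> S" if K: "K \<in> factors ?J" for K
  proof -
    define f where "f = (\<lambda>L. cl (\<Union>(S \<inter> Pow L)))"
    have f: "f L \<subseteq> L" if "L \<in> factors ?J" for L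
      unfolding f_def using factors_flat that by (intro cl_least) auto
    have flt: "flt (\<Union>L\<in>factors ?J. f L)"
      by (rule flat_Union_factors[OF flat_cl]) (use f in \<open>auto simp: f_def\<close>)
    have "X \<subseteq> (\<Union>L\<in>factors ?J. f L)" if X: "X \<in> S" for X
    proof -
      obtain L where L: "L \<in> factors ?J" "X \<subseteq> L" using ex_factor[OF nst_G[OF S X] sub[OF X]] by blast
      have "X \<subseteq> \<Union>(S \<inter> Pow L)" using X L by blast
      also have "\<dots> \<subseteq> f L" unfolding f_def by (rule cl_ext) (use SE in blast)
      finally show ?thesis using L by blast
    qed
    then have "?J \<subseteq> (\<Union>L\<in>factors ?J. f L)" by (intro cl_least flt) blast
    then have "K \<subseteq> (\<Union>L\<in>factors ?J. f L) \<inter> K" using factors_sub[OF K] by blast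
    also have "\<dots> = f K" by (rule Union_factors_Int[OF flat_cl _ K]) (rule f)
    finally have fK: "f K = K" using f[OF K] by blast
    define M where "M = {X \<in> S \<inter> Pow K. \<forall>Y\<in>S \<inter> Pow K. X \<subseteq> Y \<longrightarrow> X = Y}"
    have finK: "finite (S \<inter> Pow K)" using nst_fin[OF S] by simp
    have "\<Union>M = \<Union>(S \<inter> Pow K)"
    proof
      show "\<Union>(S \<inter> Pow K) \<subseteq> \<Union>M"
      proof
        fix x assume "x \<in> \<Union>(S \<inter> Pow K)"
        then obtain X where X: "X \<in> S \<inter> Pow K" "x \<in> X" by blast
        obtain Y where "Y \<in> S \<inter> Pow K" "X \<subseteq> Y" "\<forall>Z\<in>S \<inter> Pow K. Y \<subseteq> Z \<longrightarrow> Y = Z"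
          using finite_has_maximal2[OF finK X(1)] by auto
        then show "x \<in> \<Union>M" using X unfolding M_def by blast
      qed
    qed (auto simp: M_def)
    then have clM: "cl (\<Union>M) = K" using fK unfolding f_def by simp
    have "antichain_sets M" unfolding M_def antichain_sets_def by blast
    moreover have "M \<subseteq> S" unfolding M_def by blast
    ultimately have "\<not> 2 \<le> card M" using nstD[OF S] clM factors_G[OF K] by metis
    moreover have finM: "finite M" by (rule finite_subset[OF _ finK]) (auto simp: M_def)
    moreover have "M \<noteq> {}" using clM factors_ne[OF K] by auto
    ultimately have "card M = 1" using card_gt_0_iff[of M] by linarith
    then obtain X where X: "M = {X}" using card_1_singletonE by blast
    then have "X \<in> S" using \<open>M \<subseteq> S\<close> by blast
    moreover have "X = K" using clM X flat_eq[OF G_flat[OF nst_G[OF S \<open>X \<in> S\<close>]]] by simp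
    ultimately show ?thesis by simp
  qed
  then show ?thesis unfolding NS_def using S sub by blast
qed

lemma NS_cl_Union: assumes "flt F" "S \<in> NS F" shows "cl (\<Union>S) = F"
  using Union_NS[OF assms] flat_eq[OF assms(1)] by simp

lemma NS_not_mem: assumes "S \<in> NS J" "J \<subset> G" shows "G \<notin> S"
  using NS_Pow[OF assms(1)] assms(2) by blast

text \<open>An antichain with two members cannot contain \<open>G\<close>, because everything else
  lies below it.\<close>

lemma NS_insert: assumes G: "G \<in> \<G>" and J: "flt J" "J \<subset> G" and S: "S \<in> NS J"
  shows "insert G S \<in> NS G"
proof -
  have sub: "X \<subset> G" if "X \<in> S" for X using that NS_Pow[OF S] J by blast
  have "nst (insert G S)"
  proof (rule nstI)
    show "insert G S \<subseteq> \<G>" using G NS_G[OF S] by blast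
    fix B assume B: "B \<subseteq> insert G S" "antichain_sets B" "2 \<le> card B"
    have "G \<notin> B"
    proof
      assume "G \<in> B"
      then have "B \<subseteq> {G}" using B(1,2) sub unfolding antichain_sets_def by blast
      then show False using B(3) card_mono[of "{G}" B] by simp
    qed
    then have "B \<subseteq> S" using B by blast
    then show "cl (\<Union>B) \<notin> \<G>" using nstD[OF NS_nst[OF S]] B by blast
  qed
  then show ?thesis unfolding NS_def using G sub by auto
qed

lemma Jset_insert: assumes J: "flt J" "J \<subset> G" and S: "S \<in> NS J"
  shows "Jset E indep (insert G S) G = J"
proof -
  have "{H \<in> insert G S. H \<subset> G} = S" using NS_Pow[OF S] J by blast
  then show ?thesis unfolding Jset_def fjoin_def using NS_cl_Union[OF J(1) S] by simp
qed

lemma NS_G_mem: assumes "G \<in> \<G>" "T \<in> NS G" shows "G \<in> T"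
  using NS_factors[OF assms(2)] assms(1) by simp

lemma NS_cases: assumes G: "G \<in> \<G>" and T: "T \<in> NS G"
  obtains J S where "flt J" "J \<subset> G" "S \<in> NS J" "T = insert G S"
proof -
  define S where "S = T - {G}"
  define J where "J = cl (\<Union>S)"
  have S: "nst S" using nst_subset[OF NS_nst[OF T]] unfolding S_def by blast
  have "J \<subseteq> G" unfolding J_def
    by (rule cl_least) (use NS_Pow[OF T] G_flat[OF G] in \<open>auto simp: S_def\<close>)
  moreover have "J \<noteq> G"
  proof
    assume "J = G"
    then have "G \<in> S" using nst_NS[OF S] NS_factors[of S G] G unfolding J_def by simp
    then show False unfolding S_def by simp
  qed
  ultimately show ?thesis using that[of J S] nst_NS[OF S] NS_G_mem[OF G T] unfolding J_def S_def by auto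
qed

definition flats_below :: "'a set \<Rightarrow> 'a set set" where "flats_below G = {J. flt J \<and> J \<subset> G}"

lemma fin_flats_below: "finite (flats_below G)"
  unfolding flats_below_def by (rule finite_subset[OF _ fin_flats]) auto

lemma NS_G_eq: assumes G: "G \<in> \<G>"
  shows "NS G = (\<Union>J\<in>flats_below G. insert G ` NS J)"
proof
  show "NS G \<subseteq> (\<Union>J\<in>flats_below G. insert G ` NS J)"
  proof
    fix T assume "T \<in> NS G"
    then obtain J S where "flt J" "J \<subset> G" "S \<in> NS J" "T = insert G S" using NS_cases[OF G] by metis
    then show "T \<in> (\<Union>J\<in>flats_below G. insert G ` NS J)" unfolding flats_below_def by blast
  qed
  show "(\<Union>J\<in>flats_below G. insert G ` NS J) \<subseteq> NS G"
    using NS_insert[OF G] unfolding flats_below_def by auto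
qed

text \<open>The flat \<open>J\<close> is recovered from \<open>insert G S\<close> as
  \<open>Jset\<close>, so the union is disjoint. The family \<open>N\<close> is left open because
  such sums occur both over all nested sets and over the maximal ones.\<close>

lemma sum_insert_NS:
  assumes D: "D \<subseteq> flats_below G" and N: "\<And>J. N J \<subseteq> NS J"
  shows "(\<Sum>T\<in>(\<Union>J\<in>D. insert G ` N J). f T) = (\<Sum>J\<in>D. \<Sum>S\<in>N J. f (insert G S))"
proof -
  have J: "flt J" "J \<subset> G" if "J \<in> D" for J using that D unfolding flats_below_def by auto
  have "(\<Sum>T\<in>(\<Union>J\<in>D. insert G ` N J). f T) = (\<Sum>J\<in>D. sum f (insert G ` N J))"
  proof (rule sum.UNION_disjoint)
    show "finite D" using finite_subset[OF D fin_flats_below] .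
    show "\<forall>J\<in>D. finite (insert G ` N J)" using finite_subset[OF N fin_NS] by auto
    show "\<forall>J\<in>D. \<forall>J'\<in>D. J \<noteq> J' \<longrightarrow> insert G ` N J \<inter> insert G ` N J' = {}"
    proof (intro ballI impI, rule ccontr)
      fix J J' assume JJ: "J \<in> D" "J' \<in> D" "J \<noteq> J'" "insert G ` N J \<inter> insert G ` N J' \<noteq> {}"
      then obtain S S' where SS: "S \<in> N J" "S' \<in> N J'" "insert G S = insert G S'" by blast
      note S = subsetD[OF N SS(1)] subsetD[OF N SS(2)] SS(3)
      have "J = J'"
        using Jset_insert[OF J[OF JJ(1)] S(1)] Jset_insert[OF J[OF JJ(2)] S(2), folded S(3)] by (rule trans[OF sym])
      then show False using JJ(3) by simp
    qed
  qed
  also have "\<dots> = (\<Sum>J\<in>D. \<Sum>S\<in>N J. f (insert G S))"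
  proof (rule sum.cong[OF refl])
    fix J assume JD: "J \<in> D"
    have "inj_on (insert G) (N J)"
    proof (rule inj_onI)
      fix S S' assume S: "S \<in> N J" "S' \<in> N J" and eq: "insert G S = insert G S'"
      have "G \<notin> S" "G \<notin> S'" by (rule NS_not_mem[OF subsetD[OF N] J(2)[OF JD]], rule S)+
      then show "S = S'" using eq by (simp add: insert_ident)
    qed
    then show "sum f (insert G ` N J) = (\<Sum>S\<in>N J. f (insert G S))" by (simp add: sum.reindex)
  qed
  finally show ?thesis .
qed

section \<open>Gluing nested sets along the factors of a flat\<close>

lemma NS_glue:
  assumes F: "flt F" and f: "\<And>K. K \<in> factors F \<Longrightarrow> f K \<in> NS K"
  shows "(\<Union>K\<in>factors F. f K) \<in> NS F"
    and "K \<in> factors F \<Longrightarrow> (\<Union>L\<in>factors F. f L) \<inter> Pow K = f K"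
proof -
  have int: "(\<Union>L\<in>factors F. f L) \<inter> Pow K = f K" if K: "K \<in> factors F" for K
  proof
    show "f K \<subseteq> (\<Union>L\<in>factors F. f L) \<inter> Pow K" using NS_Pow[OF f[OF K]] K by blast
    show "(\<Union>L\<in>factors F. f L) \<inter> Pow K \<subseteq> f K"
    proof
      fix X assume "X \<in> (\<Union>L\<in>factors F. f L) \<inter> Pow K"
      then obtain L where L: "L \<in> factors F" "X \<in> f L" "X \<subseteq> K" by blast
      have "X \<noteq> {}" using G_ne[OF NS_G[OF f[OF L(1)] L(2)]] .
      then have "L = K" using factors_disjoint[OF F L(1) K] L(3) NS_Pow[OF f[OF L(1)]] L(2) by blast
      then show "X \<in> f K" using L by simp
    qed
  qed
  then show "K \<in> factors F \<Longrightarrow> (\<Union>L\<in>factors F. f L) \<inter> Pow K = f K" .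
  let ?S = "\<Union>K\<in>factors F. f K"
  have PF: "?S \<subseteq> Pow F"
  proof
    fix X assume "X \<in> ?S"
    then obtain K where "K \<in> factors F" "X \<in> f K" by blast
    then show "X \<in> Pow F" using NS_Pow[OF f] factors_sub by blast
  qed
  have "nst ?S"
  proof (rule nstI)
    show "?S \<subseteq> \<G>" using NS_G[OF f] by blast
    fix B assume B: "B \<subseteq> ?S" "antichain_sets B" "2 \<le> card B"
    show "cl (\<Union>B) \<notin> \<G>"
    proof
      assume G: "cl (\<Union>B) \<in> \<G>"
      have BF: "\<Union>B \<subseteq> F" using B(1) PF by blast
      have "cl (\<Union>B) \<subseteq> F" using cl_least[OF BF F] .
      \<comment> \<open>A join that belongs to \<open>\<G>\<close> lies below one factor, so the
        whole antichain comes from one \<open>f K\<close>, which is nested.\<close>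
      then obtain K where K: "K \<in> factors F" "cl (\<Union>B) \<subseteq> K" using ex_factor G by blast
      have "\<Union>B \<subseteq> K" using cl_ext[of "\<Union>B"] K BF flat_sub[OF F] by blast
      then have "B \<subseteq> ?S \<inter> Pow K" using B(1) by blast
      then have "B \<subseteq> f K" unfolding int[OF K(1)] .
      then show False using nstD[OF NS_nst[OF f[OF K(1)]] _ B(2,3)] G by simp
    qed
  qed
  moreover have "factors F \<subseteq> ?S"
  proof
    fix K assume K: "K \<in> factors F"
    show "K \<in> ?S" using NS_G_mem[OF factors_G[OF K] f[OF K]] K by (rule UN_I[rotated])
  qed
  ultimately show "?S \<in> NS F" unfolding NS_def using PF by blast
qed

lemma NS_restrict: assumes F: "flt F" and T: "T \<in> NS F" and K: "K \<in> factors F"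
  shows "T \<inter> Pow K \<in> NS K"
  unfolding NS_def using nst_subset[OF NS_nst[OF T], of "T \<inter> Pow K"] NS_factors[OF T] K factors_G[OF K] by auto

lemma NS_Union_restrict: assumes F: "flt F" and T: "T \<in> NS F"
  shows "(\<Union>K\<in>factors F. T \<inter> Pow K) = T"
proof
  show "T \<subseteq> (\<Union>K\<in>factors F. T \<inter> Pow K)"
  proof
    fix X assume X: "X \<in> T"
    then obtain K where "K \<in> factors F" "X \<subseteq> K"
      using ex_factor[OF NS_G[OF T X]] NS_Pow[OF T] by blast
    then show "X \<in> (\<Union>K\<in>factors F. T \<inter> Pow K)" using X by blast
  qed
qed blast

lemma NS_restrict_disjoint:
  assumes F: "flt F" and S: "S \<in> NS F" and K: "K \<in> factors F" "L \<in> factors F" "K \<noteq> L"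
  shows "(S \<inter> Pow K) \<inter> (S \<inter> Pow L) = {}"
proof -
  have "X = {}" if "X \<in> (S \<inter> Pow K) \<inter> (S \<inter> Pow L)" for X using that factors_disjoint[OF F K] by blast
  moreover have "{} \<notin> S" using G_ne NS_G[OF S] by blast
  ultimately show ?thesis by blast
qed

lemma prod_NS:
  fixes f :: "'a set \<Rightarrow> 'b::comm_monoid_mult"
  assumes F: "flt F" and S: "S \<in> NS F"
  shows "prod f S = (\<Prod>K\<in>factors F. prod f (S \<inter> Pow K))"
proof -
  have "prod f S = prod f (\<Union>K\<in>factors F. S \<inter> Pow K)" using NS_Union_restrict[OF F S] by simp
  also have "\<dots> = (\<Prod>K\<in>factors F. prod f (S \<inter> Pow K))"
    by (rule prod.UNION_disjoint) (use fin_factors NS_fin[OF S] NS_restrict_disjoint[OF F S] in auto)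
  finally show ?thesis .
qed

lemma glue_bij:
  assumes F: "flt F" and N: "\<And>K. K \<in> factors F \<Longrightarrow> N K \<subseteq> NS K"
  shows "bij_betw (\<lambda>f. \<Union>K\<in>factors F. f K) (Pi\<^sub>E (factors F) N)
    {T \<in> NS F. \<forall>K\<in>factors F. T \<inter> Pow K \<in> N K}"
proof (rule bij_betw_byWitness[where f' = "\<lambda>T. \<lambda>K\<in>factors F. T \<inter> Pow K"])
  have mem: "f K \<in> NS K" if "f \<in> Pi\<^sub>E (factors F) N" "K \<in> factors F" for f K
    using PiE_mem[OF that] N[OF that(2)] by blast
  show "\<forall>f\<in>Pi\<^sub>E (factors F) N. (\<lambda>K\<in>factors F. (\<Union>L\<in>factors F. f L) \<inter> Pow K) = f"
  proof
    fix f assume f: "f \<in> Pi\<^sub>E (factors F) N"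
    show "(\<lambda>K\<in>factors F. (\<Union>L\<in>factors F. f L) \<inter> Pow K) = f"
    proof
      fix K show "(\<lambda>K\<in>factors F. (\<Union>L\<in>factors F. f L) \<inter> Pow K) K = f K"
        using NS_glue(2)[OF F mem[OF f], of K] PiE_arb[OF f, of K] by (cases "K \<in> factors F") auto
    qed
  qed
  show "\<forall>T\<in>{T \<in> NS F. \<forall>K\<in>factors F. T \<inter> Pow K \<in> N K}.
      (\<Union>K\<in>factors F. (\<lambda>K\<in>factors F. T \<inter> Pow K) K) = T"
    using NS_Union_restrict[OF F] by simp
  show "(\<lambda>f. \<Union>K\<in>factors F. f K) ` Pi\<^sub>E (factors F) N \<subseteq> {T \<in> NS F. \<forall>K\<in>factors F. T \<inter> Pow K \<in> N K}"
  proof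
    fix T assume "T \<in> (\<lambda>f. \<Union>K\<in>factors F. f K) ` Pi\<^sub>E (factors F) N"
    then obtain f where f: "f \<in> Pi\<^sub>E (factors F) N" "T = (\<Union>K\<in>factors F. f K)" by blast
    show "T \<in> {T \<in> NS F. \<forall>K\<in>factors F. T \<inter> Pow K \<in> N K}"
      using NS_glue[OF F mem[OF f(1)]] PiE_mem[OF f(1)] f(2) by auto
  qed
  show "(\<lambda>T. \<lambda>K\<in>factors F. T \<inter> Pow K) ` {T \<in> NS F. \<forall>K\<in>factors F. T \<inter> Pow K \<in> N K} \<subseteq> Pi\<^sub>E (factors F) N"
    by auto
qed

lemma sum_glue:
  fixes g :: "'a set \<Rightarrow> 'a set set \<Rightarrow> 'b::comm_semiring_1"
  assumes F: "flt F" and N: "\<And>K. K \<in> factors F \<Longrightarrow> N K \<subseteq> NS K"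
  shows "(\<Sum>T\<in>{T \<in> NS F. \<forall>K\<in>factors F. T \<inter> Pow K \<in> N K}. \<Prod>K\<in>factors F. g K (T \<inter> Pow K))
    = (\<Prod>K\<in>factors F. \<Sum>T\<in>N K. g K T)"
proof -
  have "(\<Prod>K\<in>factors F. \<Sum>T\<in>N K. g K T) = (\<Sum>f\<in>Pi\<^sub>E (factors F) N. \<Prod>K\<in>factors F. g K (f K))"
    by (rule prod_sum_PiE[OF fin_factors finite_subset[OF N fin_NS]])
  also have "\<dots> = (\<Sum>f\<in>Pi\<^sub>E (factors F) N. \<Prod>K\<in>factors F. g K ((\<Union>L\<in>factors F. f L) \<inter> Pow K))"
  proof (intro sum.cong prod.cong refl)
    fix f K assume f: "f \<in> Pi\<^sub>E (factors F) N" and K: "K \<in> factors F"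
    have "f K \<in> NS K" if "K \<in> factors F" for K using PiE_mem[OF f that] N[OF that] by blast
    from NS_glue(2)[OF F this K] show "g K (f K) = g K ((\<Union>L\<in>factors F. f L) \<inter> Pow K)" by simp
  qed
  also have "\<dots> = (\<Sum>T\<in>{T \<in> NS F. \<forall>K\<in>factors F. T \<inter> Pow K \<in> N K}. \<Prod>K\<in>factors F. g K (T \<inter> Pow K))"
    by (rule sum.reindex_bij_betw[OF glue_bij[OF F N]])
  finally show ?thesis ..
qed

section \<open>Maximal nested sets with a given join\<close>

definition MN :: "'a set \<Rightarrow> 'a set set set" where
  "MN F = {S \<in> NS F. \<forall>T\<in>NS F. S \<subseteq> T \<longrightarrow> T = S}"

lemma MN_NS: "MN F \<subseteq> NS F" unfolding MN_def by blast

lemma fin_MN: "finite (MN F)" using finite_subset[OF MN_NS fin_NS] .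

lemma MN_empty: "MN {} = {{}}" unfolding MN_def NS_empty by auto

lemma MN_maxD: "S \<in> MN F \<Longrightarrow> T \<in> NS F \<Longrightarrow> S \<subseteq> T \<Longrightarrow> T = S" unfolding MN_def by blast

lemma MN_factors: assumes F: "flt F"
  shows "MN F = {T \<in> NS F. \<forall>K\<in>factors F. T \<inter> Pow K \<in> MN K}"
proof
  show "MN F \<subseteq> {T \<in> NS F. \<forall>K\<in>factors F. T \<inter> Pow K \<in> MN K}"
  proof
    fix T assume T: "T \<in> MN F"
    then have TN: "T \<in> NS F" using MN_NS by blast
    have "T \<inter> Pow K \<in> MN K" if K: "K \<in> factors F" for K
      unfolding MN_def
    proof (intro CollectI conjI ballI impI)
      show "T \<inter> Pow K \<in> NS K" using NS_restrict[OF F TN K] .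
      fix U assume U: "U \<in> NS K" "T \<inter> Pow K \<subseteq> U"
      define f where "f = (\<lambda>L. if L = K then U else T \<inter> Pow L)"
      have f: "f L \<in> NS L" if "L \<in> factors F" for L
        unfolding f_def using U NS_restrict[OF F TN that] by simp
      have "T \<inter> Pow L \<subseteq> f L" for L using U(2) unfolding f_def by simp
      then have "(\<Union>L\<in>factors F. T \<inter> Pow L) \<subseteq> (\<Union>L\<in>factors F. f L)" by (intro UN_mono) auto
      then have "T \<subseteq> (\<Union>L\<in>factors F. f L)" unfolding NS_Union_restrict[OF F TN] .
      then have "(\<Union>L\<in>factors F. f L) = T"
        by (rule MN_maxD[OF T NS_glue(1)[OF F], rotated]) (rule f)
      then show "U = T \<inter> Pow K" using NS_glue(2)[OF F f K] unfolding f_def by simp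
    qed
    then show "T \<in> {T \<in> NS F. \<forall>K\<in>factors F. T \<inter> Pow K \<in> MN K}" using TN by blast
  qed
  show "{T \<in> NS F. \<forall>K\<in>factors F. T \<inter> Pow K \<in> MN K} \<subseteq> MN F"
  proof
    fix T assume "T \<in> {T \<in> NS F. \<forall>K\<in>factors F. T \<inter> Pow K \<in> MN K}"
    then have T: "T \<in> NS F" "\<And>K. K \<in> factors F \<Longrightarrow> T \<inter> Pow K \<in> MN K" by simp_all
    show "T \<in> MN F" unfolding MN_def
    proof (intro CollectI conjI ballI impI)
      fix U assume U: "U \<in> NS F" "T \<subseteq> U"
      have "U \<inter> Pow K = T \<inter> Pow K" if K: "K \<in> factors F" for K
        by (rule MN_maxD[OF T(2)[OF K] NS_restrict[OF F U(1) K]]) (use U(2) in blast)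
      then have "(\<Union>K\<in>factors F. U \<inter> Pow K) = (\<Union>K\<in>factors F. T \<inter> Pow K)" by simp
      then show "U = T" using NS_Union_restrict[OF F] U(1) T(1) by simp
    qed (rule T(1))
  qed
qed

text \<open>In a factor \<open>K\<close> of \<open>H\<close>, the members of \<open>S\<close> below
  \<open>K\<close> have join \<open>J \<inter> K\<close>; either this is \<open>K\<close>, which
  then is already in \<open>S\<close>, or \<open>K\<close> can be put on top. This refinement is
  what keeps a maximal nested set from skipping ranks.\<close>

lemma NS_Un_factors: assumes H: "flt H" and J: "flt J" "J \<subseteq> H" and S: "S \<in> NS J"
  shows "S \<union> factors H \<in> NS H"
proof -
  define f where "f = (\<lambda>K. insert K (S \<inter> Pow (J \<inter> K)))"
  have f: "f K \<in> NS K" if K: "K \<in> factors H" for K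
  proof -
    have JK: "flt (J \<inter> K)" using flat_Int[OF J(1) factors_flat[OF K]] .
    have "factors (J \<inter> K) \<subseteq> S"
      using factors_subflat[OF H J(2)] NS_factors[OF S] K by blast
    then have 1: "S \<inter> Pow (J \<inter> K) \<in> NS (J \<inter> K)"
      unfolding NS_def using nst_subset[OF NS_nst[OF S], of "S \<inter> Pow (J \<inter> K)"] factors_sub by blast
    show ?thesis
    proof (cases "J \<inter> K = K")
      case True
      then have "K \<in> S" using \<open>factors (J \<inter> K) \<subseteq> S\<close> factors_G[OF K] by simp
      then have "f K = S \<inter> Pow (J \<inter> K)" using True unfolding f_def by blast
      then show ?thesis using 1 True by simp
    next
      case False
      then have "J \<inter> K \<subset> K" by blast
      then show ?thesis using NS_insert[OF factors_G[OF K] JK _ 1] unfolding f_def by blast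
    qed
  qed
  have "(\<Union>K\<in>factors H. f K) = S \<union> factors H"
  proof
    show "(\<Union>K\<in>factors H. f K) \<subseteq> S \<union> factors H" unfolding f_def by blast
    have "X \<in> (\<Union>K\<in>factors H. f K)" if X: "X \<in> S" for X
    proof -
      have "X \<subseteq> J" using NS_Pow[OF S] X by blast
      moreover obtain K where "K \<in> factors H" "X \<subseteq> K"
        using ex_factor[OF NS_G[OF S X]] J(2) \<open>X \<subseteq> J\<close> by blast
      ultimately show ?thesis using X unfolding f_def by blast
    qed
    then show "S \<union> factors H \<subseteq> (\<Union>K\<in>factors H. f K)" unfolding f_def by blast
  qed
  then show ?thesis using NS_glue(1)[OF H f] by simp
qed

definition hyperplanes :: "'a set \<Rightarrow> 'a set set" where
  "hyperplanes G = {H. flt H \<and> H \<subset> G \<and> rk G = Suc (rk H)}"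

lemma hyperplanes_sub: "hyperplanes G \<subseteq> flats_below G" unfolding hyperplanes_def flats_below_def by blast

lemma fin_hyperplanes: "finite (hyperplanes G)" using finite_subset[OF hyperplanes_sub fin_flats_below] .

text \<open>If the join \<open>J\<close> of the members below \<open>G\<close> were not a
  hyperplane, the factors of a hyperplane above \<open>J\<close> could still be added. Conversely,
  no flat fits strictly between a hyperplane and \<open>G\<close>.\<close>

lemma MN_G_eq: assumes G: "G \<in> \<G>"
  shows "MN G = (\<Union>H\<in>hyperplanes G. insert G ` MN H)"
proof
  show "MN G \<subseteq> (\<Union>H\<in>hyperplanes G. insert G ` MN H)"
  proof
    fix T assume T: "T \<in> MN G"
    then have "T \<in> NS G" using MN_NS by blast
    then obtain J S where J: "flt J" "J \<subset> G" "S \<in> NS J" "T = insert G S" using NS_cases[OF G] by metis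
    have GT: "G \<notin> S" using NS_not_mem[OF J(3,2)] .
    obtain H where H: "flt H" "J \<subseteq> H" "H \<subset> G" "rk G = Suc (rk H)"
      using ex_hyperplane[OF J(1) G_flat[OF G] J(2)] by blast
    have SH: "S \<union> factors H \<in> NS H" using NS_Un_factors[OF H(1) J(1) H(2) J(3)] .
    have "insert G (S \<union> factors H) = T"
      using MN_maxD[OF T NS_insert[OF G H(1,3) SH]] J(4) by blast
    then have "S \<union> factors H = S" using J(4) GT NS_not_mem[OF SH H(3)] by (simp add: insert_ident)
    then have "S \<in> NS H" using SH by metis
    then have JH: "J = H" using NS_cl_Union[OF H(1)] NS_cl_Union[OF J(1,3)] by metis
    have "S \<in> MN H" unfolding MN_def
    proof (intro CollectI conjI ballI impI)
      show "S \<in> NS H" using J(3) JH by simp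
      fix U assume U: "U \<in> NS H" "S \<subseteq> U"
      have "insert G U = T" using MN_maxD[OF T NS_insert[OF G H(1,3) U(1)]] U(2) J(4) by blast
      then show "U = S" using J(4) GT NS_not_mem[OF U(1) H(3)] by (simp add: insert_ident)
    qed
    then show "T \<in> (\<Union>H\<in>hyperplanes G. insert G ` MN H)" using H J(4) unfolding hyperplanes_def by blast
  qed
  show "(\<Union>H\<in>hyperplanes G. insert G ` MN H) \<subseteq> MN G"
  proof
    fix T assume "T \<in> (\<Union>H\<in>hyperplanes G. insert G ` MN H)"
    then obtain H S where H: "flt H" "H \<subset> G" "rk G = Suc (rk H)" "S \<in> MN H" "T = insert G S"
      unfolding hyperplanes_def by blast
    have S: "S \<in> NS H" using H(4) MN_NS by blast
    show "T \<in> MN G" unfolding MN_def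
    proof (intro CollectI conjI ballI impI)
      show "T \<in> NS G" using NS_insert[OF G H(1,2) S] H(5) by simp
      fix U assume U: "U \<in> NS G" "T \<subseteq> U"
      obtain J S' where J: "flt J" "J \<subset> G" "S' \<in> NS J" "U = insert G S'" using NS_cases[OF G U(1)] by metis
      have SS: "S \<subseteq> S'" using U(2) H(5) J(4) NS_not_mem[OF S H(2)] by blast
      have "H \<subseteq> J" using Union_NS[OF H(1) S] Union_NS[OF J(1,3)] SS by blast
      moreover have "rk J \<le> rk H" using rk_flat_mono[OF J(1) G_flat[OF G] J(2)] H(3) by simp
      ultimately have "H = J" using flat_eqI[OF H(1) J(1)] by blast
      then have "S' = S" using MN_maxD[OF H(4)] J(3) SS by blast
      then show "U = T" using J(4) H(5) by simp
    qed
  qed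
qed

text \<open>Every nested set extends by \<open>E\<close> to one with join \<open>E\<close>, so
  maximality among all nested sets agrees with maximality among those with join
  \<open>E\<close>.\<close>

lemma max_nested_iff: assumes E: "E \<in> \<G>" shows "max_nested E indep \<G> S \<longleftrightarrow> S \<in> MN E"
proof
  have ins: "insert E S \<in> NS E" if S: "nst S" for S
  proof (cases "E \<in> S")
    case True
    then have "\<Union>S = E" using nst_G[OF S] G_sub by blast
    then show ?thesis using nst_NS[OF S] True flat_eq[OF flat_E] by (simp add: insert_absorb)
  next
    case False
    have "\<Union>S \<subseteq> E" using nst_G[OF S] G_sub by blast
    moreover have "cl (\<Union>S) \<noteq> E"
      using False nst_NS[OF S] NS_factors[of S E] E by auto
    ultimately have "cl (\<Union>S) \<subset> E" using cl_sub by blast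
    then show ?thesis using NS_insert[OF E flat_cl _ nst_NS[OF S]] by blast
  qed
  { assume m: "max_nested E indep \<G> S"
    then have S: "nst S" and mx: "\<And>T. nst T \<Longrightarrow> S \<subseteq> T \<Longrightarrow> T = S" unfolding max_nested_def by auto
    have "insert E S = S" using mx[OF NS_nst[OF ins[OF S]]] by blast
    then have "S \<in> NS E" using ins[OF S] by simp
    then show "S \<in> MN E" unfolding MN_def using mx NS_nst by blast }
  assume S: "S \<in> MN E"
  then have SN: "S \<in> NS E" using MN_NS by blast
  have "T = S" if T: "nst T" "S \<subseteq> T" for T
  proof -
    have "insert E T = S" using MN_maxD[OF S ins[OF T(1)]] T(2) by blast
    then show ?thesis using T(2) by blast
  qed
  then show "max_nested E indep \<G> S" unfolding max_nested_def using NS_nst[OF SN] by blast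
qed

end

section \<open>Descents in a grafted tree\<close>

text \<open>Stated for an arbitrary relation, so that the converse order yields greatest
  elements.\<close>

lemma strict_total_on_least:
  assumes r: "strict_total_on E r" and X: "finite X" "X \<noteq> {}" "X \<subseteq> E"
  shows "\<exists>m\<in>X. \<forall>y\<in>X. y \<noteq> m \<longrightarrow> r m y"
  using X
proof (induction X rule: finite_ne_induct)
  case (insert x X)
  then obtain m where m: "m \<in> X" "\<forall>y\<in>X. y \<noteq> m \<longrightarrow> r m y" by blast
  have E: "m \<in> E" "x \<in> E" "m \<noteq> x" using m(1) insert.prems insert.hyps by auto
  show ?case
  proof (cases "r m x")
    case True then show ?thesis using m by (intro bexI[of _ m]) auto
  next
    case False
    then have mx: "r x m" using r E unfolding strict_total_on_def by blast
    have "r x y" if "y \<in> X" for y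
    proof (cases "y = m")
      case False
      then have "r m y" "y \<in> E" using m that insert.prems by auto
      then show ?thesis using r E mx unfolding strict_total_on_def by blast
    qed (use mx in simp)
    then show ?thesis by (intro bexI[of _ x]) auto
  qed
qed simp

locale ordered_building_set = building_set_matroid +
  fixes lt :: "'a \<Rightarrow> 'a \<Rightarrow> bool"
  assumes lt_total: "strict_total_on E lt"
begin

lemma lt_irrefl: "x \<in> E \<Longrightarrow> \<not> lt x x"
  and lt_trans: "x \<in> E \<Longrightarrow> y \<in> E \<Longrightarrow> z \<in> E \<Longrightarrow> lt x y \<Longrightarrow> lt y z \<Longrightarrow> lt x z"
  and lt_linear: "x \<in> E \<Longrightarrow> y \<in> E \<Longrightarrow> x \<noteq> y \<Longrightarrow> lt x y \<or> lt y x"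
  using lt_total unfolding strict_total_on_def by blast+

lemma lt_not_sym: "x \<in> E \<Longrightarrow> y \<in> E \<Longrightarrow> lt x y \<Longrightarrow> \<not> lt y x"
  using lt_trans[of x y x] lt_irrefl by blast

lemma ex_lt_least:
  assumes "finite X" "X \<noteq> {}" "X \<subseteq> E"
  shows "\<exists>m\<in>X. \<forall>y\<in>X. y \<noteq> m \<longrightarrow> lt m y"
  using strict_total_on_least[OF lt_total assms] .

lemma ex_lt_greatest:
  assumes "finite X" "X \<noteq> {}" "X \<subseteq> E"
  shows "\<exists>m\<in>X. \<forall>y\<in>X. y \<noteq> m \<longrightarrow> lt y m"
proof -
  have "strict_total_on E (\<lambda>x y. lt y x)" using lt_total unfolding strict_total_on_def by blast
  from strict_total_on_least[OF this assms] show ?thesis .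
qed

lemma lt_min_eqI:
  assumes "x \<in> X" "X \<subseteq> E" "\<And>y. y \<in> X \<Longrightarrow> y \<noteq> x \<Longrightarrow> lt x y"
  shows "lt_min lt X = x"
  unfolding lt_min_def
proof (rule the_equality)
  fix z assume z: "z \<in> X \<and> (\<forall>y\<in>X. y \<noteq> z \<longrightarrow> lt z y)"
  show "z = x"
  proof (rule ccontr)
    assume "z \<noteq> x"
    then have "lt z x" "lt x z" using z assms by auto
    then show False using lt_not_sym[of z x] z assms by blast
  qed
qed (use assms in blast)

lemma lt_min_in: assumes "X \<noteq> {}" "X \<subseteq> E"
  shows "lt_min lt X \<in> X" and "y \<in> X \<Longrightarrow> y \<noteq> lt_min lt X \<Longrightarrow> lt (lt_min lt X) y"
proof -
  obtain m where m: "m \<in> X" "\<forall>y\<in>X. y \<noteq> m \<longrightarrow> lt m y"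
    using ex_lt_least[of X] assms finite_subset[OF assms(2) finE] by blast
  have eq: "lt_min lt X = m" by (rule lt_min_eqI) (use m assms in auto)
  show "lt_min lt X \<in> X" using eq m by simp
  show "y \<in> X \<Longrightarrow> y \<noteq> lt_min lt X \<Longrightarrow> lt (lt_min lt X) y" using eq m by simp
qed

abbreviation lb :: "'a set set \<Rightarrow> 'a set \<Rightarrow> 'a" where "lb \<equiv> lab E indep lt"
abbreviation dsc :: "'a set set \<Rightarrow> 'a set \<Rightarrow> bool" where "dsc \<equiv> descent E indep lt"

definition nondesc_child :: "'a set set \<Rightarrow> 'a set \<Rightarrow> bool" where
  "nondesc_child T X \<longleftrightarrow> (\<exists>Y\<in>children T X. \<not> dsc T Y)"

lemma parent_eqI:
  assumes "P \<in> T" "X \<subset> P" "\<And>Z. Z \<in> T \<Longrightarrow> X \<subset> Z \<Longrightarrow> P \<subseteq> Z"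
  shows "parent T X = P"
  unfolding parent_def
proof (rule the_equality)
  fix H assume H: "H \<in> T \<and> X \<subset> H \<and> (\<forall>H'\<in>T. X \<subset> H' \<longrightarrow> H \<subseteq> H')"
  then have "H \<subseteq> P" "P \<subseteq> H" using assms by auto
  then show "H = P" by (rule equalityI)
qed (use assms in blast)

text \<open>The members of \<open>T\<close> above \<open>X\<close> share the points of the nonempty
  set \<open>X\<close>, so they are pairwise comparable and a minimal one is the least.\<close>

lemma parent_props:
  assumes T: "nst T" and X: "X \<in> T" "\<not> is_max_in T X"
  shows "parent T X \<in> T" "X \<subset> parent T X" "\<And>Z. Z \<in> T \<Longrightarrow> X \<subset> Z \<Longrightarrow> parent T X \<subseteq> Z"
proof -
  let ?A = "{Z \<in> T. X \<subset> Z}"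
  have "finite ?A" using nst_fin[OF T] by simp
  moreover have "?A \<noteq> {}" using X unfolding is_max_in_def by blast
  ultimately obtain P where P: "P \<in> ?A" "\<And>Z. Z \<in> ?A \<Longrightarrow> Z \<subseteq> P \<Longrightarrow> P = Z"
    using finite_has_minimal[of ?A] by auto
  have ne: "X \<noteq> {}" using G_ne[OF nst_G[OF T X(1)]] .
  have *: "P \<subseteq> Z" if "Z \<in> T" "X \<subset> Z" for Z
  proof -
    have "P \<subseteq> Z \<or> Z \<subseteq> P" by (rule nst_comparable[OF T]) (use P(1) that ne in auto)
    then show ?thesis using P(2)[of Z] that by auto
  qed
  have "parent T X = P" by (rule parent_eqI) (use P(1) * in auto)
  then show "parent T X \<in> T" "X \<subset> parent T X" "\<And>Z. Z \<in> T \<Longrightarrow> X \<subset> Z \<Longrightarrow> parent T X \<subseteq> Z"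
    using P(1) * by auto
qed

lemma is_max_NS: assumes "G \<in> \<G>" "T \<in> NS G" "X \<in> T" shows "is_max_in T X \<longleftrightarrow> X = G"
  unfolding is_max_in_def using NS_G_mem[OF assms(1,2)] NS_Pow[OF assms(2)] assms(3) by blast

text \<open>Over a hyperplane every element of \<open>G - H\<close> generates \<open>G\<close>, so
  the label of the root depends on the nested set only through \<open>H\<close>.\<close>

lemma lab_hyp:
  assumes H: "H \<in> hyperplanes G" and G: "G \<in> \<G>" and S: "S \<in> NS H"
  shows "lb (insert G S) G = lt_min lt (G - H)"
proof -
  have H': "flt H" "H \<subset> G" "rk G = Suc (rk H)" using H unfolding hyperplanes_def by auto
  have "{e \<in> E. cl (insert e H) = G} = G - H"
  proof
    show "G - H \<subseteq> {e \<in> E. cl (insert e H) = G}"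
      using hyperplane_insert[OF H'(1) G_flat[OF G] H'(2,3)] G_sub[OF G] by blast
    show "{e \<in> E. cl (insert e H) = G} \<subseteq> G - H"
    proof
      fix e assume "e \<in> {e \<in> E. cl (insert e H) = G}"
      then have e: "e \<in> E" "cl (insert e H) = G" by auto
      have "insert e H \<subseteq> cl (insert e H)" by (rule cl_ext) (use e flat_sub[OF H'(1)] in simp)
      then have "e \<in> G" using e by blast
      moreover have "e \<notin> H"
      proof
        assume "e \<in> H"
        then have "cl (insert e H) = H" using flat_eq[OF H'(1)] by (simp add: insert_absorb)
        then show False using e H' by simp
      qed
      ultimately show "e \<in> G - H" by blast
    qed
  qed
  then show ?thesis unfolding lab_def Jset_insert[OF H'(1,2) S] by simp
qed

end

text \<open>\<open>T\<close> arises from nested sets \<open>SK K\<close> on the factors \<open>K\<close> of \<open>H\<close> by adding the root \<open>G\<close>.\<close>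

locale grafted = ordered_building_set +
  fixes G H S
  assumes G: "G \<in> \<G>" and H: "flt H" "H \<subset> G" and S: "S \<in> NS H"
begin

abbreviation "T \<equiv> insert G S"
abbreviation "SK K \<equiv> S \<inter> Pow K"

lemma T_NS: "T \<in> NS G" using NS_insert[OF G H S] .

lemma SK_NS: "K \<in> factors H \<Longrightarrow> SK K \<in> NS K" using NS_restrict[OF H(1) S] .

lemma K_SK: "K \<in> factors H \<Longrightarrow> K \<in> SK K" using NS_G_mem[OF factors_G SK_NS] .

lemma K_sub_G: "K \<in> factors H \<Longrightarrow> K \<subset> G" using factors_sub[of K H] H(2) by blast

lemma mem_SK:
  assumes K: "K \<in> factors H" and X: "X \<in> SK K" and Z: "Z \<in> T" "X \<subseteq> Z" shows "Z = G \<or> Z \<in> SK K"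
proof (cases "Z = G")
  case False
  then have ZS: "Z \<in> S" using Z by simp
  have "X \<noteq> {}" using G_ne[OF NS_G[OF SK_NS[OF K] X]] .
  then have "Z \<inter> K \<noteq> {}" using X Z(2) by blast
  then have "Z \<subseteq> K" using G_in_one_factor[OF H(1) K NS_G[OF S ZS]] NS_Pow[OF S] ZS by blast
  then show ?thesis using ZS by simp
qed simp

lemma lab_SK: assumes K: "K \<in> factors H" and X: "X \<in> SK K" shows "lb T X = lb (SK K) X"
proof -
  have "{Y \<in> T. Y \<subset> X} = {Y \<in> SK K. Y \<subset> X}" using X K_sub_G[OF K] by blast
  then show ?thesis unfolding lab_def Jset_def by simp
qed

lemma max_T: "X \<in> T \<Longrightarrow> is_max_in T X \<longleftrightarrow> X = G" using is_max_NS[OF G T_NS] .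

lemma max_SK: "K \<in> factors H \<Longrightarrow> X \<in> SK K \<Longrightarrow> is_max_in (SK K) X \<longleftrightarrow> X = K"
  using is_max_NS[OF factors_G SK_NS] .

lemma G_notin_SK: "K \<in> factors H \<Longrightarrow> G \<notin> SK K" using K_sub_G by blast

lemma parent_SK:
  assumes K: "K \<in> factors H" and X: "X \<in> SK K" "X \<noteq> K"
  shows "parent T X = parent (SK K) X" "parent (SK K) X \<in> SK K" "X \<subset> parent (SK K) X"
proof -
  note p = parent_props[OF NS_nst[OF SK_NS[OF K]] X(1)] 
  have nm: "\<not> is_max_in (SK K) X" using max_SK[OF K X(1)] X(2) by simp
  note p = p[OF nm]
  show "parent (SK K) X \<in> SK K" "X \<subset> parent (SK K) X" using p by auto
  show "parent T X = parent (SK K) X"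
  proof (rule parent_eqI)
    show "parent (SK K) X \<in> T" "X \<subset> parent (SK K) X" using p by auto
    fix Z assume Z: "Z \<in> T" "X \<subset> Z"
    then have "Z = G \<or> Z \<in> SK K" using mem_SK[OF K X(1)] by blast
    then show "parent (SK K) X \<subseteq> Z" using p Z(2) K_sub_G[OF K] by blast
  qed
qed

lemma parent_K: assumes K: "K \<in> factors H" shows "parent T K = G"
proof (rule parent_eqI)
  show "K \<subset> G" using K_sub_G[OF K] .
  fix Z assume Z: "Z \<in> T" "K \<subset> Z"
  then have "Z = G \<or> Z \<in> SK K" using mem_SK[OF K K_SK[OF K]] by blast
  then show "G \<subseteq> Z" using Z by blast
qed simp

lemma T_cases: assumes "X \<in> T" obtains "X = G" | K where "K \<in> factors H" "X \<in> SK K"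
proof (cases "X = G")
  case False
  then have "X \<in> (\<Union>K\<in>factors H. SK K)" using assms NS_Union_restrict[OF H(1) S] by simp
  then show ?thesis using that(2) by blast
qed (use that in blast)

lemma dsc_K: "K \<in> factors H \<Longrightarrow> dsc T K \<longleftrightarrow> lt (lb T G) (lb (SK K) K)"
  unfolding descent_def using max_T[of K] parent_K[of K] lab_SK[of K K] K_SK[of K] K_sub_G[of K] by auto

lemma dsc_SK: assumes K: "K \<in> factors H" and X: "X \<in> SK K" "X \<noteq> K"
  shows "dsc T X \<longleftrightarrow> dsc (SK K) X"
proof -
  have "X \<in> T" "X \<noteq> G" using X K_sub_G[OF K] by auto
  then show ?thesis unfolding descent_def
    using max_T[of X] max_SK[OF K X(1)] X parent_SK[OF K X] lab_SK[OF K X(1)] lab_SK[OF K, of "parent (SK K) X"]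
    by simp
qed

lemma children_SK: assumes K: "K \<in> factors H" and X: "X \<in> SK K" shows "children T X = children (SK K) X"
proof
  show "children T X \<subseteq> children (SK K) X"
  proof
    fix Y assume "Y \<in> children T X"
    then have Y: "Y \<in> T" "\<not> is_max_in T Y" "parent T Y = X" unfolding children_def by auto
    have "Y \<subset> X" using parent_props(2)[OF NS_nst[OF T_NS] Y(1,2)] Y(3) by simp
    then have YK: "Y \<in> SK K" "Y \<noteq> K" using Y(1) X K_sub_G[OF K] by auto
    then show "Y \<in> children (SK K) X" unfolding children_def
      using max_SK[OF K YK(1)] parent_SK(1)[OF K YK] Y(3) by simp
  qed
  show "children (SK K) X \<subseteq> children T X"
  proof
    fix Y assume "Y \<in> children (SK K) X"
    then have Y: "Y \<in> SK K" "Y \<noteq> K" "parent (SK K) Y = X" unfolding children_def using max_SK[OF K] by auto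
    have "Y \<in> T" "Y \<noteq> G" using Y K_sub_G[OF K] by auto
    then show "Y \<in> children T X" unfolding children_def
      using max_T[of Y] parent_SK(1)[OF K Y(1,2)] Y(3) by simp
  qed
qed

lemma children_G: "children T G = factors H"
proof
  show "factors H \<subseteq> children T G"
  proof
    fix K assume K: "K \<in> factors H"
    then have "K \<in> T" "K \<noteq> G" using K_SK[OF K] K_sub_G[OF K] by auto
    then show "K \<in> children T G" unfolding children_def using max_T[of K] parent_K[OF K] by simp
  qed
  show "children T G \<subseteq> factors H"
  proof
    fix Y assume "Y \<in> children T G"
    then have Y: "Y \<in> T" "Y \<noteq> G" "parent T Y = G" unfolding children_def using max_T by auto
    then obtain K where K: "K \<in> factors H" "Y \<in> SK K" using T_cases[of Y] by metis
    have "Y = K"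
    proof (rule ccontr)
      assume "Y \<noteq> K"
      then have "G \<in> SK K" using parent_SK(1,2)[OF K] Y(3) by simp
      then show False using G_notin_SK[OF K(1)] by simp
    qed
    then show "Y \<in> factors H" using K by simp
  qed
qed

lemma nondesc_child_SK: assumes K: "K \<in> factors H" and X: "X \<in> SK K"
  shows "nondesc_child T X \<longleftrightarrow> nondesc_child (SK K) X"
proof -
  have "dsc T Y \<longleftrightarrow> dsc (SK K) Y" if "Y \<in> children (SK K) X" for Y
    using that max_SK[OF K] unfolding children_def by (intro dsc_SK[OF K]) auto
  then show ?thesis unfolding nondesc_child_def children_SK[OF K X] by blast
qed

lemma nondesc_child_G: "nondesc_child T G \<longleftrightarrow> (\<exists>K\<in>factors H. \<not> lt (lb T G) (lb (SK K) K))"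
  unfolding nondesc_child_def children_G using dsc_K by blast

end

context ordered_building_set
begin

text \<open>The value 0 removes exactly the maximal nested sets with a bottom or a double descent,
  compare \<open>stable_iff\<close>.\<close>

definition node_weight :: "'a set set \<Rightarrow> 'a set \<Rightarrow> rat poly" where
  "node_weight T X = (if dsc T X then (if nondesc_child T X then [:0, 1:] else 0)
    else (if nondesc_child T X then [:1, 1:] else 1))"

text \<open>The root is never a descent of its own tree; \<open>c\<close> and \<open>d\<close> prescribe its weight, so that \<open>wR\<close>
  is the weight of a whole tree and \<open>wA\<close> that of a subtree whose root is a descent.\<close>

definition tree_weight :: "rat poly \<Rightarrow> rat poly \<Rightarrow> 'a set \<Rightarrow> 'a set set \<Rightarrow> rat poly" where
  "tree_weight c d G T = (if nondesc_child T G then c else d) * (\<Prod>X\<in>T - {G}. node_weight T X)"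

abbreviation "wR \<equiv> tree_weight [:1, 1:] 1"
abbreviation "wA \<equiv> tree_weight [:0, 1:] 0"

end

context grafted
begin

text \<open>Grafting alters the status of the root \<open>K\<close> of a subtree only: it is never a
  descent in its own tree but may become one below \<open>G\<close>. Adjusting the weight of that
  root exchanges \<open>wR\<close> for \<open>wA\<close>.\<close>

lemma prod_node_weight_SK:
  assumes K: "K \<in> factors H"
  shows "prod (node_weight T) (SK K) = (if lt (lb T G) (lb (SK K) K) then wA K (SK K) else wR K (SK K))"
proof -
  have "prod (node_weight T) (SK K) = node_weight T K * prod (node_weight T) (SK K - {K})"
    using prod.remove[OF _ K_SK[OF K]] NS_fin[OF SK_NS[OF K]] by blast
  moreover have "prod (node_weight T) (SK K - {K}) = prod (node_weight (SK K)) (SK K - {K})"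
    by (rule prod.cong) (use dsc_SK[OF K] nondesc_child_SK[OF K] in \<open>auto simp: node_weight_def\<close>)
  ultimately show ?thesis
    unfolding tree_weight_def node_weight_def[of T K] dsc_K[OF K] nondesc_child_SK[OF K K_SK[OF K]] by simp
qed

lemma tree_weight_graft:
  "tree_weight c d G T = (if \<exists>K\<in>factors H. \<not> lt (lb T G) (lb (SK K) K) then c else d) *
    (\<Prod>K\<in>factors H. if lt (lb T G) (lb (SK K) K) then wA K (SK K) else wR K (SK K))"
proof -
  have "T - {G} = S" using NS_not_mem[OF S H(2)] by simp
  then have "(\<Prod>X\<in>T - {G}. node_weight T X) = (\<Prod>K\<in>factors H. prod (node_weight T) (SK K))"
    using prod_NS[OF H(1) S, of "node_weight T"] by simp
  also have "\<dots> = (\<Prod>K\<in>factors H. if lt (lb T G) (lb (SK K) K) then wA K (SK K) else wR K (SK K))"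
    by (rule prod.cong[OF refl prod_node_weight_SK])
  finally show ?thesis unfolding tree_weight_def nondesc_child_G by simp
qed

end

section \<open>Generating functions of nested sets and their labels\<close>

definition qint :: "nat \<Rightarrow> rat poly" where "qint n = (\<Sum>i<n. monom 1 i)"

text \<open>The polynomial t + ... + t^(n-1), listing the exponents that a variable may carry in a
  Feichtner-Yuzvinsky monomial when \<open>n\<close> is its rank gap. It vanishes for
  \<open>n \<le> 1\<close>.\<close>

definition tqint :: "nat \<Rightarrow> rat poly" where "tqint n = [:0, 1:] * qint (n - 1)"

lemma qint_0 [simp]: "qint 0 = 0" and qint_1 [simp]: "qint (Suc 0) = 1"
  unfolding qint_def by (simp_all add: monom_0 one_pCons)

lemma qint_Suc: "qint (Suc n) = 1 + [:0, 1:] * qint n"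
proof -
  have "qint (Suc n) = monom 1 0 + (\<Sum>i<n. monom 1 (Suc i))"
    unfolding qint_def by (rule sum.lessThan_Suc_shift)
  also have "(\<Sum>i<n. monom 1 (Suc i)) = [:0, 1:] * qint n"
    unfolding qint_def sum_distrib_left by (simp add: monom_Suc)
  finally show ?thesis by (simp add: monom_0 one_pCons)
qed

lemma qint_tqint: "0 < n \<Longrightarrow> qint n = 1 + tqint n"
  unfolding tqint_def using qint_Suc[of "n - 1"] by simp

text \<open>Together with \<open>tqint_Suc\<close> this is the recursion
  \<open>\<psi> (Suc n) = c * qint n - d * tqint n\<close> for the two choices of
  \<open>(c, d)\<close>; the initial values \<open>qint 1 = 1\<close> and \<open>tqint 1 = 0\<close>
  are the corresponding \<open>d\<close>.\<close>

lemma qint_rec: "0 < n \<Longrightarrow> qint (Suc n) = [:1, 1:] * qint n - tqint n"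
proof -
  assume "0 < n"
  then have "qint n - tqint n = 1" using qint_tqint by simp
  moreover have "[:1, 1:] * qint n = qint n + [:0, 1:] * qint n" by simp
  ultimately show ?thesis unfolding qint_Suc by (simp add: algebra_simps)
qed

lemma tqint_1 [simp]: "tqint (Suc 0) = 0" and tqint_Suc: "tqint (Suc n) = [:0, 1:] * qint n"
  unfolding tqint_def by simp_all

context building_set_matroid
begin

text \<open>Counts by degree the Feichtner-Yuzvinsky monomials whose support has join
  \<open>F\<close>.\<close>

definition NS_gf :: "'a set \<Rightarrow> rat poly" where
  "NS_gf F = (\<Sum>S\<in>NS F. \<Prod>X\<in>S. tqint (rk X - rk (Jset E indep S X)))"

lemma NS_gf_factors: assumes F: "flt F" shows "NS_gf F = (\<Prod>K\<in>factors F. NS_gf K)"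
proof -
  have J: "Jset E indep S X = Jset E indep (S \<inter> Pow K) X" if "X \<in> S \<inter> Pow K" for S X K
  proof -
    have "{H \<in> S. H \<subset> X} = {H \<in> S \<inter> Pow K. H \<subset> X}" using that by blast
    then show ?thesis unfolding Jset_def by simp
  qed
  have "NS_gf F = (\<Sum>S\<in>{S \<in> NS F. \<forall>K\<in>factors F. S \<inter> Pow K \<in> NS K}.
      \<Prod>K\<in>factors F. \<Prod>X\<in>S \<inter> Pow K. tqint (rk X - rk (Jset E indep (S \<inter> Pow K) X)))"
    unfolding NS_gf_def
  proof (rule sum.cong)
    show "NS F = {S \<in> NS F. \<forall>K\<in>factors F. S \<inter> Pow K \<in> NS K}" using NS_restrict[OF F] by blast
    fix S assume "S \<in> {S \<in> NS F. \<forall>K\<in>factors F. S \<inter> Pow K \<in> NS K}"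
    then have S: "S \<in> NS F" by simp
    show "(\<Prod>X\<in>S. tqint (rk X - rk (Jset E indep S X))) =
      (\<Prod>K\<in>factors F. \<Prod>X\<in>S \<inter> Pow K. tqint (rk X - rk (Jset E indep (S \<inter> Pow K) X)))"
      unfolding prod_NS[OF F S]
    proof (intro prod.cong refl)
      fix K X assume X: "X \<in> S \<inter> Pow K"
      show "tqint (rk X - rk (Jset E indep S X)) = tqint (rk X - rk (Jset E indep (S \<inter> Pow K) X))"
        by (subst J[OF X]) (rule refl)
    qed
  qed
  also have "\<dots> = (\<Prod>K\<in>factors F. NS_gf K)" unfolding NS_gf_def by (rule sum_glue[OF F order_refl])
  finally show ?thesis .
qed

lemma NS_gf_empty [simp]: "NS_gf {} = 1" using NS_gf_factors[OF flat_empty] by simp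

lemma NS_gf_G: assumes G: "G \<in> \<G>"
  shows "NS_gf G = (\<Sum>J\<in>flats_below G. NS_gf J * tqint (rk G - rk J))"
proof -
  let ?f = "\<lambda>S. \<Prod>X\<in>S. tqint (rk X - rk (Jset E indep S X))"
  have "NS_gf G = (\<Sum>J\<in>flats_below G. \<Sum>S\<in>NS J. ?f (insert G S))"
    unfolding NS_gf_def NS_G_eq[OF G] by (rule sum_insert_NS) auto
  also have "\<dots> = (\<Sum>J\<in>flats_below G. \<Sum>S\<in>NS J. ?f S * tqint (rk G - rk J))"
  proof (intro sum.cong refl)
    fix J S assume "J \<in> flats_below G" and S: "S \<in> NS J"
    then have J: "flt J" "J \<subset> G" unfolding flats_below_def by auto
    have "Jset E indep (insert G S) X = Jset E indep S X" if "X \<in> S" for X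
    proof -
      have "{H \<in> insert G S. H \<subset> X} = {H \<in> S. H \<subset> X}" using that NS_Pow[OF S] J(2) by blast
      then show ?thesis unfolding Jset_def by simp
    qed
    then have 1: "(\<Prod>X\<in>S. tqint (rk X - rk (Jset E indep (insert G S) X))) = ?f S" by simp
    have "?f (insert G S) = tqint (rk G - rk (Jset E indep (insert G S) G)) *
        (\<Prod>X\<in>S. tqint (rk X - rk (Jset E indep (insert G S) X)))"
      by (rule prod.insert[OF NS_fin[OF S] NS_not_mem[OF S J(2)]])
    then show "?f (insert G S) = ?f S * tqint (rk G - rk J)"
      unfolding 1 Jset_insert[OF J S] by (simp only: mult.commute)
  qed
  also have "\<dots> = (\<Sum>J\<in>flats_below G. NS_gf J * tqint (rk G - rk J))"
    unfolding NS_gf_def by (simp only: sum_distrib_right)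
  finally show ?thesis .
qed

lemma factors_Int_disjoint:
  assumes "flt F" "K \<in> factors F" "L \<in> factors F" "K \<noteq> L"
  shows "factors (X \<inter> K) \<inter> factors (X \<inter> L) = {}"
proof -
  have "M = {}" if "M \<in> factors (X \<inter> K) \<inter> factors (X \<inter> L)" for M
  proof -
    have "M \<subseteq> X \<inter> K" "M \<subseteq> X \<inter> L" using that factors_sub by blast+
    then show ?thesis using factors_disjoint[OF assms] by blast
  qed
  then show ?thesis using factors_ne by blast
qed

text \<open>Some traces \<open>X \<inter> K\<close> may be empty and contribute 1; this lets a flat
  be compared factor by factor with a larger one.\<close>

lemma NS_gf_below: assumes F: "flt F" and X: "flt X" "X \<subseteq> F"
  shows "NS_gf X = (\<Prod>K\<in>factors F. NS_gf (X \<inter> K))"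
proof -
  have "NS_gf X = (\<Prod>L\<in>(\<Union>K\<in>factors F. factors (X \<inter> K)). NS_gf L)"
    using NS_gf_factors[OF X(1)] factors_subflat[OF F X(2)] by simp
  also have "\<dots> = (\<Prod>K\<in>factors F. \<Prod>L\<in>factors (X \<inter> K). NS_gf L)"
    by (rule prod.UNION_disjoint) (use fin_factors factors_Int_disjoint[OF F] in auto)
  also have "\<dots> = (\<Prod>K\<in>factors F. NS_gf (X \<inter> K))"
    by (intro prod.cong refl NS_gf_factors[symmetric] flat_Int X factors_flat)
  finally show ?thesis .
qed

lemma rk_below: assumes F: "flt F" and X: "flt X" "X \<subseteq> F"
  shows "rk X = (\<Sum>K\<in>factors F. rk (X \<inter> K))"
proof -
  have "rk X = (\<Sum>L\<in>(\<Union>K\<in>factors F. factors (X \<inter> K)). rk L)"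
    using rk_factors[OF X(1)] factors_subflat[OF F X(2)] by simp
  also have "\<dots> = (\<Sum>K\<in>factors F. \<Sum>L\<in>factors (X \<inter> K). rk L)"
    by (rule sum.UNION_disjoint) (use fin_factors factors_Int_disjoint[OF F] in auto)
  also have "\<dots> = (\<Sum>K\<in>factors F. rk (X \<inter> K))"
    by (intro sum.cong refl rk_factors[symmetric] flat_Int X factors_flat)
  finally show ?thesis .
qed

end

section \<open>Chains of flats under a complete order\<close>

locale complete_building_set = ordered_building_set +
  assumes lt_compl: "lt_complete E indep \<G> lt"
begin

definition below :: "'a set \<Rightarrow> 'a \<Rightarrow> 'a set" where "below G e = {x \<in> G. lt x e}"

text \<open>By \<open>lab_hyp\<close>, the label that \<open>G\<close> receives in every nested set
  whose members below \<open>G\<close> have join \<open>H\<close>.\<close>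

definition hmin :: "'a set \<Rightarrow> 'a set \<Rightarrow> 'a" where "hmin G H = lt_min lt (G - H)"

text \<open>The initial segment ends at its greatest element \<open>m\<close>, so its closure is the
  member of the chain from \<open>{}\<close> to \<open>G\<close> at \<open>m\<close>. Completeness
  is applied with \<open>F = {}\<close>, where \<open>G_F\<close> is \<open>\<G>\<close>
  itself.\<close>

lemma below_closure: assumes G: "G \<in> \<G>" and e: "e \<in> G" and ne: "below G e \<noteq> {}"
  shows "cl (below G e) \<in> \<G>"
proof -
  have sub: "below G e \<subseteq> E" using G_sub[OF G] unfolding below_def by blast
  obtain m where m: "m \<in> below G e" "\<forall>y\<in>below G e. y \<noteq> m \<longrightarrow> lt y m"
    using ex_lt_greatest[OF finite_subset[OF sub finE] ne sub] by blast
  have mE: "m \<in> E" "m \<in> G" "lt m e" and eE: "e \<in> E" using m(1) sub e G_sub[OF G] unfolding below_def by auto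
  have "{x \<in> G - {}. lt x m \<or> x = m} = below G e"
  proof
    show "{x \<in> G - {}. lt x m \<or> x = m} \<subseteq> below G e"
    proof
      fix x assume x: "x \<in> {x \<in> G - {}. lt x m \<or> x = m}"
      then have "x \<in> E" using G_sub[OF G] by blast
      then have "lt x e" using x mE lt_trans[of x m e] eE by blast
      then show "x \<in> below G e" using x unfolding below_def by simp
    qed
    show "below G e \<subseteq> {x \<in> G - {}. lt x m \<or> x = m}" using m(2) unfolding below_def by blast
  qed
  then have eq: "cl ({} \<union> {x \<in> G - {}. lt x m \<or> x = m}) = cl (below G e)" by simp
  have "cl (below G e) \<in> cchain E indep lt {} G" unfolding cchain_def eq[symmetric] using mE(2) by blast
  then have "cl (below G e) \<in> insert {} {K \<in> G_F E indep \<G> {}. {} \<subseteq> K \<and> K \<subseteq> G}"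
    using lt_compl[unfolded lt_complete_def, rule_format, of "{}" G] G by (simp only: flat_empty) blast
  moreover have "cl (below G e) \<noteq> {}" using cl_ext[OF sub] ne by blast
  ultimately obtain K where "K \<in> \<G>" "cl (below G e) = cl K" unfolding G_F_def by auto
  then show ?thesis using flat_eq[OF G_flat] by simp
qed

lemma hyperplaneD: assumes "H \<in> hyperplanes G" shows "flt H" "H \<subset> G" "rk G = Suc (rk H)"
  using assms unfolding hyperplanes_def by auto

lemma hmin_props: assumes G: "flt G" and H: "H \<in> hyperplanes G"
  shows "hmin G H \<in> G" "hmin G H \<notin> H" "hmin G H \<in> E" "below G (hmin G H) \<subseteq> H"
    "cl (insert (hmin G H) H) = G"
proof -
  note h = hyperplaneD[OF H]
  have 1: "G - H \<noteq> {}" "G - H \<subseteq> E" using h flat_sub[OF G] by auto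
  show 2: "hmin G H \<in> G" "hmin G H \<notin> H" using lt_min_in(1)[OF 1] unfolding hmin_def by auto
  then show 3: "hmin G H \<in> E" using flat_sub[OF G] by blast
  show "below G (hmin G H) \<subseteq> H"
  proof
    fix x assume "x \<in> below G (hmin G H)"
    then have x: "x \<in> G" "lt x (hmin G H)" unfolding below_def by auto
    show "x \<in> H"
    proof (rule ccontr)
      assume xH: "x \<notin> H"
      have xE: "x \<in> E" using x flat_sub[OF G] by blast
      have "x \<noteq> hmin G H" using x lt_irrefl 3 by auto
      then have "lt (hmin G H) x" using lt_min_in(2)[OF 1, of x] xH x unfolding hmin_def by simp
      then show False using lt_not_sym[OF xE 3 x(2)] by simp
    qed
  qed
  show "cl (insert (hmin G H) H) = G" using hyperplane_insert[OF h(1) G h(2,3) 2] .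
qed

text \<open>The flats \<open>J\<close> for which \<open>H\<close> is the last proper member of the chain \<open>C\<close> from \<open>J\<close> to \<open>G\<close>.\<close>

definition chain_top :: "'a set \<Rightarrow> 'a set \<Rightarrow> 'a set set" where
  "chain_top G H = {J. flt J \<and> J \<subseteq> H \<and> cl (J \<union> below G (hmin G H)) = H}"

text \<open>Take the least \<open>e\<close> for which \<open>J\<close> and the elements of
  \<open>G\<close> up to \<open>e\<close> generate \<open>G\<close>. Just before \<open>e\<close>
  they generate a hyperplane \<open>H\<close>, and \<open>e\<close> is the first element of
  \<open>G\<close> outside \<open>H\<close>.\<close>

lemma chain_top_exists: assumes G: "flt G" and J: "J \<in> flats_below G"
  shows "\<exists>H\<in>hyperplanes G. J \<in> chain_top G H"
proof -
  have J': "flt J" "J \<subset> G" using J unfolding flats_below_def by auto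
  define A where "A = {e \<in> G. cl (J \<union> insert e (below G e)) = G}"
  have AE: "A \<subseteq> E" using flat_sub[OF G] unfolding A_def by blast
  have fG: "finite G" using flat_fin[OF G] .
  have Gne: "G \<noteq> {}" using J' by blast
  obtain m where m: "m \<in> G" "\<forall>y\<in>G. y \<noteq> m \<longrightarrow> lt y m" using ex_lt_greatest[OF fG Gne flat_sub[OF G]] by blast
  have "J \<union> insert m (below G m) = G" using m J' unfolding below_def by blast
  then have "m \<in> A" unfolding A_def using m(1) flat_eq[OF G] by simp
  then obtain e where e: "e \<in> A" "\<forall>y\<in>A. y \<noteq> e \<longrightarrow> lt e y"
    using ex_lt_least[OF finite_subset[OF AE finE] _ AE] by blast
  have eG: "e \<in> G" "e \<in> E" and ecl: "cl (J \<union> insert e (below G e)) = G" using e AE unfolding A_def by auto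
  define H where "H = cl (J \<union> below G e)"
  have sub: "J \<union> below G e \<subseteq> G" "J \<union> below G e \<subseteq> E" using J' flat_sub[OF G] unfolding below_def by auto
  have Hf: "flt H" unfolding H_def by simp
  have HG: "H \<subseteq> G" unfolding H_def by (rule cl_least[OF sub(1) G])
  have JH: "J \<union> below G e \<subseteq> H" unfolding H_def by (rule cl_ext[OF sub(2)])
  have HnG: "H \<noteq> G"
  proof
    assume HG': "H = G"
    show False
    proof (cases "below G e = {}")
      case True then show False using HG' flat_eq[OF J'(1)] J'(2) unfolding H_def by simp
    next
      case False
      have bE: "below G e \<subseteq> E" using sub by blast
      obtain m where m: "m \<in> below G e" "\<forall>y\<in>below G e. y \<noteq> m \<longrightarrow> lt y m"
        using ex_lt_greatest[OF finite_subset[OF bE finE] False bE] by blast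
      then have "below G e \<subseteq> insert m (below G m)" unfolding below_def by blast
      then have 1: "G \<subseteq> cl (J \<union> insert m (below G m))"
        using HG' cl_mono[of "J \<union> below G e" "J \<union> insert m (below G m)"] unfolding H_def by blast
      have "m \<in> G" using m(1) unfolding below_def by simp
      then have "cl (J \<union> insert m (below G m)) \<subseteq> G"
        by (intro cl_least[OF _ G]) (use J'(2) in \<open>auto simp: below_def\<close>)
      then have "m \<in> A" unfolding A_def using 1 \<open>m \<in> G\<close> by blast
      moreover have "m \<noteq> e" "lt m e" "m \<in> E" using m(1) lt_irrefl eG bE unfolding below_def by auto
      ultimately show False using e(2) lt_not_sym[of m e] eG by blast
    qed
  qed
  have "cl (insert e H) = cl (J \<union> insert e (below G e))"
    using cl_Un_cl[OF sub(2), of "{e}"] eG unfolding H_def by (simp add: Un_commute)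
  then have clG: "cl (insert e H) = G" using ecl by simp
  have eH: "e \<notin> H"
  proof
    assume "e \<in> H"
    then have "cl (insert e H) = H" using flat_eq[OF Hf] by (simp add: insert_absorb)
    then show False using clG HnG by simp
  qed
  have "rk G = Suc (rk H)" using rk_insert_flat[OF Hf eG(2) eH] clG rk_cl[of "insert e H"] by simp
  then have Hh: "H \<in> hyperplanes G" unfolding hyperplanes_def using Hf HG HnG by blast
  have "hmin G H = e" unfolding hmin_def
  proof (rule lt_min_eqI)
    show "e \<in> G - H" using eG eH by blast
    show "G - H \<subseteq> E" using flat_sub[OF G] by blast
    fix y assume y: "y \<in> G - H" "y \<noteq> e"
    then have "\<not> lt y e" using JH unfolding below_def by blast
    then show "lt e y" using lt_linear[of e y] y eG flat_sub[OF G] by blast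
  qed
  then have "J \<in> chain_top G H" unfolding chain_top_def using J'(1) JH H_def by simp
  then show ?thesis using Hh by blast
qed

lemma chain_top_sub: assumes "H \<in> hyperplanes G" shows "chain_top G H \<subseteq> flats_below G"
  unfolding chain_top_def flats_below_def using hyperplaneD(2)[OF assms] by blast

text \<open>Beyond \<open>hmin G H\<close> the initial segment, joined with \<open>J\<close>,
  generates \<open>H\<close> and contains a point of \<open>G\<close> outside
  \<open>H\<close>.\<close>

lemma cl_Un_below_G:
  assumes G: "flt G" and H: "H \<in> hyperplanes G" and J: "J \<in> chain_top G H" and e: "e \<in> E" "lt (hmin G H) e"
  shows "cl (J \<union> below G e) = G"
proof
  note h = hmin_props[OF G H]
  have J': "flt J" "J \<subseteq> H" "cl (J \<union> below G (hmin G H)) = H" using J unfolding chain_top_def by auto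
  have JG: "J \<subseteq> G" using J'(2) hyperplaneD(2)[OF H] by blast
  then have sub: "J \<union> below G e \<subseteq> G" unfolding below_def by blast
  then show "cl (J \<union> below G e) \<subseteq> G" by (rule cl_least[OF _ G])
  have subE: "J \<union> below G e \<subseteq> E" using sub flat_sub[OF G] by blast
  have "below G (hmin G H) \<subseteq> below G e"
  proof
    fix x assume x: "x \<in> below G (hmin G H)"
    then have "x \<in> E" using flat_sub[OF G] unfolding below_def by blast
    then show "x \<in> below G e" using x lt_trans[of x "hmin G H" e] h(3) e unfolding below_def by blast
  qed
  then have "H \<subseteq> cl (J \<union> below G e)"
    using cl_mono[of "J \<union> below G (hmin G H)" "J \<union> below G e"] J'(3) by blast
  moreover have "hmin G H \<in> J \<union> below G e" using h(1) e unfolding below_def by simp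
  then have "hmin G H \<in> cl (J \<union> below G e)" using cl_ext[OF subE] by blast
  ultimately have "insert (hmin G H) H \<subseteq> cl (J \<union> below G e)" by simp
  then have "cl (insert (hmin G H) H) \<subseteq> cl (J \<union> below G e)" by (rule cl_least[OF _ flat_cl])
  then show "G \<subseteq> cl (J \<union> below G e)" using h(5) by simp
qed

text \<open>If the labels of the two hyperplanes differed, the initial segment before the larger
  label would, with \<open>J\<close>, already generate \<open>G\<close> and not a hyperplane. With
  \<open>chain_top_exists\<close> it follows that the sets \<open>chain_top G H\<close> partition
  the flats below \<open>G\<close>.\<close>

lemma chain_top_unique: assumes G: "flt G" and H: "H \<in> hyperplanes G" "H' \<in> hyperplanes G"
    and J: "J \<in> chain_top G H" "J \<in> chain_top G H'" shows "H = H'"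
proof -
  have no: "\<not> lt (hmin G H) (hmin G H')" if "H \<in> hyperplanes G" "H' \<in> hyperplanes G" "J \<in> chain_top G H" "J \<in> chain_top G H'" for H H'
  proof
    assume "lt (hmin G H) (hmin G H')"
    then have "cl (J \<union> below G (hmin G H')) = G"
      using cl_Un_below_G[OF G that(1,3)] hmin_props(3)[OF G that(2)] by blast
    then show False using that(4) hyperplaneD(2)[OF that(2)] unfolding chain_top_def by simp
  qed
  have "hmin G H = hmin G H'"
    using no[OF H J] no[OF H(2,1) J(2,1)] lt_linear hmin_props(3)[OF G] H by blast
  then show ?thesis using J unfolding chain_top_def by auto
qed

lemma fin_chain_top: "finite (chain_top G H)"
  by (rule finite_subset[OF _ fin_flats]) (auto simp: chain_top_def)

text \<open>Groups the flats \<open>J\<close> below \<open>G\<close> by the last hyperplane of their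
  chain and keeps those whose label satisfies \<open>P\<close>. The weight \<open>\<psi>\<close> is
  a parameter because it is shifted by one rank when the sum passes from \<open>G\<close> to a
  factor.\<close>

definition label_sum :: "('a \<Rightarrow> bool) \<Rightarrow> (nat \<Rightarrow> rat poly) \<Rightarrow> 'a set \<Rightarrow> rat poly" where
  "label_sum P \<psi> G = (\<Sum>H\<in>{H \<in> hyperplanes G. P (hmin G H)}. \<Sum>J\<in>chain_top G H. NS_gf J * \<psi> (rk G - rk J))"

lemma label_sum_UN: assumes G: "flt G"
  shows "label_sum P \<psi> G = (\<Sum>J\<in>(\<Union>H\<in>{H \<in> hyperplanes G. P (hmin G H)}. chain_top G H). NS_gf J * \<psi> (rk G - rk J))"
  unfolding label_sum_def
proof (rule sum.UNION_disjoint[symmetric])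
  show "\<forall>H\<in>{H \<in> hyperplanes G. P (hmin G H)}. \<forall>H'\<in>{H \<in> hyperplanes G. P (hmin G H)}.
      H \<noteq> H' \<longrightarrow> chain_top G H \<inter> chain_top G H' = {}"
    using chain_top_unique[OF G] by (metis (no_types, lifting) disjoint_iff mem_Collect_eq)
qed (use fin_hyperplanes fin_chain_top in auto)

lemma label_sum_True: assumes G: "flt G"
  shows "label_sum (\<lambda>_. True) \<psi> G = (\<Sum>J\<in>flats_below G. NS_gf J * \<psi> (rk G - rk J))"
proof -
  have "(\<Union>H\<in>{H \<in> hyperplanes G. True}. chain_top G H) = flats_below G"
    using chain_top_exists[OF G] chain_top_sub by auto
  then show ?thesis unfolding label_sum_UN[OF G] by simp
qed

text \<open>The chain of \<open>J\<close> ends with a label below \<open>e\<close> exactly when the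
  elements before \<open>e\<close> generate \<open>G\<close> over \<open>J\<close>. In this form,
  without mention of a hyperplane, the condition can be recognised on a factor.\<close>

lemma label_sum_less: assumes G: "flt G" and e: "e \<in> E"
  shows "label_sum (\<lambda>x. lt x e) \<psi> G =
    (\<Sum>J\<in>{J \<in> flats_below G. cl (J \<union> below G e) = G}. NS_gf J * \<psi> (rk G - rk J))"
proof -
  have "(\<Union>H\<in>{H \<in> hyperplanes G. lt (hmin G H) e}. chain_top G H) = {J \<in> flats_below G. cl (J \<union> below G e) = G}"
  proof
    show "(\<Union>H\<in>{H \<in> hyperplanes G. lt (hmin G H) e}. chain_top G H) \<subseteq> {J \<in> flats_below G. cl (J \<union> below G e) = G}"
      using chain_top_sub cl_Un_below_G[OF G _ _ e] by auto
    show "{J \<in> flats_below G. cl (J \<union> below G e) = G} \<subseteq> (\<Union>H\<in>{H \<in> hyperplanes G. lt (hmin G H) e}. chain_top G H)"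
    proof
      fix J assume "J \<in> {J \<in> flats_below G. cl (J \<union> below G e) = G}"
      then have J: "J \<in> flats_below G" "cl (J \<union> below G e) = G" by auto
      obtain H where H: "H \<in> hyperplanes G" "J \<in> chain_top G H" using chain_top_exists[OF G J(1)] by blast
      note h = hmin_props[OF G H(1)]
      have "lt (hmin G H) e"
      proof (rule ccontr)
        assume n: "\<not> lt (hmin G H) e"
        have "below G e \<subseteq> below G (hmin G H)"
        proof
          fix x assume x: "x \<in> below G e"
          then have "x \<in> E" "lt x e" using flat_sub[OF G] unfolding below_def by auto
          then have "lt x (hmin G H)"
            using n lt_linear[of e "hmin G H"] lt_trans[of x e "hmin G H"] e h(3) by blast
          then show "x \<in> below G (hmin G H)" using x unfolding below_def by simp
        qed
        then have "J \<union> below G e \<subseteq> H" using h(4) H(2) unfolding chain_top_def by blast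
        then have "cl (J \<union> below G e) \<subseteq> H" using cl_least hyperplaneD(1)[OF H(1)] by blast
        then show False using J(2) hyperplaneD(2)[OF H(1)] by simp
      qed
      then show "J \<in> (\<Union>H\<in>{H \<in> hyperplanes G. lt (hmin G H) e}. chain_top G H)" using H by blast
    qed
  qed
  then show ?thesis unfolding label_sum_UN[OF G] by simp
qed

text \<open>The only use of completeness. Labels of a factor lie in that factor, so all factors of \<open>H\<close> but
  one have labels above that of \<open>G\<close>, i.e. become descents.\<close>

lemma below_in_factor: assumes G: "G \<in> \<G>" and H: "H \<in> hyperplanes G" and ne: "H \<noteq> {}"
  shows "\<exists>K\<in>factors H. below G (hmin G H) \<subseteq> K"
proof (cases "below G (hmin G H) = {}")
  case True
  then show ?thesis using ne Union_factors[OF hyperplaneD(1)[OF H]] by auto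
next
  case False
  note h = hmin_props[OF G_flat[OF G] H]
  have c: "cl (below G (hmin G H)) \<in> \<G>" using below_closure[OF G h(1) False] .
  have "cl (below G (hmin G H)) \<subseteq> H" using cl_least[OF h(4) hyperplaneD(1)[OF H]] .
  then obtain K where K: "K \<in> factors H" "cl (below G (hmin G H)) \<subseteq> K" using ex_factor[OF c] by blast
  have "below G (hmin G H) \<subseteq> cl (below G (hmin G H))"
    by (rule cl_ext) (use G_sub[OF G] in \<open>auto simp: below_def\<close>)
  then show ?thesis using K by blast
qed

text \<open>The initial segment lies in \<open>K\<close>, so generating \<open>H\<close> over
  \<open>J\<close> forces \<open>J\<close> to contain every other factor of \<open>H\<close>; all
  the freedom is in the trace of \<open>J\<close> on \<open>K\<close>.\<close>

lemma chain_top_image: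
  assumes G: "G \<in> \<G>" and H: "H \<in> hyperplanes G" and K: "K \<in> factors H" "below G (hmin G H) \<subseteq> K"
  defines "e \<equiv> hmin G H"
  shows "bij_betw (\<lambda>J'. J' \<union> (H - K)) {J'. flt J' \<and> J' \<subseteq> K \<and> cl (J' \<union> below K e) = K} (chain_top G H)"
proof -
  have Hf: "flt H" using hyperplaneD[OF H] by blast
  have HE: "H \<subseteq> E" using flat_sub[OF Hf] .
  have KH: "K \<subseteq> H" using factors_sub[OF K(1)] .
  have Kf: "flt K" using factors_flat[OF K(1)] .
  have B: "below G e = below K e" using K(2) KH hyperplaneD(2)[OF H] unfolding below_def e_def by blast
  have BK: "below K e \<subseteq> K" unfolding below_def by blast
  have fl: "flt (J' \<union> (H - K))" if J': "flt J'" "J' \<subseteq> K" for J'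
  proof -
    define f where "f = (\<lambda>L. if L = K then J' else L)"
    have "flt (\<Union>L\<in>factors H. f L)"
      by (rule flat_Union_factors[OF Hf]) (use J' factors_flat in \<open>auto simp: f_def\<close>)
    moreover have "(\<Union>L\<in>factors H. f L) = J' \<union> (H - K)"
    proof
      show "(\<Union>L\<in>factors H. f L) \<subseteq> J' \<union> (H - K)"
      proof
        fix x assume "x \<in> (\<Union>L\<in>factors H. f L)"
        then obtain L where L: "L \<in> factors H" "x \<in> f L" by blast
        show "x \<in> J' \<union> (H - K)"
        proof (cases "L = K")
          case False
          then have "x \<in> L" using L(2) unfolding f_def by simp
          then show ?thesis using factors_disjoint[OF Hf K(1) L(1)] factors_sub[OF L(1)] False by blast
        qed (use L in \<open>simp add: f_def\<close>)
      qed
      show "J' \<union> (H - K) \<subseteq> (\<Union>L\<in>factors H. f L)"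
      proof
        fix x assume x: "x \<in> J' \<union> (H - K)"
        show "x \<in> (\<Union>L\<in>factors H. f L)"
        proof (cases "x \<in> J'")
          case True then show ?thesis using K(1) unfolding f_def by (intro UN_I[of K]) auto
        next
          case False
          then have "x \<in> H" "x \<notin> K" using x by auto
          then obtain L where "L \<in> factors H" "x \<in> L" using Union_factors[OF Hf] by blast
          then show ?thesis using \<open>x \<notin> K\<close> unfolding f_def by (intro UN_I[of L]) auto
        qed
      qed
    qed
    ultimately show ?thesis by simp
  qed
  have clU: "cl (J' \<union> (H - K) \<union> below K e) = cl (J' \<union> below K e) \<union> (H - K)" if J': "J' \<subseteq> K" for J'
  proof
    have sK: "J' \<union> below K e \<subseteq> K" using J' BK by blast
    have "cl (J' \<union> below K e) \<subseteq> K" by (rule cl_least[OF sK Kf])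
    then have "flt (cl (J' \<union> below K e) \<union> (H - K))" by (rule fl[OF flat_cl])
    moreover have "J' \<union> below K e \<subseteq> cl (J' \<union> below K e)" by (rule cl_ext) (use sK KH HE in blast)
    ultimately show "cl (J' \<union> (H - K) \<union> below K e) \<subseteq> cl (J' \<union> below K e) \<union> (H - K)"
      by (intro cl_least) auto
    have "J' \<union> (H - K) \<union> below K e \<subseteq> E" using sK KH HE by blast
    then have "H - K \<subseteq> cl (J' \<union> (H - K) \<union> below K e)" using cl_ext by blast
    moreover have "cl (J' \<union> below K e) \<subseteq> cl (J' \<union> (H - K) \<union> below K e)" by (rule cl_mono) blast
    ultimately show "cl (J' \<union> below K e) \<union> (H - K) \<subseteq> cl (J' \<union> (H - K) \<union> below K e)" by blast
  qed
  show ?thesis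
  proof (rule bij_betw_byWitness[where f' = "\<lambda>J. J \<inter> K"])
    let ?W = "{J'. flt J' \<and> J' \<subseteq> K \<and> cl (J' \<union> below K e) = K}"
    have dec: "J = (J \<inter> K) \<union> (H - K)" if J: "J \<in> chain_top G H" for J
    proof -
      have J': "flt J" "J \<subseteq> H" "cl (J \<union> below K e) = H" using J B unfolding chain_top_def e_def by auto
      \<comment> \<open>The flat equal to \<open>K\<close> on \<open>K\<close> and to
        \<open>J\<close> elsewhere contains \<open>J\<close> and the initial segment, hence all of
        \<open>H\<close>; outside \<open>K\<close> this leaves no room between \<open>J\<close> and
        \<open>H\<close>.\<close>
      define f where "f = (\<lambda>L. if L = K then K else J \<inter> L)"
      have U: "flt (\<Union>L\<in>factors H. f L)"
        by (rule flat_Union_factors[OF Hf]) (use J' factors_flat flat_Int in \<open>auto simp: f_def\<close>)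
      have "J \<subseteq> (\<Union>L\<in>factors H. f L)"
      proof
        fix x assume "x \<in> J"
        moreover from this obtain L where "L \<in> factors H" "x \<in> L" using Union_factors[OF Hf] J'(2) by blast
        ultimately show "x \<in> (\<Union>L\<in>factors H. f L)" unfolding f_def by (intro UN_I[of L]) auto
      qed
      moreover have "below K e \<subseteq> (\<Union>L\<in>factors H. f L)"
        using BK K(1) unfolding f_def by auto
      ultimately have HU: "H \<subseteq> (\<Union>L\<in>factors H. f L)" using cl_least[OF _ U, of "J \<union> below K e"] J'(3) by simp
      have "H - K \<subseteq> J"
      proof
        fix x assume x: "x \<in> H - K"
        then obtain L where "L \<in> factors H" "x \<in> f L" using HU by blast
        then show "x \<in> J" using x unfolding f_def by (auto split: if_splits)
      qed
      then show ?thesis using J'(2) by blast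
    qed
    show "\<forall>J'\<in>?W. (J' \<union> (H - K)) \<inter> K = J'" by blast
    show "\<forall>J\<in>chain_top G H. J \<inter> K \<union> (H - K) = J" using dec by simp
    show "(\<lambda>J'. J' \<union> (H - K)) ` ?W \<subseteq> chain_top G H"
    proof
      fix J assume "J \<in> (\<lambda>J'. J' \<union> (H - K)) ` ?W"
      then obtain J' where J': "flt J'" "J' \<subseteq> K" "cl (J' \<union> below K e) = K" "J = J' \<union> (H - K)" by blast
      have "cl (J \<union> below K e) = H" using clU[OF J'(2)] J'(3,4) KH by auto
      then show "J \<in> chain_top G H"
        unfolding chain_top_def using fl[OF J'(1,2)] J'(2,4) KH B unfolding e_def by auto
    qed
    show "(\<lambda>J. J \<inter> K) ` chain_top G H \<subseteq> ?W"
    proof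
      fix J' assume "J' \<in> (\<lambda>J. J \<inter> K) ` chain_top G H"
      then obtain J where J: "J \<in> chain_top G H" "J' = J \<inter> K" by blast
      have Jf: "flt J" "cl (J \<union> below K e) = H" using J(1) B unfolding chain_top_def e_def by auto
      have J'K: "J' \<subseteq> K" using J by blast
      have "J' \<union> (H - K) = J" using dec[OF J(1)] J(2) by simp
      then have "cl (J' \<union> below K e) \<union> (H - K) = H" using clU[OF J'K] Jf(2) by simp
      moreover have "cl (J' \<union> below K e) \<subseteq> K" by (rule cl_least[OF _ Kf]) (use J'K BK in blast)
      ultimately have "cl (J' \<union> below K e) = K" using KH by blast
      then show "J' \<in> ?W" using J'K flat_Int[OF Jf(1) Kf] J(2) by simp
    qed
  qed
qed

text \<open>The trace on \<open>K\<close> is either \<open>K\<close> itself, where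
  \<open>J = H\<close> has corank 1 in \<open>G\<close>, or a smaller flat whose chain to
  \<open>K\<close> ends with a label before that of \<open>G\<close>. The corank of \<open>J\<close>
  in \<open>G\<close> exceeds that of the trace in \<open>K\<close> by one, whence the shift of
  \<open>\<psi>\<close>.\<close>

lemma chain_top_sum:
  assumes G: "G \<in> \<G>" and H: "H \<in> hyperplanes G" and K: "K \<in> factors H" "below G (hmin G H) \<subseteq> K"
  shows "(\<Sum>J\<in>chain_top G H. NS_gf J * \<psi> (rk G - rk J)) =
    (NS_gf K * \<psi> 1 + label_sum (\<lambda>x. lt x (hmin G H)) (\<lambda>n. \<psi> (Suc n)) K) * (\<Prod>L\<in>factors H - {K}. NS_gf L)"
proof -
  define e where "e = hmin G H"
  let ?R = "\<Prod>L\<in>factors H - {K}. NS_gf L"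
  let ?W = "{J'. flt J' \<and> J' \<subseteq> K \<and> cl (J' \<union> below K e) = K}"
  have Hf: "flt H" using hyperplaneD[OF H] by blast
  have Kf: "flt K" using factors_flat[OF K(1)] .
  note bij = chain_top_image[OF G H K, folded e_def]
  have "(\<Sum>J\<in>chain_top G H. NS_gf J * \<psi> (rk G - rk J)) =
      (\<Sum>J'\<in>?W. NS_gf (J' \<union> (H - K)) * \<psi> (rk G - rk (J' \<union> (H - K))))"
    by (rule sum.reindex_bij_betw[OF bij, symmetric])
  also have "\<dots> = (\<Sum>J'\<in>?W. NS_gf J' * \<psi> (Suc (rk K - rk J')) * ?R)"
  proof (rule sum.cong[OF refl])
    fix J' assume J'W: "J' \<in> ?W"
    then have J': "flt J'" "J' \<subseteq> K" by auto
    let ?J = "J' \<union> (H - K)"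
    have "?J \<in> chain_top G H" using bij_betw_apply[OF bij J'W] .
    then have J: "flt ?J" "?J \<subseteq> H" unfolding chain_top_def by auto
    have i1: "?J \<inter> K = J'" using J'(2) by blast
    have i2: "?J \<inter> L = L" if "L \<in> factors H - {K}" for L
      using that factors_disjoint[OF Hf K(1), of L] factors_sub[of L H] by blast
    have "NS_gf ?J = NS_gf (?J \<inter> K) * (\<Prod>L\<in>factors H - {K}. NS_gf (?J \<inter> L))"
      unfolding NS_gf_below[OF Hf J] by (rule prod.remove[OF fin_factors K(1)])
    also have "\<dots> = NS_gf J' * ?R" using i1 i2 by simp
    finally have 1: "NS_gf ?J = NS_gf J' * ?R" .
    have "rk ?J = rk (?J \<inter> K) + (\<Sum>L\<in>factors H - {K}. rk (?J \<inter> L))"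
      unfolding rk_below[OF Hf J] by (rule sum.remove[OF fin_factors K(1)])
    then have r1: "rk ?J = rk J' + (\<Sum>L\<in>factors H - {K}. rk L)" using i1 i2 by simp
    have r2: "rk H = rk K + (\<Sum>L\<in>factors H - {K}. rk L)"
      unfolding rk_factors[OF Hf] by (rule sum.remove[OF fin_factors K(1)])
    have "rk J' \<le> rk K" using rk_mono[OF J'(2)] .
    then have "rk G - rk ?J = Suc (rk K - rk J')" using r1 r2 hyperplaneD(3)[OF H] by simp
    then show "NS_gf ?J * \<psi> (rk G - rk ?J) = NS_gf J' * \<psi> (Suc (rk K - rk J')) * ?R" using 1 by simp
  qed
  also have "\<dots> = (\<Sum>J'\<in>?W. NS_gf J' * \<psi> (Suc (rk K - rk J'))) * ?R" by (rule sum_distrib_right[symmetric])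
  also have "?W = insert K {J \<in> flats_below K. cl (J \<union> below K e) = K}"
  proof -
    have "K \<union> below K e = K" unfolding below_def by blast
    then have "cl (K \<union> below K e) = K" using flat_eq[OF Kf] by simp
    then show ?thesis using Kf unfolding flats_below_def by auto
  qed
  also have "(\<Sum>J'\<in>\<dots>. NS_gf J' * \<psi> (Suc (rk K - rk J'))) = NS_gf K * \<psi> 1 +
      (\<Sum>J'\<in>{J \<in> flats_below K. cl (J \<union> below K e) = K}. NS_gf J' * \<psi> (Suc (rk K - rk J')))"
  proof (subst sum.insert)
    show "finite {J \<in> flats_below K. cl (J \<union> below K e) = K}" using fin_flats_below[of K] by simp
    show "K \<notin> {J \<in> flats_below K. cl (J \<union> below K e) = K}" unfolding flats_below_def by simp
  qed simp
  also have "(\<Sum>J'\<in>{J \<in> flats_below K. cl (J \<union> below K e) = K}. NS_gf J' * \<psi> (Suc (rk K - rk J'))) =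
      label_sum (\<lambda>x. lt x e) (\<lambda>n. \<psi> (Suc n)) K"
    by (rule label_sum_less[OF Kf, symmetric]) (use hmin_props(3)[OF G_flat[OF G] H] e_def in simp)
  finally show ?thesis unfolding e_def .
qed

end

section \<open>The label recursion and stable maximal nested sets\<close>

context complete_building_set
begin

lemma label_sum_linear: assumes G: "G \<in> \<G>"
    and \<psi>: "\<And>n. 0 < n \<Longrightarrow> \<psi> (Suc n) = c * qint n - d * tqint n"
  shows "label_sum P (\<lambda>n. \<psi> (Suc n)) G = c * label_sum P qint G - d * label_sum P tqint G"
proof -
  have 1: "NS_gf J * \<psi> (Suc (rk G - rk J)) = c * (NS_gf J * qint (rk G - rk J)) - d * (NS_gf J * tqint (rk G - rk J))"
    if "H \<in> hyperplanes G" "J \<in> chain_top G H" for H J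
  proof -
    have J: "flt J" "J \<subset> G" using chain_top_sub[OF that(1)] that(2) unfolding flats_below_def by auto
    have p: "0 < rk G - rk J" using rk_flat_mono[OF J(1) G_flat[OF G] J(2)] by simp
    show ?thesis unfolding \<psi>[OF p] by (simp add: algebra_simps)
  qed
  have "label_sum P (\<lambda>n. \<psi> (Suc n)) G = (\<Sum>H\<in>{H \<in> hyperplanes G. P (hmin G H)}. \<Sum>J\<in>chain_top G H.
      c * (NS_gf J * qint (rk G - rk J)) - d * (NS_gf J * tqint (rk G - rk J)))"
    unfolding label_sum_def by (intro sum.cong refl 1) auto
  also have "\<dots> = c * label_sum P qint G - d * label_sum P tqint G"
    unfolding label_sum_def by (simp only: sum_subtractf sum_distrib_left)
  finally show ?thesis .
qed

lemma MN_cases: assumes G: "G \<in> \<G>" and T: "T \<in> MN G"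
  obtains H S where "H \<in> hyperplanes G" "S \<in> MN H" "T = insert G S"
  using T unfolding MN_G_eq[OF G] by blast

lemma lab_MN: assumes "G \<in> \<G>" "H \<in> hyperplanes G" "S \<in> MN H" shows "lb (insert G S) G = hmin G H"
  unfolding hmin_def using lab_hyp[OF assms(2,1)] assms(3) MN_NS by blast

lemma lab_mem: assumes G: "G \<in> \<G>" and T: "T \<in> MN G" shows "lb T G \<in> G"
proof -
  obtain H S where H: "H \<in> hyperplanes G" "S \<in> MN H" "T = insert G S" using MN_cases[OF G T] .
  then show ?thesis using lab_MN[OF G H(1,2)] hmin_props(1)[OF G_flat[OF G] H(1)] by simp
qed

lemma MN_restrict: "flt F \<Longrightarrow> T \<in> MN F \<Longrightarrow> K \<in> factors F \<Longrightarrow> T \<inter> Pow K \<in> MN K"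
  using MN_factors by blast

lemma graft: assumes "G \<in> \<G>" "H \<in> hyperplanes G" "S \<in> MN H" shows "grafted E indep \<G> lt G H S"
proof
  show "G \<in> \<G>" "flt H" "H \<subset> G" using assms hyperplaneD by auto
  show "S \<in> NS H" using assms(3) MN_NS by blast
qed

lemma lt_lab_other:
  assumes G: "G \<in> \<G>" and H: "H \<in> hyperplanes G" and K: "K \<in> factors H" "below G (hmin G H) \<subseteq> K"
    and L: "L \<in> factors H" "L \<noteq> K" and T: "T \<in> MN L"
  shows "lt (hmin G H) (lb T L)"
proof -
  note h = hmin_props[OF G_flat[OF G] H]
  have x: "lb T L \<in> L" using lab_mem[OF factors_G[OF L(1)] T] .
  then have xH: "lb T L \<in> H" using factors_sub[OF L(1)] by blast
  then have xG: "lb T L \<in> G" using hyperplaneD(2)[OF H] by blast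
  have "lb T L \<notin> K" using factors_disjoint[OF hyperplaneD(1)[OF H] L(1) K(1) L(2)] x by blast
  then have "\<not> lt (lb T L) (hmin G H)" using K(2) xG unfolding below_def by blast
  moreover have "lb T L \<noteq> hmin G H" using xH h(2) by auto
  ultimately show ?thesis using lt_linear[of "lb T L" "hmin G H"] h(3) xG G_sub[OF G] by blast
qed

text \<open>For \<open>\<psi> = qint\<close> and \<open>\<psi> = tqint\<close> this is one induction step, with \<open>(c, d) = (1 + t, 1)\<close> and
  \<open>(c, d) = (t, 0)\<close> respectively.\<close>

lemma chain_top_sum_MN:
  assumes G: "G \<in> \<G>" and H: "H \<in> hyperplanes G"
    and \<psi>1: "\<psi> (Suc 0) = d" and \<psi>: "\<And>n. 0 < n \<Longrightarrow> \<psi> (Suc n) = c * qint n - d * tqint n"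
    and IH: "\<And>K P. K \<in> factors H \<Longrightarrow> label_sum P qint K = (\<Sum>T\<in>{T \<in> MN K. P (lb T K)}. wR K T)"
      "\<And>K P. K \<in> factors H \<Longrightarrow> label_sum P tqint K = (\<Sum>T\<in>{T \<in> MN K. P (lb T K)}. wA K T)"
  shows "(\<Sum>J\<in>chain_top G H. NS_gf J * \<psi> (rk G - rk J)) = (\<Sum>S\<in>MN H. tree_weight c d G (insert G S))"
proof (cases "H = {}")
  case True
  note h = hmin_props[OF G_flat[OF G] H]
  have "below G (hmin G H) = {}" using h(4) True by simp
  then have ct: "chain_top G H = {{}}" unfolding chain_top_def True by auto
  have M: "{} \<in> MN H" unfolding True MN_empty by simp
  interpret g: grafted E indep \<G> lt G H "{}" using graft[OF G H M] .
  have "tree_weight c d G {G} = d" using g.tree_weight_graft[of c d] True by simp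
  moreover have "rk G = Suc 0" using hyperplaneD(3)[OF H] True by simp
  ultimately show ?thesis unfolding ct using True MN_empty \<psi>1 by simp
next
  case False
  define e where "e = hmin G H"
  note h = hmin_props[OF G_flat[OF G] H, folded e_def]
  have Hf: "flt H" using hyperplaneD(1)[OF H] .
  obtain K where K: "K \<in> factors H" "below G e \<subseteq> K" using below_in_factor[OF G H False] e_def by blast
  have KG: "K \<in> \<G>" using factors_G[OF K(1)] .
  have gf: "NS_gf L = (\<Sum>T\<in>MN L. wA L T)" if L: "L \<in> factors H" for L
    using IH(2)[OF L, of "\<lambda>_. True"] label_sum_True[OF factors_flat[OF L]] NS_gf_G[OF factors_G[OF L]] by simp
  \<comment> \<open>For a root label below \<open>e\<close>, the term \<open>d * wA\<close> from
    \<open>\<psi> 1\<close> cancels against the negative term and leaves \<open>c * wR\<close>; for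
    one above \<open>e\<close> only \<open>d * wA\<close> is left. The factor \<open>c\<close> or
    \<open>d\<close> is the weight of the new root, booked on \<open>K\<close>.\<close>
  define g where "g = (\<lambda>L T. if L = K then (if lt e (lb T K) then d * wA K T else c * wR K T) else wA L T)"
  have lbE: "lt (lb T K) e \<longleftrightarrow> \<not> lt e (lb T K)" if "T \<in> MN K" for T
  proof -
    have x: "lb T K \<in> K" using lab_mem[OF KG that] .
    then have "lb T K \<noteq> e" using h(2) factors_sub[OF K(1)] by blast
    moreover have "lb T K \<in> E" using x G_sub[OF KG] by blast
    ultimately show ?thesis using lt_linear lt_not_sym h(3) by blast
  qed
  have "(\<Sum>J\<in>chain_top G H. NS_gf J * \<psi> (rk G - rk J)) =
      (NS_gf K * \<psi> 1 + label_sum (\<lambda>x. lt x e) (\<lambda>n. \<psi> (Suc n)) K) * (\<Prod>L\<in>factors H - {K}. NS_gf L)"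
    unfolding e_def by (rule chain_top_sum[OF G H K(1)]) (use K(2) e_def in simp)
  also have "NS_gf K * \<psi> 1 + label_sum (\<lambda>x. lt x e) (\<lambda>n. \<psi> (Suc n)) K = (\<Sum>T\<in>MN K. g K T)"
  proof -
    have "label_sum (\<lambda>x. lt x e) (\<lambda>n. \<psi> (Suc n)) K =
        c * (\<Sum>T\<in>{T \<in> MN K. lt (lb T K) e}. wR K T) - d * (\<Sum>T\<in>{T \<in> MN K. lt (lb T K) e}. wA K T)"
      using label_sum_linear[OF KG \<psi>, where P = "\<lambda>x. lt x e"] IH[OF K(1), of "\<lambda>x. lt x e"] by simp
    also have "(\<Sum>T\<in>{T \<in> MN K. lt (lb T K) e}. wR K T) = (\<Sum>T\<in>MN K. if lt (lb T K) e then wR K T else 0)"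
      by (rule sum.inter_filter[OF fin_MN])
    also have "(\<Sum>T\<in>{T \<in> MN K. lt (lb T K) e}. wA K T) = (\<Sum>T\<in>MN K. if lt (lb T K) e then wA K T else 0)"
      by (rule sum.inter_filter[OF fin_MN])
    finally have "NS_gf K * \<psi> 1 + label_sum (\<lambda>x. lt x e) (\<lambda>n. \<psi> (Suc n)) K =
        (\<Sum>T\<in>MN K. wA K T * d + (c * (if lt (lb T K) e then wR K T else 0) - d * (if lt (lb T K) e then wA K T else 0)))"
      using gf[OF K(1)] \<psi>1 by (simp add: sum.distrib sum_subtractf sum_distrib_left sum_distrib_right)
    also have "\<dots> = (\<Sum>T\<in>MN K. g K T)"
    proof (rule sum.cong[OF refl])
      fix T assume "T \<in> MN K"
      then show "wA K T * d + (c * (if lt (lb T K) e then wR K T else 0) - d * (if lt (lb T K) e then wA K T else 0)) = g K T"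
        unfolding g_def using lbE by (cases "lt e (lb T K)") (simp_all add: mult.commute)
    qed
    finally show ?thesis .
  qed
  also have "(\<Prod>L\<in>factors H - {K}. NS_gf L) = (\<Prod>L\<in>factors H - {K}. \<Sum>T\<in>MN L. g L T)"
    by (rule prod.cong[OF refl]) (use gf g_def in auto)
  also have "(\<Sum>T\<in>MN K. g K T) * \<dots> = (\<Prod>L\<in>factors H. \<Sum>T\<in>MN L. g L T)"
    by (rule prod.remove[OF fin_factors K(1), symmetric])
  also have "\<dots> = (\<Sum>S\<in>{S \<in> NS H. \<forall>L\<in>factors H. S \<inter> Pow L \<in> MN L}. \<Prod>L\<in>factors H. g L (S \<inter> Pow L))"
    by (rule sum_glue[OF Hf MN_NS, symmetric])
  also have "\<dots> = (\<Sum>S\<in>MN H. \<Prod>L\<in>factors H. g L (S \<inter> Pow L))" unfolding MN_factors[OF Hf] ..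
  also have "\<dots> = (\<Sum>S\<in>MN H. tree_weight c d G (insert G S))"
  proof (rule sum.cong[OF refl])
    fix S assume S: "S \<in> MN H"
    interpret gr: grafted E indep \<G> lt G H S using graft[OF G H S] .
    have lbG: "lb (insert G S) G = e" using lab_MN[OF G H S] e_def by simp
    have other: "lt e (lb (S \<inter> Pow L) L)" if "L \<in> factors H" "L \<noteq> K" for L
      using lt_lab_other[OF G H K(1) _ that MN_restrict[OF Hf S that(1)]] K(2) e_def by simp
    have "tree_weight c d G (insert G S) = (if \<not> lt e (lb (S \<inter> Pow K) K) then c else d) *
      (\<Prod>L\<in>factors H. if lt e (lb (S \<inter> Pow L) L) then wA L (S \<inter> Pow L) else wR L (S \<inter> Pow L))"
    proof -
      \<comment> \<open>All other factors become descents, so \<open>K\<close> alone decides which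
        weight the root receives.\<close>
      have "(\<exists>L\<in>factors H. \<not> lt e (lb (S \<inter> Pow L) L)) \<longleftrightarrow> \<not> lt e (lb (S \<inter> Pow K) K)"
        using other K(1) by metis
      then show ?thesis unfolding gr.tree_weight_graft lbG by simp
    qed
    also have "(\<Prod>L\<in>factors H. if lt e (lb (S \<inter> Pow L) L) then wA L (S \<inter> Pow L) else wR L (S \<inter> Pow L)) =
        (if lt e (lb (S \<inter> Pow K) K) then wA K (S \<inter> Pow K) else wR K (S \<inter> Pow K)) *
        (\<Prod>L\<in>factors H - {K}. if lt e (lb (S \<inter> Pow L) L) then wA L (S \<inter> Pow L) else wR L (S \<inter> Pow L))"
      by (rule prod.remove[OF fin_factors K(1)])
    also have "(\<Prod>L\<in>factors H - {K}. if lt e (lb (S \<inter> Pow L) L) then wA L (S \<inter> Pow L) else wR L (S \<inter> Pow L)) =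
        (\<Prod>L\<in>factors H - {K}. g L (S \<inter> Pow L))"
      by (rule prod.cong[OF refl]) (use other in \<open>auto simp: g_def\<close>)
    also have "(if \<not> lt e (lb (S \<inter> Pow K) K) then c else d) *
        ((if lt e (lb (S \<inter> Pow K) K) then wA K (S \<inter> Pow K) else wR K (S \<inter> Pow K)) *
        (\<Prod>L\<in>factors H - {K}. g L (S \<inter> Pow L))) = g K (S \<inter> Pow K) * (\<Prod>L\<in>factors H - {K}. g L (S \<inter> Pow L))"
      unfolding g_def by (cases "lt e (lb (S \<inter> Pow K) K)") (simp_all only: if_True if_False not_False_eq_True mult.assoc refl simp_thms)
    also have "\<dots> = (\<Prod>L\<in>factors H. g L (S \<inter> Pow L))"
      by (rule prod.remove[OF fin_factors K(1), symmetric])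
    finally show "(\<Prod>L\<in>factors H. g L (S \<inter> Pow L)) = tree_weight c d G (insert G S)" by simp
  qed
  finally show ?thesis .
qed

lemma label_sum_MN: assumes "G \<in> \<G>"
  shows "label_sum P qint G = (\<Sum>T\<in>{T \<in> MN G. P (lb T G)}. wR G T) \<and>
    label_sum P tqint G = (\<Sum>T\<in>{T \<in> MN G. P (lb T G)}. wA G T)"
  using assms
proof (induction "card G" arbitrary: G P rule: less_induct)
  case less
  note G = less.prems
  have IH: "label_sum P qint K = (\<Sum>T\<in>{T \<in> MN K. P (lb T K)}. wR K T)"
    "label_sum P tqint K = (\<Sum>T\<in>{T \<in> MN K. P (lb T K)}. wA K T)"
    if "H \<in> hyperplanes G" "K \<in> factors H" for H K P
  proof -
    have "K \<subset> G" using factors_sub[OF that(2)] hyperplaneD(2)[OF that(1)] by blast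
    then have "card K < card G" by (rule psubset_card_mono[OF flat_fin[OF G_flat[OF G]]])
    note c = less.hyps[OF this factors_G[OF that(2)], of P]
    show "label_sum P qint K = (\<Sum>T\<in>{T \<in> MN K. P (lb T K)}. wR K T)" using c by (rule conjunct1)
    show "label_sum P tqint K = (\<Sum>T\<in>{T \<in> MN K. P (lb T K)}. wA K T)" using c by (rule conjunct2)
  qed
  have "{T \<in> MN G. P (lb T G)} = (\<Union>H\<in>{H \<in> hyperplanes G. P (hmin G H)}. insert G ` MN H)"
    unfolding MN_G_eq[OF G] using lab_MN[OF G] by fastforce
  then have step: "(\<Sum>T\<in>{T \<in> MN G. P (lb T G)}. f T) =
      (\<Sum>H\<in>{H \<in> hyperplanes G. P (hmin G H)}. \<Sum>S\<in>MN H. f (insert G S))" for f :: "'a set set \<Rightarrow> rat poly"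
  proof -
    have "{H \<in> hyperplanes G. P (hmin G H)} \<subseteq> flats_below G" using hyperplanes_sub by blast
    then show ?thesis unfolding \<open>{T \<in> MN G. P (lb T G)} = _\<close> by (rule sum_insert_NS[OF _ MN_NS])
  qed
  have R: "(\<Sum>J\<in>chain_top G H. NS_gf J * qint (rk G - rk J)) = (\<Sum>S\<in>MN H. wR G (insert G S))"
    if H: "H \<in> hyperplanes G" for H
    by (rule chain_top_sum_MN[OF G H _ _ IH[OF H]]) (use qint_rec in auto)
  have A: "(\<Sum>J\<in>chain_top G H. NS_gf J * tqint (rk G - rk J)) = (\<Sum>S\<in>MN H. wA G (insert G S))"
    if H: "H \<in> hyperplanes G" for H
    by (rule chain_top_sum_MN[OF G H _ _ IH[OF H]]) (auto simp: tqint_Suc)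
  show ?case unfolding step label_sum_def using R A by simp
qed

text \<open>One node per rank: \<open>G\<close> adds one to the total rank of the factors of the
  hyperplane below it.\<close>

lemma card_MN: assumes "G \<in> \<G>" "T \<in> MN G" shows "card T = rk G"
  using assms
proof (induction "card G" arbitrary: G T rule: less_induct)
  case less
  note G = less.prems(1)
  obtain H S where H: "H \<in> hyperplanes G" "S \<in> MN H" "T = insert G S" using MN_cases[OF less.prems] .
  have Hf: "flt H" and HG: "H \<subset> G" using hyperplaneD[OF H(1)] by auto
  have S: "S \<in> NS H" using H(2) MN_NS by blast
  have "card S = card (\<Union>K\<in>factors H. S \<inter> Pow K)" using NS_Union_restrict[OF Hf S] by simp
  also have "\<dots> = (\<Sum>K\<in>factors H. card (S \<inter> Pow K))"
    by (rule card_UN_disjoint) (use fin_factors NS_fin[OF S] NS_restrict_disjoint[OF Hf S] in auto)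
  also have "\<dots> = (\<Sum>K\<in>factors H. rk K)"
  proof (rule sum.cong[OF refl])
    fix K assume K: "K \<in> factors H"
    then have "K \<subset> G" using factors_sub[OF K] HG by blast
    then have "card K < card G" using psubset_card_mono[OF flat_fin[OF G_flat[OF G]]] by blast
    then show "card (S \<inter> Pow K) = rk K" using less.hyps[OF _ factors_G[OF K] MN_restrict[OF Hf H(2) K]] by blast
  qed
  finally have "card S = rk H" using rk_factors[OF Hf] by simp
  moreover have "card T = Suc (card S)" using H(3) NS_fin[OF S] NS_not_mem[OF S HG] by simp
  ultimately show ?case using hyperplaneD(3)[OF H(1)] by simp
qed

lemma nondesc_child_unique: assumes "G \<in> \<G>" "T \<in> MN G" "X \<in> T"
    "Y \<in> children T X" "\<not> dsc T Y" "Y' \<in> children T X" "\<not> dsc T Y'"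
  shows "Y = Y'"
  using assms
proof (induction "card G" arbitrary: G T X Y Y' rule: less_induct)
  case less
  note G = less.prems(1)
  obtain H S where H: "H \<in> hyperplanes G" "S \<in> MN H" "T = insert G S" using MN_cases[OF less.prems(1,2)] .
  have Hf: "flt H" and HG: "H \<subset> G" using hyperplaneD[OF H(1)] by auto
  interpret gr: grafted E indep \<G> lt G H S using graft[OF G H(1,2)] .
  have XT: "X \<in> insert G S" using less.prems(3) H(3) by simp
  show ?case
  proof (cases "X = G")
    case True
    have Y: "Y \<in> factors H" "Y' \<in> factors H" using less.prems(4,6) gr.children_G True H(3) by auto
    then have "H \<noteq> {}" by auto
    then obtain K where K: "K \<in> factors H" "below G (hmin G H) \<subseteq> K" using below_in_factor[OF G H(1)] by blast
    have "L = K" if L: "L \<in> factors H" "\<not> dsc T L" for L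
    proof (rule ccontr)
      assume "L \<noteq> K"
      then have "lt (hmin G H) (lb (S \<inter> Pow L) L)"
        using lt_lab_other[OF G H(1) K L(1) _ MN_restrict[OF Hf H(2) L(1)]] by blast
      then show False using L gr.dsc_K[OF L(1)] lab_MN[OF G H(1,2)] H(3) by simp
    qed
    then show ?thesis using Y less.prems(5,7) by blast
  next
    case False
    obtain K where K: "K \<in> factors H" "X \<in> S \<inter> Pow K" using gr.T_cases[OF XT] False by metis
    have ch: "children T X = children (S \<inter> Pow K) X" using gr.children_SK[OF K] H(3) by simp
    have ds: "dsc T Z \<longleftrightarrow> dsc (S \<inter> Pow K) Z" if "Z \<in> children (S \<inter> Pow K) X" for Z
      using that gr.max_SK[OF K(1)] H(3) gr.dsc_SK[OF K(1)] unfolding children_def by auto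
    have "card K < card G" using psubset_card_mono[OF flat_fin[OF G_flat[OF G]] gr.K_sub_G[OF K(1)]] .
    then show ?thesis
      using less.hyps[OF _ factors_G[OF K(1)] MN_restrict[OF Hf H(2) K(1)] K(2), of Y Y'] less.prems(4-7) ch ds by simp
  qed
qed

end

section \<open>Evaluation at the top flat of an irreducible building set\<close>

locale irreducible_complete = complete_building_set +
  assumes E_G: "E \<in> \<G>"
begin

lemma children_sub: assumes T: "nst T" and Y: "Y \<in> children T X" shows "Y \<in> T" "Y \<subset> X"
  using Y parent_props(2)[OF T] unfolding children_def by auto

text \<open>A minimal element has no children, so bottom and double descents together are the
  descents without a child that is not a descent.\<close>

lemma stable_iff: "S \<in> stable_max_nested E indep \<G> lt \<longleftrightarrow> S \<in> MN E \<and> (\<forall>X\<in>S. dsc S X \<longrightarrow> nondesc_child S X)"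
proof -
  have "(\<not> bottom_descent E indep lt S X \<and> \<not> double_descent E indep lt S X) \<longleftrightarrow> (dsc S X \<longrightarrow> nondesc_child S X)"
    if S: "S \<in> MN E" and X: "X \<in> S" for X
  proof -
    have n: "nst S" using S MN_NS NS_nst by blast
    have "\<not> nondesc_child S X" if "is_min_in S X"
    proof
      assume "nondesc_child S X"
      then obtain Y where Y: "Y \<in> children S X" unfolding nondesc_child_def by blast
      then show False using that children_sub[OF n Y] unfolding is_min_in_def by simp
    qed
    moreover have "double_descent E indep lt S X \<longleftrightarrow> dsc S X \<and> \<not> is_min_in S X \<and> \<not> nondesc_child S X"
      unfolding double_descent_def nondesc_child_def by simp
    moreover have "bottom_descent E indep lt S X \<longleftrightarrow> dsc S X \<and> is_min_in S X"
      unfolding bottom_descent_def by simp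
    ultimately show ?thesis by argo
  qed
  then show ?thesis unfolding stable_max_nested_def using max_nested_iff[OF E_G] by auto
qed

text \<open>Passing to the parent maps the non-descents other than \<open>E\<close> bijectively onto
  the nodes with a child that is not a descent, and by stability every descent is among the latter.
  Hence \<open>rk E = 1 + des + (des + n)\<close>, where \<open>n\<close> counts the non-descents
  with such a child.\<close>

lemma card_nondesc:
  assumes S: "S \<in> MN E" and st: "\<forall>X\<in>S. dsc S X \<longrightarrow> nondesc_child S X"
  shows "card {X \<in> S. \<not> dsc S X \<and> nondesc_child S X} + 2 * card (Des E indep lt S) = rk E - 1"
proof -
  have SN: "S \<in> NS E" and n: "nst S" and fin: "finite S" using S MN_NS NS_nst nst_fin by blast+
  have ES: "E \<in> S" using NS_G_mem[OF E_G SN] .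
  let ?D = "{X \<in> S. dsc S X}" and ?N = "{X \<in> S. nondesc_child S X}" and ?C = "{Y \<in> S. Y \<noteq> E \<and> \<not> dsc S Y}"
  have D: "Des E indep lt S = ?D" unfolding Des_def descent_def by blast
  have mx: "is_max_in S X \<longleftrightarrow> X = E" if "X \<in> S" for X using is_max_NS[OF E_G SN that] .
  have ED: "\<not> dsc S E" unfolding descent_def using mx[OF ES] by simp
  have ch: "Y \<in> children S (parent S Y)" if "Y \<in> S" "Y \<noteq> E" for Y
    unfolding children_def using that mx by auto
  have "bij_betw (parent S) ?C ?N"
    unfolding bij_betw_def
  proof
    show "inj_on (parent S) ?C"
    proof (rule inj_onI)
      fix Y Y' assume Y: "Y \<in> ?C" "Y' \<in> ?C" "parent S Y = parent S Y'"
      have "parent S Y \<in> S" using parent_props(1)[OF n] Y(1) mx by auto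
      then show "Y = Y'" using nondesc_child_unique[OF E_G S _ ch[of Y] _ _] ch[of Y'] Y by auto
    qed
    show "parent S ` ?C = ?N"
    proof
      show "parent S ` ?C \<subseteq> ?N"
        using parent_props(1)[OF n] mx ch unfolding nondesc_child_def by blast
      show "?N \<subseteq> parent S ` ?C"
      proof
        fix X assume "X \<in> ?N"
        then obtain Y where "Y \<in> children S X" "\<not> dsc S Y" unfolding nondesc_child_def by blast
        then show "X \<in> parent S ` ?C" unfolding children_def using mx by auto
      qed
    qed
  qed
  then have cN: "card ?N = card ?C" by (rule bij_betw_same_card[symmetric])
  have "S = insert E (?D \<union> ?C)" using ES by blast
  then have "card S = card (insert E (?D \<union> ?C))" by (rule arg_cong)
  moreover have "card (insert E (?D \<union> ?C)) = Suc (card (?D \<union> ?C))"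
    using fin ED by (intro card_insert_disjoint) auto
  moreover have "card (?D \<union> ?C) = card ?D + card ?C" by (rule card_Un_disjoint) (use fin in auto)
  ultimately have "card S = Suc (card ?D + card ?C)" by simp
  moreover have "?N = {X \<in> S. \<not> dsc S X \<and> nondesc_child S X} \<union> ?D" using st by blast
  moreover have "card ({X \<in> S. \<not> dsc S X \<and> nondesc_child S X} \<union> ?D) =
      card {X \<in> S. \<not> dsc S X \<and> nondesc_child S X} + card ?D" by (rule card_Un_disjoint) (use fin in auto)
  ultimately show ?thesis using cN card_MN[OF E_G S] D by simp
qed

lemma wR_E: assumes S: "S \<in> MN E"
  shows "wR E S = (if S \<in> stable_max_nested E indep \<G> lt
    then monom 1 (card (Des E indep lt S)) * [:1, 1:] ^ (rk E - 1 - 2 * card (Des E indep lt S)) else 0)"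
proof -
  have SN: "S \<in> NS E" and n: "nst S" and fin: "finite S" using S MN_NS NS_nst nst_fin by blast+
  have ES: "E \<in> S" using NS_G_mem[OF E_G SN] .
  have ED: "\<not> dsc S E" unfolding descent_def using is_max_NS[OF E_G SN ES] by simp
  \<comment> \<open>\<open>E\<close> is not a descent, so the root weights 1 + t and 1 of
    \<open>wR\<close> are its ordinary node weights.\<close>
  have "wR E S = node_weight S E * (\<Prod>X\<in>S - {E}. node_weight S X)"
    unfolding tree_weight_def node_weight_def[of S E] using ED by simp
  also have "\<dots> = prod (node_weight S) S" by (rule prod.remove[OF fin ES, symmetric])
  finally have w: "wR E S = prod (node_weight S) S" .
  show ?thesis
  proof (cases "\<forall>X\<in>S. dsc S X \<longrightarrow> nondesc_child S X")
    case False
    then obtain X where "X \<in> S" "node_weight S X = 0" unfolding node_weight_def by auto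
    then show ?thesis using w fin stable_iff False prod_zero[OF fin] by auto
  next
    case True
    let ?D = "{X \<in> S. dsc S X}" and ?N = "{X \<in> S. \<not> dsc S X \<and> nondesc_child S X}"
    have D: "Des E indep lt S = ?D" unfolding Des_def descent_def by blast
    have "prod (node_weight S) S = (\<Prod>X\<in>S. (if dsc S X then [:0, 1:] else 1) * (if \<not> dsc S X \<and> nondesc_child S X then [:1, 1:] else 1))"
      by (rule prod.cong[OF refl]) (use True in \<open>simp add: node_weight_def\<close>)
    also have "\<dots> = (\<Prod>X\<in>S. if dsc S X then [:0, 1:] else 1) * (\<Prod>X\<in>S. if \<not> dsc S X \<and> nondesc_child S X then [:1, 1:] else 1)"
      by (rule prod.distrib)
    also have "(\<Prod>X\<in>S. if dsc S X then [:0, 1:] else (1 :: rat poly)) = [:0, 1:] ^ card ?D"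
      using prod.inter_filter[OF fin, of "\<lambda>_. [:0, 1:]" "dsc S", symmetric] by simp
    also have "(\<Prod>X\<in>S. if \<not> dsc S X \<and> nondesc_child S X then [:1, 1:] else (1 :: rat poly)) = [:1, 1:] ^ card ?N"
      using prod.inter_filter[OF fin, of "\<lambda>_. [:1, 1:]" "\<lambda>X. \<not> dsc S X \<and> nondesc_child S X", symmetric] by simp
    also have "card ?N = rk E - 1 - 2 * card (Des E indep lt S)" using card_nondesc[OF S True] by simp
    also have "[:0, 1:] ^ card ?D = monom (1 :: rat) (card (Des E indep lt S))"
      using monom_altdef[of "1 :: rat" "card ?D"] D by simp
    finally show ?thesis using w stable_iff S True by simp
  qed
qed

definition FY_gf :: "rat poly" where
  "FY_gf = (\<Sum>S\<in>{S. nst S}. \<Prod>X\<in>S. tqint (rk X - rk (Jset E indep S X)))"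

lemma FY_gf_eq_NS_gf: "FY_gf = (\<Sum>J\<in>{J. flt J}. NS_gf J)"
proof -
  have "S \<in> (\<Union>J\<in>{J. flt J}. NS J)" if "nst S" for S using nst_NS[OF that] flat_cl by blast
  then have "{S. nst S} = (\<Union>J\<in>{J. flt J}. NS J)" using NS_nst by blast
  then have "FY_gf = (\<Sum>S\<in>(\<Union>J\<in>{J. flt J}. NS J). \<Prod>X\<in>S. tqint (rk X - rk (Jset E indep S X)))"
    unfolding FY_gf_def by simp
  also have "\<dots> = (\<Sum>J\<in>{J. flt J}. NS_gf J)" unfolding NS_gf_def
  proof (rule sum.UNION_disjoint)
    show "\<forall>J\<in>{J. flt J}. \<forall>J'\<in>{J. flt J}. J \<noteq> J' \<longrightarrow> NS J \<inter> NS J' = {}"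
      using NS_cl_Union by blast
  qed (use fin_flats fin_NS in auto)
  finally show ?thesis .
qed

lemma stable_sub: "stable_max_nested E indep \<G> lt \<subseteq> MN E" using stable_iff by blast

text \<open>For a flat of corank n below \<open>E\<close>, the nested sets with this join contribute
  factor 1 as they stand and t[n-1] once \<open>E\<close> is put on top. Together this is [n], so
  the label identity for \<open>qint\<close> applies.\<close>

lemma FY_gf_stable: "FY_gf = (\<Sum>S\<in>stable_max_nested E indep \<G> lt.
    monom 1 (card (Des E indep lt S)) * [:1, 1:] ^ (rk E - 1 - 2 * card (Des E indep lt S)))"
proof -
  have fl: "{J. flt J} = insert E (flats_below E)" unfolding flats_below_def using flat_sub flat_E by auto
  have "FY_gf = NS_gf E + (\<Sum>J\<in>flats_below E. NS_gf J)"
    unfolding FY_gf_eq_NS_gf fl by (rule sum.insert[OF fin_flats_below]) (simp add: flats_below_def)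
  also have "\<dots> = (\<Sum>J\<in>flats_below E. NS_gf J * tqint (rk E - rk J) + NS_gf J)"
    unfolding NS_gf_G[OF E_G] by (rule sum.distrib[symmetric])
  also have "\<dots> = (\<Sum>J\<in>flats_below E. NS_gf J * qint (rk E - rk J))"
  proof (rule sum.cong[OF refl])
    fix J assume "J \<in> flats_below E"
    then have "0 < rk E - rk J" using rk_flat_mono[of J E] unfolding flats_below_def by simp
    then show "NS_gf J * tqint (rk E - rk J) + NS_gf J = NS_gf J * qint (rk E - rk J)"
      using qint_tqint by (simp add: algebra_simps)
  qed
  also have "\<dots> = label_sum (\<lambda>_. True) qint E" using label_sum_True[OF flat_E] by simp
  also have "\<dots> = (\<Sum>T\<in>MN E. wR E T)" using label_sum_MN[OF E_G, of "\<lambda>_. True"] by simp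
  also have "\<dots> = (\<Sum>S\<in>stable_max_nested E indep \<G> lt. wR E S)"
    by (rule sum.mono_neutral_right[OF fin_MN stable_sub]) (use wR_E in auto)
  also have "\<dots> = (\<Sum>S\<in>stable_max_nested E indep \<G> lt.
    monom 1 (card (Des E indep lt S)) * [:1, 1:] ^ (rk E - 1 - 2 * card (Des E indep lt S)))"
    by (rule sum.cong[OF refl]) (use wR_E stable_sub in auto)
  finally show ?thesis .
qed

text \<open>The constant term serves to fix the degree of the polynomial in
  \<open>gamma_poly_eqI\<close>.\<close>

lemma FY_gf_0: "poly FY_gf 0 = 1"
proof -
  have "poly (\<Prod>X\<in>S. tqint (rk X - rk (Jset E indep S X))) 0 = (if S = {} then 1 else 0)" if "nst S" for S
    using nst_fin[OF that] unfolding poly_prod tqint_def by auto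
  then have "poly FY_gf 0 = (\<Sum>S\<in>{S. nst S}. if S = {} then 1 else 0)" unfolding FY_gf_def poly_sum by simp
  moreover have "finite {S. nst S}" by (rule finite_subset[of _ "Pow \<G>"]) (use finG nst_G in auto)
  ultimately show ?thesis using nst_empty by simp
qed

end

section \<open>Monomials, linear extension and substitution\<close>

context vector_space
begin

text \<open>The finite set \<open>S0\<close> is there because \<open>dim\<close> is a cardinality,
  which is 0 for infinite bases. This bound and \<open>dim_ge_quotient\<close> are applied to two
  different families over the same index set: monomials in the variables, and monomials in the sums
  \<open>upper_sum\<close>.\<close>

lemma dim_le_quotient:
  assumes P: "P \<subseteq> span S0" "finite S0" and Q: "Q \<subseteq> P" and I: "finite I" and sp: "P \<subseteq> span (Q \<union> v ` I)"
  shows "dim P \<le> dim Q + card I"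
proof -
  obtain B where B: "B \<subseteq> Q" "independent B" "Q \<subseteq> span B" "card B = dim Q" by (rule basis_exists)
  have "B \<subseteq> span S0" using B(1) Q P(1) by (meson subset_trans)
  then have fB: "finite B" using independent_span_bound[OF P(2) B(2)] by simp
  have "Q \<union> v ` I \<subseteq> span (B \<union> v ` I)"
  proof
    fix x assume "x \<in> Q \<union> v ` I"
    then show "x \<in> span (B \<union> v ` I)"
    proof
      assume "x \<in> Q"
      then show ?thesis using B(3) span_mono[of B "B \<union> v ` I"] by blast
    qed (rule span_base, blast)
  qed
  then have "P \<subseteq> span (B \<union> v ` I)" using sp span_minimal[OF _ subspace_span] by (meson subset_trans)
  then have "dim P \<le> card (B \<union> v ` I)" by (rule dim_le_card) (use fB I in simp)
  also have "\<dots> \<le> card B + card (v ` I)" by (rule card_Un_le)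
  also have "\<dots> \<le> dim Q + card I" using B(4) card_image_le[OF I] by simp
  finally show ?thesis .
qed

lemma dim_ge_quotient:
  assumes P: "P \<subseteq> span S0" "finite S0" and Q: "Q \<subseteq> P" "subspace Q" and I: "finite I" and v: "v ` I \<subseteq> P"
    and ind: "\<And>c. (\<Sum>i\<in>I. c i *s v i) \<in> Q \<Longrightarrow> \<forall>i\<in>I. c i = 0"
  shows "dim Q + card I \<le> dim P"
proof -
  obtain B where B: "B \<subseteq> Q" "independent B" "Q \<subseteq> span B" "card B = dim Q" by (rule basis_exists)
  have "B \<subseteq> span S0" using B(1) Q P(1) by (meson subset_trans)
  then have fB: "finite B" using independent_span_bound[OF P(2) B(2)] by simp
  have inj: "inj_on v I"
  proof (rule inj_onI, rule ccontr)
    fix i j assume ij: "i \<in> I" "j \<in> I" "v i = v j" "i \<noteq> j"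
    \<comment> \<open>A coincidence \<open>v i = v j\<close> would be a nontrivial combination with
      value 0, which lies in \<open>Q\<close>.\<close>
    define c where "c = (\<lambda>k. if k = i then 1 else if k = j then -1 else (0 :: 'a))"
    have "(\<Sum>k\<in>I. c k *s v k) = (\<Sum>k\<in>{i, j}. c k *s v k)"
      by (rule sum.mono_neutral_right[OF I]) (use ij in \<open>auto simp: c_def\<close>)
    also have "\<dots> = 0" using ij by (simp add: c_def)
    finally have "(\<Sum>k\<in>I. c k *s v k) \<in> Q" using subspace_0[OF Q(2)] by simp
    then have "c i = 0" using ind ij(1) by blast
    then show False by (simp add: c_def)
  qed
  have disj: "B \<inter> v ` I = {}"
  proof (rule ccontr)
    assume "B \<inter> v ` I \<noteq> {}"
    then obtain i where i: "i \<in> I" "v i \<in> Q" using B(1) by blast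
    define c where "c = (\<lambda>k. if k = i then (1 :: 'a) else 0)"
    have "(\<Sum>k\<in>I. c k *s v k) = (\<Sum>k\<in>{i}. c k *s v k)"
      by (rule sum.mono_neutral_right[OF I]) (use i in \<open>auto simp: c_def\<close>)
    then have "(\<Sum>k\<in>I. c k *s v k) \<in> Q" using i by (simp add: c_def)
    then have "c i = 0" using ind i(1) by blast
    then show False by (simp add: c_def)
  qed
  have "independent (B \<union> v ` I)"
  proof (rule independent_if_scalars_zero)
    show "finite (B \<union> v ` I)" using fB I by simp
    fix f x assume s: "(\<Sum>x\<in>B \<union> v ` I. f x *s x) = 0" and x: "x \<in> B \<union> v ` I"
    have "(\<Sum>x\<in>B \<union> v ` I. f x *s x) = (\<Sum>x\<in>B. f x *s x) + (\<Sum>x\<in>v ` I. f x *s x)"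
      by (rule sum.union_disjoint[OF fB _ disj]) (use I in simp)
    also have "(\<Sum>x\<in>v ` I. f x *s x) = (\<Sum>i\<in>I. f (v i) *s v i)" using sum.reindex[OF inj] by simp
    finally have eq: "(\<Sum>x\<in>B. f x *s x) + (\<Sum>i\<in>I. f (v i) *s v i) = 0" using s by simp
    have "(\<Sum>x\<in>B. f x *s x) \<in> Q"
      by (rule subspace_sum[OF Q(2)]) (use B(1) subspace_scale[OF Q(2)] in blast)
    moreover have "(\<Sum>i\<in>I. f (v i) *s v i) = - (\<Sum>x\<in>B. f x *s x)" using eq by (simp add: eq_neg_iff_add_eq_0 add.commute)
    ultimately have "(\<Sum>i\<in>I. f (v i) *s v i) \<in> Q" using subspace_neg[OF Q(2)] by simp
    then have z: "\<forall>i\<in>I. f (v i) = 0" using ind[of "\<lambda>i. f (v i)"] by blast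
    then have "(\<Sum>x\<in>B. f x *s x) = 0" using eq by simp
    then have "\<And>y. y \<in> B \<Longrightarrow> f y = 0" using independentD[OF B(2) fB order_refl] by blast
    then show "f x = 0" using x z by blast
  qed
  moreover obtain C where C: "C \<subseteq> P" "independent C" "P \<subseteq> span C" "card C = dim P" by (rule basis_exists)
  have fC: "finite C" using independent_span_bound[OF P(2) C(2)] C(1) P(1) by (meson subset_trans)
  moreover have "B \<union> v ` I \<subseteq> span C" using B(1) Q(1) v C(3) by blast
  ultimately have "card (B \<union> v ` I) \<le> card C" using independent_span_bound by blast
  moreover have "card (B \<union> v ` I) = card B + card (v ` I)"
    by (rule card_Un_disjoint[OF fB _ disj]) (use I in simp)
  moreover have "card (v ` I) = card I" using card_image[OF inj] .
  ultimately show ?thesis using B(4) C(4) by simp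
qed

end

abbreviation "keys \<equiv> Poly_Mapping.keys"
abbreviation "lookup \<equiv> Poly_Mapping.lookup"
abbreviation "single \<equiv> Poly_Mapping.single"

lemma cscale_eq: "cscale c p = single 0 c * p"
  unfolding cscale_def by (rule mult_map_scale_conv_mult)

interpretation cpoly: vector_space "cscale :: rat \<Rightarrow> 'a cpoly \<Rightarrow> 'a cpoly"
proof
  fix a b :: rat and x y :: "'a cpoly"
  show "cscale a (x + y) = cscale a x + cscale a y" by (simp add: cscale_eq distrib_left)
  show "cscale (a + b) x = cscale a x + cscale b x" by (simp add: cscale_eq single_add distrib_right)
  show "cscale a (cscale b x) = cscale (a * b) x"
    by (simp add: cscale_eq mult.assoc[symmetric] mult_single)
  show "cscale 1 x = x" by (simp add: cscale_eq)
qed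

lemma cscale_mult: "cscale c p * q = cscale c (p * q)" and mult_cscale: "p * cscale c q = cscale c (p * q)"
  by (simp_all add: cscale_eq mult.assoc mult.left_commute)

lemma lookup_cscale: "lookup (cscale c p) m = c * lookup p m"
  unfolding cscale_def by (simp add: Poly_Mapping.map.rep_eq when_def)

definition cmon :: "('a set \<Rightarrow>\<^sub>0 nat) \<Rightarrow> 'a cpoly" where "cmon m = single m 1"

lemma cmon_0 [simp]: "cmon 0 = 1" unfolding cmon_def by simp

lemma cmon_add: "cmon (m + k) = cmon m * cmon k" unfolding cmon_def by (simp add: mult_single)

lemma cvar_cmon: "cvar G = cmon (single G 1)" unfolding cvar_def cmon_def ..

lemma cvar_power: "cvar G ^ n = cmon (single G n)"
proof (induction n)
  case (Suc n)
  have "single G (Suc n) = single G 1 + single G n"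
    by (simp add: single_add[symmetric])
  then show ?case using Suc by (simp add: cmon_add cvar_cmon)
qed simp

definition indicator_mon :: "'a set set \<Rightarrow> ('a set \<Rightarrow>\<^sub>0 nat)" where "indicator_mon T = (\<Sum>G\<in>T. single G 1)"

lemma prod_cvar: "finite T \<Longrightarrow> (\<Prod>G\<in>T. cvar G) = cmon (indicator_mon T)"
  unfolding indicator_mon_def by (induction T rule: finite_induct) (simp_all add: cmon_add cvar_cmon)

lemma keys_add_sub: "keys m \<subseteq> A \<Longrightarrow> keys k \<subseteq> A \<Longrightarrow> keys (m + k) \<subseteq> A"
  using keys_add[of m k] by blast

lemma lookup_indicator_mon: "finite T \<Longrightarrow> lookup (indicator_mon T) G = (if G \<in> T then 1 else 0)"
proof -
  assume T: "finite T"
  have "lookup (indicator_mon T) G = (\<Sum>H\<in>T. if G = H then 1 else 0)"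
    unfolding indicator_mon_def lookup_sum by (rule sum.cong) (auto simp: lookup_single when_def)
  then show ?thesis using T by simp
qed

lemma keys_indicator_mon: "finite T \<Longrightarrow> keys (indicator_mon T) = T"
  by (auto simp: in_keys_iff lookup_indicator_mon split: if_splits)

lemma cpoly_expand: "p = (\<Sum>m\<in>keys p. cscale (lookup p m) (cmon m))"
proof (rule poly_mapping_eqI)
  fix k
  have "lookup p k = (\<Sum>m\<in>keys p. if k = m then lookup p m else 0)"
    by (simp add: in_keys_iff)
  also have "\<dots> = lookup (\<Sum>m\<in>keys p. cscale (lookup p m) (cmon m)) k"
    unfolding lookup_sum lookup_cscale cmon_def by (rule sum.cong) (auto simp: lookup_single when_def)
  finally show "lookup p k =
      lookup (\<Sum>m\<in>keys p. cscale (lookup p m) (cmon m)) k" .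
qed

text \<open>The values are polynomials, so that one construction serves substitutions and
  functionals alike; a functional takes constant polynomials as values.\<close>

definition lin_ext :: "(('a set \<Rightarrow>\<^sub>0 nat) \<Rightarrow> 'b cpoly) \<Rightarrow> 'a cpoly \<Rightarrow> 'b cpoly" where
  "lin_ext f p = (\<Sum>m\<in>keys p. cscale (lookup p m) (f m))"

lemma lin_ext_add: "lin_ext f (p + q) = lin_ext f p + lin_ext f q"
  unfolding lin_ext_def
  by (rule setsum_keys_plus_distrib) (simp_all add: cpoly.scale_left_distrib)

lemma lin_ext_cmon [simp]: "lin_ext f (cmon m) = f m"
  unfolding lin_ext_def cmon_def by simp

lemma lin_ext_0 [simp]: "lin_ext f 0 = 0" unfolding lin_ext_def by simp

lemma lin_ext_cscale: "lin_ext f (cscale c p) = cscale c (lin_ext f p)"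
proof (cases "c = 0")
  case False
  then have "keys (cscale c p) = keys p" by (auto simp: in_keys_iff lookup_cscale)
  then show ?thesis unfolding lin_ext_def by (simp add: lookup_cscale cpoly.scale_sum_right)
qed simp

lemma lin_ext_sum: "lin_ext f (sum p A) = (\<Sum>i\<in>A. lin_ext f (p i))"
  by (induction A rule: infinite_finite_induct) (simp_all add: lin_ext_add)

lemma lin_ext_minus: "lin_ext f (p - q) = lin_ext f p - lin_ext f q"
proof -
  have "lin_ext f (p - q) + lin_ext f q = lin_ext f p" unfolding lin_ext_add[symmetric] by simp
  then show ?thesis by (simp add: algebra_simps)
qed

lemma cpoly_linear_induct:
  assumes "\<And>m. P (cmon m)" "\<And>p q. P p \<Longrightarrow> P q \<Longrightarrow> P (p + q)" "\<And>c p. P p \<Longrightarrow> P (cscale c p)" "P 0"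
  shows "P p"
proof -
  have "P (\<Sum>m\<in>A. cscale (lookup p m) (cmon m))" for A
    by (induction A rule: infinite_finite_induct) (use assms in auto)
  then show ?thesis using cpoly_expand[of p] by metis
qed

definition mon_subst :: "('a set \<Rightarrow> 'b cpoly) \<Rightarrow> ('a set \<Rightarrow>\<^sub>0 nat) \<Rightarrow> 'b cpoly" where
  "mon_subst \<xi> m = (\<Prod>G\<in>keys m. \<xi> G ^ lookup m G)"

lemma mon_subst_superset: "finite A \<Longrightarrow> keys m \<subseteq> A \<Longrightarrow> mon_subst \<xi> m = (\<Prod>G\<in>A. \<xi> G ^ lookup m G)"
  unfolding mon_subst_def by (rule prod.mono_neutral_left) (auto simp: in_keys_iff)

lemma mon_subst_add: "mon_subst \<xi> (m + k) = mon_subst \<xi> m * mon_subst \<xi> k"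
proof -
  let ?A = "keys m \<union> keys k"
  have "mon_subst \<xi> (m + k) = (\<Prod>G\<in>?A. \<xi> G ^ lookup (m + k) G)"
    by (rule mon_subst_superset) (use keys_add[of m k] in auto)
  also have "\<dots> = (\<Prod>G\<in>?A. \<xi> G ^ lookup m G) * (\<Prod>G\<in>?A. \<xi> G ^ lookup k G)"
    by (simp add: lookup_add power_add prod.distrib)
  also have "(\<Prod>G\<in>?A. \<xi> G ^ lookup m G) = mon_subst \<xi> m"
    by (rule mon_subst_superset[symmetric]) auto
  also have "(\<Prod>G\<in>?A. \<xi> G ^ lookup k G) = mon_subst \<xi> k"
    by (rule mon_subst_superset[symmetric]) auto
  finally show ?thesis .
qed

lemma mon_subst_0 [simp]: "mon_subst \<xi> 0 = 1" unfolding mon_subst_def by simp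

lemma mon_subst_single [simp]: "mon_subst \<xi> (single G 1) = \<xi> G" unfolding mon_subst_def by simp

definition csubst :: "('a set \<Rightarrow> 'b cpoly) \<Rightarrow> 'a cpoly \<Rightarrow> 'b cpoly" where
  "csubst \<xi> = lin_ext (mon_subst \<xi>)"

lemma csubst_mult: "csubst \<xi> (p * q) = csubst \<xi> p * csubst \<xi> q"
proof (induction p rule: cpoly_linear_induct)
  case (1 m)
  show ?case
  proof (induction q rule: cpoly_linear_induct)
    case (1 k)
    show ?case unfolding csubst_def cmon_add[symmetric] lin_ext_cmon by (rule mon_subst_add)
  next
    case (2 p q)
    then show ?case by (simp add: csubst_def lin_ext_add distrib_left)
  next
    case (3 c p)
    then show ?case by (simp add: csubst_def lin_ext_cscale mult_cscale)
  next
    case 4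
    then show ?case by (simp add: csubst_def)
  qed
next
  case (2 p q)
  then show ?case by (simp add: csubst_def lin_ext_add distrib_right)
next
  case (3 c p)
  then show ?case by (simp add: csubst_def lin_ext_cscale cscale_mult)
next
  case 4
  then show ?case by (simp add: csubst_def)
qed

lemma csubst_cmon [simp]: "csubst \<xi> (cmon m) = mon_subst \<xi> m" unfolding csubst_def by simp

lemma csubst_cvar [simp]: "csubst \<xi> (cvar G) = \<xi> G"
  unfolding cvar_cmon csubst_cmon by (rule mon_subst_single)

lemma csubst_1 [simp]: "csubst \<xi> 1 = 1" using csubst_cmon[of \<xi> 0] by simp

lemma csubst_sum: "csubst \<xi> (sum p A) = (\<Sum>i\<in>A. csubst \<xi> (p i))"
  unfolding csubst_def by (rule lin_ext_sum)

lemma csubst_prod: "csubst \<xi> (prod p A) = (\<Prod>i\<in>A. csubst \<xi> (p i))"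
  by (induction A rule: infinite_finite_induct) (simp_all add: csubst_mult)

lemma csubst_power: "csubst \<xi> (p ^ n) = csubst \<xi> p ^ n"
  by (induction n) (simp_all add: csubst_mult)

text \<open>For \<open>f = rk\<close> this is the total rank of a monomial, for \<open>f\<close>
  constantly 1 its degree.\<close>

definition wsum :: "('a set \<Rightarrow> nat) \<Rightarrow> ('a set \<Rightarrow>\<^sub>0 nat) \<Rightarrow> nat" where
  "wsum f m = (\<Sum>G\<in>keys m. lookup m G * f G)"

lemma wsum_add: "wsum f (m + k) = wsum f m + wsum f k"
  unfolding wsum_def by (rule setsum_keys_plus_distrib) (simp_all add: distrib_right)

lemma wsum_single [simp]: "wsum f (single G n) = n * f G"
  unfolding wsum_def by simp

lemma wsum_0 [simp]: "wsum f 0 = 0" unfolding wsum_def by simp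

lemma mdeg_wsum: "mdeg m = wsum (\<lambda>_. 1) m" unfolding mdeg_def wsum_def by simp

section \<open>The filtration by total rank and the Chow ideal\<close>

context building_set_matroid
begin

definition rank_mons :: "nat \<Rightarrow> nat \<Rightarrow> ('a set \<Rightarrow>\<^sub>0 nat) set" where
  "rank_mons i s = {m. keys m \<subseteq> \<G> \<and> mdeg m = i \<and> s \<le> wsum rk m}"

text \<open>A filtration that decreases in \<open>s\<close>; straightening moves a monomial to
  larger \<open>s\<close>, and \<open>wsum_le\<close> bounds the total rank in a given
  degree.\<close>

definition rank_part :: "nat \<Rightarrow> nat \<Rightarrow> 'a cpoly set" where "rank_part i s = cpoly.span (cmon ` rank_mons i s)"

abbreviation ID :: "'a cpoly set" where "ID \<equiv> chow_ideal E indep \<G>"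

text \<open>The polynomial type has a variable for every set, so the subring on the variables in
  \<open>\<G>\<close> is singled out; \<open>chow_ideal\<close> is an ideal of it.\<close>

definition G_polys :: "'a cpoly set" where "G_polys = cpoly.span (cmon ` {m. keys m \<subseteq> \<G>})"

lemma hom_part_rank_part: "hom_part \<G> i = rank_part i 0"
proof -
  have "{single m (1 :: rat) |m. keys m \<subseteq> \<G> \<and> mdeg m = i} = cmon ` rank_mons i 0"
    unfolding cmon_def rank_mons_def by auto
  then show ?thesis unfolding hom_part_def rank_part_def by simp
qed

lemma rank_part_mono: "s \<le> s' \<Longrightarrow> rank_part i s' \<subseteq> rank_part i s"
  unfolding rank_part_def rank_mons_def by (rule cpoly.span_mono) auto

lemma span_mult:
  assumes "\<And>m k. m \<in> A \<Longrightarrow> k \<in> B \<Longrightarrow> m + k \<in> C" "p \<in> cpoly.span (cmon ` A)" "q \<in> cpoly.span (cmon ` B)"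
  shows "p * q \<in> cpoly.span (cmon ` C)"
  using assms(2)
proof (induction rule: cpoly.span_induct_alt)
  case base show ?case by (simp add: cpoly.span_zero)
next
  case (step c x y)
  obtain m where m: "m \<in> A" "x = cmon m" using step.hyps(1) by blast
  have "cmon m * q \<in> cpoly.span (cmon ` C)" using assms(3)
  proof (induction rule: cpoly.span_induct_alt)
    case base show ?case by (simp add: cpoly.span_zero)
  next
    case (step d x' y')
    then obtain k where k: "k \<in> B" "x' = cmon k" by blast
    have "cmon m * cmon k \<in> cpoly.span (cmon ` C)"
      unfolding cmon_add[symmetric] by (intro cpoly.span_base imageI assms(1) m k)
    then show ?case using step k by (simp add: distrib_left mult_cscale cpoly.span_add cpoly.span_scale)
  qed
  then show ?case using step m by (simp add: distrib_right cscale_mult cpoly.span_add cpoly.span_scale)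
qed

lemma rank_part_mult: "p \<in> rank_part i s \<Longrightarrow> q \<in> rank_part j t \<Longrightarrow> p * q \<in> rank_part (i + j) (s + t)"
  unfolding rank_part_def
  by (rule span_mult[of "rank_mons i s" "rank_mons j t"])
     (simp_all add: rank_mons_def mdeg_wsum wsum_add keys_add_sub)

lemma G_polys_mult: "p \<in> G_polys \<Longrightarrow> q \<in> G_polys \<Longrightarrow> p * q \<in> G_polys"
  unfolding G_polys_def by (rule span_mult) (simp_all add: keys_add_sub)

lemma cmon_G_polys: "keys m \<subseteq> \<G> \<Longrightarrow> cmon m \<in> G_polys"
  unfolding G_polys_def by (intro cpoly.span_base) auto

lemma cvar_G_polys: "G \<in> \<G> \<Longrightarrow> cvar G \<in> G_polys" unfolding cvar_cmon by (rule cmon_G_polys) simp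

lemma one_G_polys: "1 \<in> G_polys" using cmon_G_polys[of 0] by simp

lemma G_polys_sum: "(\<And>i. i \<in> A \<Longrightarrow> p i \<in> G_polys) \<Longrightarrow> sum p A \<in> G_polys"
  unfolding G_polys_def by (rule cpoly.span_sum)

lemma G_polys_prod: "(\<And>i. i \<in> A \<Longrightarrow> p i \<in> G_polys) \<Longrightarrow> prod p A \<in> G_polys"
  by (induction A rule: infinite_finite_induct) (auto intro: G_polys_mult one_G_polys)

lemma G_polys_power: "p \<in> G_polys \<Longrightarrow> p ^ n \<in> G_polys"
  by (induction n) (auto intro: G_polys_mult one_G_polys)

lemma rank_part_cmon: "keys m \<subseteq> \<G> \<Longrightarrow> mdeg m = i \<Longrightarrow> s \<le> wsum rk m \<Longrightarrow> cmon m \<in> rank_part i s"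
  unfolding rank_part_def rank_mons_def by (intro cpoly.span_base) auto

lemma rank_part_cvar: "G \<in> \<G> \<Longrightarrow> s \<le> rk G \<Longrightarrow> cvar G \<in> rank_part 1 s"
  unfolding cvar_cmon by (rule rank_part_cmon) (simp_all add: mdeg_wsum)

lemma rank_part_one: "1 \<in> rank_part 0 0" using rank_part_cmon[of 0 0 0] by (simp add: mdeg_wsum)

lemma rank_part_power: "p \<in> rank_part i s \<Longrightarrow> p ^ n \<in> rank_part (n * i) (n * s)"
proof (induction n)
  case (Suc n) then show ?case using rank_part_mult[of p i s "p ^ n"] by simp
qed (simp add: rank_part_one)

lemma rank_part_sum: "(\<And>j. j \<in> A \<Longrightarrow> p j \<in> rank_part i s) \<Longrightarrow> sum p A \<in> rank_part i s"
  unfolding rank_part_def by (rule cpoly.span_sum)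

lemma rank_part_subspace: "cpoly.subspace (rank_part i s)" unfolding rank_part_def by (rule cpoly.subspace_span)

lemma ID_subspace: "cpoly.subspace ID" unfolding chow_ideal_def by (rule cpoly.subspace_span)

definition ID_gens :: "'a cpoly set" where
  "ID_gens = {cmon m * g |m g. keys m \<subseteq> \<G> \<and> g \<in> chow_gens E indep \<G>}"

lemma ID_span: "ID = cpoly.span ID_gens" unfolding chow_ideal_def ID_gens_def cmon_def ..

lemma ID_gensI: "keys m \<subseteq> \<G> \<Longrightarrow> g \<in> chow_gens E indep \<G> \<Longrightarrow> cmon m * g \<in> ID_gens"
  unfolding ID_gens_def by blast

lemma ID_gen: assumes "g \<in> chow_gens E indep \<G>" shows "g \<in> ID"
  using cpoly.span_base[OF ID_gensI[of 0, OF _ assms]] unfolding ID_span by simp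

lemma ID_mult: assumes p: "p \<in> G_polys" and q: "q \<in> ID" shows "p * q \<in> ID"
proof -
  have 1: "cmon m * q \<in> ID" if m: "keys m \<subseteq> \<G>" for m
    using q unfolding ID_span
  proof (induction rule: cpoly.span_induct_alt)
    case base show ?case by (simp add: cpoly.span_zero)
  next
    case (step c x y)
    obtain k g where k: "x = cmon k * g" "keys k \<subseteq> \<G>" "g \<in> chow_gens E indep \<G>"
      using step.hyps(1) unfolding ID_gens_def by blast
    have "cmon m * x \<in> cpoly.span ID_gens"
      unfolding k(1) mult.assoc[symmetric] cmon_add[symmetric]
      by (intro cpoly.span_base ID_gensI keys_add_sub m k)
    then show ?case using step.IH unfolding distrib_left mult_cscale
      by (intro cpoly.span_add cpoly.span_scale)
  qed
  show ?thesis using p unfolding G_polys_def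
  proof (induction rule: cpoly.span_induct_alt)
    case base show ?case using cpoly.subspace_0[OF ID_subspace] by simp
  next
    case (step c x y)
    obtain m where m: "x = cmon m" "keys m \<subseteq> \<G>" using step.hyps(1) by blast
    show ?case unfolding distrib_right cscale_mult m(1)
      by (intro cpoly.subspace_add[OF ID_subspace] cpoly.subspace_scale[OF ID_subspace] 1 m(2) step.IH)
  qed
qed

lemma fin_rank_mons: "finite (rank_mons i s)"
proof -
  have inj: "inj_on (\<lambda>m. \<lambda>G\<in>\<G>. lookup m G) (rank_mons i s)"
  proof (rule inj_onI, rule poly_mapping_eqI)
    fix m k G assume a: "m \<in> rank_mons i s" "k \<in> rank_mons i s"
      "(\<lambda>G\<in>\<G>. lookup m G) = (\<lambda>G\<in>\<G>. lookup k G)"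
    show "lookup m G = lookup k G"
    proof (cases "G \<in> \<G>")
      case True then show ?thesis using fun_cong[OF a(3), of G] by simp
    next
      case False
      then have "G \<notin> keys m" "G \<notin> keys k" using a(1,2) unfolding rank_mons_def by auto
      then show ?thesis by (simp add: in_keys_iff)
    qed
  qed
  have "(\<lambda>m. \<lambda>G\<in>\<G>. lookup m G) ` rank_mons i s \<subseteq> (\<Pi>\<^sub>E G\<in>\<G>. {..i})"
  proof
    fix f assume "f \<in> (\<lambda>m. \<lambda>G\<in>\<G>. lookup m G) ` rank_mons i s"
    then obtain m where m: "m \<in> rank_mons i s" "f = (\<lambda>G\<in>\<G>. lookup m G)" by blast
    have "lookup m G \<le> i" for G
    proof (cases "G \<in> keys m")
      case True
      then have "lookup m G \<le> mdeg m" unfolding mdeg_def by (intro member_le_sum) auto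
      then show ?thesis using m(1) unfolding rank_mons_def by simp
    qed (simp add: in_keys_iff)
    then show "f \<in> (\<Pi>\<^sub>E G\<in>\<G>. {..i})" using m(2) by auto
  qed
  moreover have "finite (\<Pi>\<^sub>E G\<in>\<G>. {..i})" by (rule finite_PiE[OF finG]) auto
  ultimately show ?thesis using finite_imageD[OF finite_subset inj] by blast
qed

end

section \<open>Feichtner--Yuzvinsky monomials span\<close>

context building_set_matroid
begin

definition upper_sum :: "'a set \<Rightarrow> 'a cpoly" where "upper_sum B = (\<Sum>G\<in>{G \<in> \<G>. B \<subseteq> G}. cvar G)"

definition FY :: "('a set \<Rightarrow>\<^sub>0 nat) \<Rightarrow> bool" where
  "FY m \<longleftrightarrow> nst (keys m) \<and>
    (\<forall>X\<in>keys m. lookup m X < rk X - rk (Jset E indep (keys m) X))"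

definition FYs :: "nat \<Rightarrow> ('a set \<Rightarrow>\<^sub>0 nat) set" where "FYs i = {m. FY m \<and> mdeg m = i}"

lemma FYs_rank_mons: "FYs i \<subseteq> rank_mons i 0"
  unfolding FYs_def FY_def rank_mons_def using nst_G by auto

lemma fin_FYs: "finite (FYs i)" by (rule finite_subset[OF FYs_rank_mons fin_rank_mons])

lemma upper_sum_G_polys: "upper_sum B \<in> G_polys" unfolding upper_sum_def by (rule G_polys_sum) (auto intro: cvar_G_polys)

lemma ID_add: "p \<in> ID \<Longrightarrow> q \<in> ID \<Longrightarrow> p + q \<in> ID" and ID_diff: "p \<in> ID \<Longrightarrow> q \<in> ID \<Longrightarrow> p - q \<in> ID"
  and ID_sum: "(\<And>i. i \<in> A \<Longrightarrow> f i \<in> ID) \<Longrightarrow> sum f A \<in> ID"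
  using cpoly.subspace_add[OF ID_subspace] cpoly.subspace_diff[OF ID_subspace] cpoly.subspace_sum[OF ID_subspace]
  by blast+

lemma ID_nonnested: assumes "T \<subseteq> \<G>" "\<not> nst T" shows "(\<Prod>G\<in>T. cvar G) \<in> ID"
  by (rule ID_gen) (use assms in \<open>auto simp: chow_gens_def\<close>)

lemma ID_atom: assumes a: "a \<in> E" shows "(\<Sum>G\<in>{G \<in> \<G>. a \<in> G}. cvar G) \<in> ID"
proof -
  have ac: "a \<in> cl {a}" using cl_ext[of "{a}"] a by blast
  have "atom E indep (cl {a})"
    unfolding atom_def
  proof (intro conjI allI impI)
    show "cl {a} \<noteq> cl {}" using ac by auto
    fix F assume F: "flt F \<and> F \<subseteq> cl {a}"
    show "F = cl {} \<or> F = cl {a}"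
    proof (cases "F = {}")
      case False
      then have "rk (cl {a}) \<le> rk F" using rk_flat_pos[of F] F rk_singleton[OF a] by simp
      then show ?thesis using flat_eqI[of F "cl {a}"] F by simp
    qed simp
  qed simp
  then have "(\<Sum>G\<in>{G \<in> \<G>. cl {a} \<subseteq> G}. cvar G) \<in> ID" by (intro ID_gen) (auto simp: chow_gens_def)
  moreover have "{G \<in> \<G>. cl {a} \<subseteq> G} = {G \<in> \<G>. a \<in> G}"
    using cl_sub_iff[of "{a}"] a G_flat by auto
  ultimately show ?thesis by simp
qed

lemma G_union_below: assumes "H \<in> \<G>" "G \<subseteq> E" "B \<subseteq> E" shows "cl (G \<union> B) \<subseteq> H \<longleftrightarrow> G \<subseteq> H \<and> B \<subseteq> H"
  using cl_sub_iff[of "G \<union> B" H] assms G_flat by auto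

text \<open>The two sums differ by the \<open>x_H\<close> with \<open>H\<close> above
  \<open>B\<close> but not above \<open>G\<close>. Such an \<open>H\<close> meets \<open>G\<close>,
  in points of \<open>B\<close>, and is not comparable with it, so \<open>{G, H}\<close> is not
  nested.\<close>

lemma upper_sum_shift:
  assumes G: "G \<in> \<G>" and B: "B \<in> \<G>" and ne: "G \<inter> B \<noteq> {}" and nsub: "\<not> B \<subseteq> G"
  shows "cvar G * (upper_sum B - upper_sum (cl (G \<union> B))) \<in> ID"
proof -
  have eq: "{H \<in> \<G>. cl (G \<union> B) \<subseteq> H} = {H \<in> \<G>. G \<subseteq> H \<and> B \<subseteq> H}"
    using G_union_below[OF _ G_sub[OF G] G_sub[OF B]] by blast
  have "upper_sum B = upper_sum (cl (G \<union> B)) + (\<Sum>H\<in>{H \<in> \<G>. B \<subseteq> H \<and> \<not> G \<subseteq> H}. cvar H)"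
    unfolding upper_sum_def eq by (subst sum.union_disjoint[symmetric]) (use finG in \<open>auto intro: sum.cong\<close>)
  then have "cvar G * (upper_sum B - upper_sum (cl (G \<union> B))) = (\<Sum>H\<in>{H \<in> \<G>. B \<subseteq> H \<and> \<not> G \<subseteq> H}. cvar G * cvar H)"
    by (simp add: sum_distrib_left)
  also have "\<dots> \<in> ID"
  proof (rule ID_sum)
    fix H assume "H \<in> {H \<in> \<G>. B \<subseteq> H \<and> \<not> G \<subseteq> H}"
    then have H: "H \<in> \<G>" "B \<subseteq> H" "\<not> G \<subseteq> H" by auto
    have "\<not> nst {G, H}"
    proof
      assume n: "nst {G, H}"
      have "G \<subseteq> H \<or> H \<subseteq> G" by (rule nst_comparable[OF n]) (use ne H in auto)
      then show False using H nsub by blast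
    qed
    then have "(\<Prod>X\<in>{G, H}. cvar X) \<in> ID" using G H by (intro ID_nonnested) auto
    moreover have "G \<noteq> H" using H by auto
    ultimately show "cvar G * cvar H \<in> ID" by simp
  qed
  finally show ?thesis .
qed

lemma power_diff_ID:
  assumes "x * (p - q) \<in> ID" "p \<in> G_polys" "q \<in> G_polys" shows "x * (p ^ n - q ^ n) \<in> ID"
proof (induction n)
  case 0
  then show ?case using cpoly.subspace_0[OF ID_subspace] by simp
next
  case (Suc n)
  have "x * (p ^ Suc n - q ^ Suc n) = p * (x * (p ^ n - q ^ n)) + q ^ n * (x * (p - q))"
    by (simp add: algebra_simps)
  then show ?case using ID_add[OF ID_mult[OF assms(2) Suc] ID_mult[OF G_polys_power[OF assms(3)] assms(1)]] by simp
qed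

text \<open>For an \<open>a \<in> B\<close> outside the join of \<open>T\<close>, the linear relation of \<open>a\<close> replaces one factor \<open>h\<^sub>B\<close> by
  variables \<open>x\<^sub>G\<close> with \<open>a \<in> G\<close>; then \<open>x\<^sub>G h\<^sub>B = x\<^sub>G h\<^sub>C\<close> with \<open>C\<close> the join of \<open>B\<close> and \<open>G\<close>.\<close>

lemma ID_relation:
  assumes "B \<in> \<G>" "finite T" "\<And>X. X \<in> T \<Longrightarrow> X \<in> \<G> \<and> X \<subset> B" "rk B \<le> rk (\<Union>T) + n"
  shows "(\<Prod>G\<in>T. cvar G) * upper_sum B ^ n \<in> ID"
  using assms
proof (induction n arbitrary: B T)
  case (0 B T)
  have "cl (\<Union>T) \<subseteq> B" by (rule cl_least) (use 0 G_flat in auto)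
  then have "cl (\<Union>T) = B" using flat_eqI[OF flat_cl G_flat[OF 0(1)]] 0(4) by simp
  \<comment> \<open>If \<open>T\<close> were nested, \<open>B\<close> would be the only factor of
    its join and thus belong to \<open>T\<close>, whose members are proper subsets of
    \<open>B\<close>.\<close>
  then have "\<not> nst T" using nst_NS[of T] NS_G_mem[OF 0(1)] 0(3) by blast
  then show ?case using ID_nonnested[of T] 0(3) by auto
next
  case (Suc n)
  note B = Suc.prems(1) and T = Suc.prems(3)
  have TE: "\<Union>T \<subseteq> E" using T G_sub by blast
  have sub: "cl (\<Union>T) \<subseteq> B" by (rule cl_least) (use T G_flat[OF B] in auto)
  have TG: "(\<Prod>G\<in>T. cvar G) \<in> G_polys" by (rule G_polys_prod) (use T cvar_G_polys in auto)
  show ?case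
  proof (cases "cl (\<Union>T) = B")
    case True
    then have "rk B \<le> rk (\<Union>T) + n" using rk_cl[of "\<Union>T"] by simp
    then have "(\<Prod>G\<in>T. cvar G) * upper_sum B ^ n \<in> ID" using Suc.IH[OF B Suc.prems(2)] T by blast
    then have "upper_sum B * ((\<Prod>G\<in>T. cvar G) * upper_sum B ^ n) \<in> ID" by (rule ID_mult[OF upper_sum_G_polys])
    moreover have "(\<Prod>G\<in>T. cvar G) * upper_sum B ^ Suc n = upper_sum B * ((\<Prod>G\<in>T. cvar G) * upper_sum B ^ n)"
      unfolding power_Suc by (rule mult.left_commute)
    ultimately show ?thesis by (simp only:)
  next
    case False
    then obtain a where a: "a \<in> B" "a \<notin> cl (\<Union>T)" using sub by blast
    have aE: "a \<in> E" using a G_sub[OF B] by blast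
    let ?y = "\<Sum>G\<in>{G \<in> \<G>. a \<in> G}. cvar G" and ?N = "{G \<in> \<G>. a \<in> G \<and> \<not> B \<subseteq> G}"
    have y: "?y = upper_sum B + (\<Sum>G\<in>?N. cvar G)"
      unfolding upper_sum_def by (subst sum.union_disjoint[symmetric]) (use finG a in \<open>auto intro: sum.cong\<close>)
    have N: "(\<Prod>G\<in>T. cvar G) * cvar G * upper_sum B ^ n \<in> ID" if "G \<in> ?N" for G
    proof -
      have G: "G \<in> \<G>" "a \<in> G" "\<not> B \<subseteq> G" using that by auto
      let ?B = "cl (G \<union> B)"
      have GB: "G \<union> B \<subseteq> E" using G_sub G B by blast
      have BG: "?B \<in> \<G>" using G_Un[OF G(1) B] a G by blast
      have GT: "G \<notin> T" using a(2) G(2) cl_ext[OF TE] by blast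
      have sup: "G \<union> B \<subseteq> ?B" using cl_ext[OF GB] .
      have 1: "X \<in> \<G> \<and> X \<subset> ?B" if "X \<in> insert G T" for X
        using that T[of X] G sup by auto
      \<comment> \<open>Submodularity for \<open>\<Union>T \<union> G\<close> and \<open>B\<close>:
        their intersection contains \<open>a\<close> besides \<open>\<Union>T\<close>, so joining
        \<open>G\<close> to \<open>B\<close> gains at least one rank less than adding
        \<open>G\<close> to \<open>T\<close> does. This pays for the lost power.\<close>
      have "rk (\<Union>T) < rk (insert a (\<Union>T))" using rk_insert_notin[OF aE a(2)] by simp
      also have "\<dots> \<le> rk ((\<Union>T \<union> G) \<inter> B)"
        by (rule rk_mono) (use T a G in auto)
      finally have r: "Suc (rk (\<Union>T)) \<le> rk ((\<Union>T \<union> G) \<inter> B)" by simp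
      have "(\<Union>T \<union> G) \<union> B = G \<union> B" using T by blast
      then have "rk (G \<union> B) + rk ((\<Union>T \<union> G) \<inter> B) \<le> rk (\<Union>T \<union> G) + rk B"
        using rk_submod[of "\<Union>T \<union> G" B] by simp
      then have "rk ?B \<le> rk (\<Union>(insert G T)) + n" using r Suc.prems(4) by (simp add: Un_commute)
      then have "(\<Prod>X\<in>insert G T. cvar X) * upper_sum ?B ^ n \<in> ID"
        by (rule Suc.IH[OF BG _ 1, rotated -1]) (use Suc.prems(2) in simp_all)
      then have 2: "(\<Prod>G\<in>T. cvar G) * cvar G * upper_sum ?B ^ n \<in> ID"
        using Suc.prems(2) GT by (simp add: mult.commute mult.left_commute)
      have "cvar G * (upper_sum B ^ n - upper_sum ?B ^ n) \<in> ID"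
        by (rule power_diff_ID[OF upper_sum_shift[OF G(1) B _ G(3)] upper_sum_G_polys upper_sum_G_polys]) (use a G in blast)
      then have "(\<Prod>G\<in>T. cvar G) * (cvar G * (upper_sum B ^ n - upper_sum ?B ^ n)) \<in> ID" by (rule ID_mult[OF TG])
      then have "(\<Prod>G\<in>T. cvar G) * (cvar G * (upper_sum B ^ n - upper_sum ?B ^ n)) + (\<Prod>G\<in>T. cvar G) * cvar G * upper_sum ?B ^ n \<in> ID"
        using 2 by (rule ID_add)
      then show ?thesis by (simp add: algebra_simps)
    qed
    have "(\<Prod>G\<in>T. cvar G) * upper_sum B ^ Suc n =
        ((\<Prod>G\<in>T. cvar G) * upper_sum B ^ n) * ?y - (\<Sum>G\<in>?N. (\<Prod>G\<in>T. cvar G) * cvar G * upper_sum B ^ n)"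
    proof -
      have "(\<Sum>G\<in>?N. (\<Prod>G\<in>T. cvar G) * cvar G * upper_sum B ^ n) = ((\<Prod>G\<in>T. cvar G) * upper_sum B ^ n) * (\<Sum>G\<in>?N. cvar G)"
        unfolding sum_distrib_left by (rule sum.cong) (simp_all add: mult_ac)
      then show ?thesis unfolding y by (simp add: algebra_simps)
    qed
    moreover have "((\<Prod>G\<in>T. cvar G) * upper_sum B ^ n) * ?y \<in> ID"
      by (intro ID_mult G_polys_mult TG G_polys_power upper_sum_G_polys ID_atom[OF aE])
    moreover have "(\<Sum>G\<in>?N. (\<Prod>G\<in>T. cvar G) * cvar G * upper_sum B ^ n) \<in> ID" by (rule ID_sum[OF N])
    ultimately show ?thesis using ID_diff by simp
  qed
qed

lemma upper_sum_rank_part: "upper_sum X \<in> rank_part 1 (rk X)"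
  unfolding upper_sum_def
proof (rule rank_part_sum)
  fix G assume "G \<in> {G \<in> \<G>. X \<subseteq> G}"
  then show "cvar G \<in> rank_part 1 (rk X)" by (intro rank_part_cvar rk_mono) auto
qed

text \<open>The variable \<open>x_X\<close> is the only term of least rank in
  \<open>upper_sum X\<close>, so exchanging the two changes a monomial only by terms of higher total
  rank.\<close>

lemma upper_sum_cvar_rank_part: assumes X: "X \<in> \<G>" shows "upper_sum X - cvar X \<in> rank_part 1 (Suc (rk X))"
proof -
  have "{G \<in> \<G>. X \<subseteq> G} = insert X {G \<in> \<G>. X \<subset> G}" using X by blast
  then have "upper_sum X = cvar X + (\<Sum>G\<in>{G \<in> \<G>. X \<subset> G}. cvar G)" unfolding upper_sum_def using finG by simp
  moreover have "(\<Sum>G\<in>{G \<in> \<G>. X \<subset> G}. cvar G) \<in> rank_part 1 (Suc (rk X))"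
  proof (rule rank_part_sum)
    fix G assume "G \<in> {G \<in> \<G>. X \<subset> G}"
    then have G: "G \<in> \<G>" "X \<subset> G" by auto
    then have "Suc (rk X) \<le> rk G" using rk_flat_mono[OF G_flat[OF X] G_flat[OF G(1)] G(2)] by simp
    then show "cvar G \<in> rank_part 1 (Suc (rk X))" by (rule rank_part_cvar[OF G(1)])
  qed
  ultimately show ?thesis by simp
qed

lemma upper_sum_power_rank_part: assumes X: "X \<in> \<G>" shows "upper_sum X ^ n - cvar X ^ n \<in> rank_part n (Suc (n * rk X))"
proof (induction n)
  case 0 show ?case using cpoly.subspace_0[OF rank_part_subspace] by simp
next
  case (Suc n)
  have eq: "upper_sum X ^ Suc n - cvar X ^ Suc n = upper_sum X * (upper_sum X ^ n - cvar X ^ n) + (upper_sum X - cvar X) * cvar X ^ n"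
    by (simp add: algebra_simps)
  have 1: "upper_sum X * (upper_sum X ^ n - cvar X ^ n) \<in> rank_part (Suc n) (Suc (Suc n * rk X))"
    using rank_part_mult[OF upper_sum_rank_part Suc.IH] by (simp add: add_ac)
  have "cvar X ^ n \<in> rank_part n (n * rk X)" using rank_part_power[OF rank_part_cvar[OF X order_refl], of n] by simp
  then have 2: "(upper_sum X - cvar X) * cvar X ^ n \<in> rank_part (Suc n) (Suc (Suc n * rk X))"
    using rank_part_mult[OF upper_sum_cvar_rank_part[OF X]] by fastforce
  show ?case unfolding eq using cpoly.subspace_add[OF rank_part_subspace 1 2] .
qed

lemma wsum_le: "keys m \<subseteq> \<G> \<Longrightarrow> wsum rk m \<le> mdeg m * rk E"
  unfolding wsum_def mdeg_def sum_distrib_right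
  by (rule sum_mono) (use G_sub rk_mono in auto)

text \<open>At a member \<open>X\<close> violating the bound, the monomial is divisible by
  \<open>x_T x_X^n\<close> with \<open>T\<close> the members below \<open>X\<close> and
  \<open>n\<close> the rank gap. Replacing \<open>x_X^n\<close> by \<open>upper_sum X ^ n\<close>
  gives an element of the ideal by \<open>ID_relation\<close>, at the cost of terms of higher
  rank.\<close>

lemma monomial_reduction:
  assumes m: "keys m \<subseteq> \<G>" "nst (keys m)" and nFY: "\<not> FY m"
  shows "\<exists>r\<in>rank_part (mdeg m) 0 \<inter> ID. cmon m - r \<in> rank_part (mdeg m) (Suc (wsum rk m))"
proof -
  let ?S = "keys m"
  obtain X where X: "X \<in> ?S" "rk X - rk (Jset E indep ?S X) \<le> lookup m X"
    using m(2) nFY unfolding FY_def by (meson not_le_imp_less)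
  define n where "n = rk X - rk (Jset E indep ?S X)"
  define T where "T = {H \<in> ?S. H \<subset> X}"
  have XG: "X \<in> \<G>" using X m by blast
  have fT: "finite T" unfolding T_def by simp
  have J: "rk (Jset E indep ?S X) = rk (\<Union>T)" unfolding Jset_def fjoin_def T_def by simp
  define m' where "m' = m - indicator_mon T - single X n"
  have le: "lookup (indicator_mon T) G + lookup (single X n) G \<le> lookup m G" for G
  proof (cases "G = X")
    case True then show ?thesis using X(2) fT by (simp add: lookup_indicator_mon T_def n_def)
  next
    case False
    then have "G \<in> T \<Longrightarrow> 0 < lookup m G" unfolding T_def by (simp add: in_keys_iff)
    then show ?thesis using False fT by (auto simp: lookup_indicator_mon lookup_single when_def Suc_le_eq)
  qed
  have eq: "m = m' + indicator_mon T + single X n"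
  proof (rule poly_mapping_eqI)
    fix G show "lookup m G = lookup (m' + indicator_mon T + single X n) G"
      using le[of G] unfolding m'_def by (simp add: lookup_add lookup_minus)
  qed
  have km': "keys m' \<subseteq> \<G>"
    using m(1) unfolding m'_def by (auto simp: in_keys_iff lookup_minus)
  have kT: "keys (indicator_mon T) \<subseteq> \<G>" using keys_indicator_mon[OF fT] m(1) unfolding T_def by blast
  define k where "k = m' + indicator_mon T"
  have kk: "keys k \<subseteq> \<G>" unfolding k_def by (rule keys_add_sub[OF km' kT])
  have deg: "mdeg m = mdeg k + n" "wsum rk m = wsum rk k + n * rk X"
    unfolding eq[folded k_def] by (simp_all add: mdeg_wsum wsum_add)
  have cm: "cmon m = cmon k * cvar X ^ n" unfolding eq[folded k_def] cmon_add cvar_power ..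
  have ck: "cmon k = cmon m' * (\<Prod>G\<in>T. cvar G)" unfolding k_def cmon_add prod_cvar[OF fT] ..
  let ?r = "cmon k * upper_sum X ^ n"
  have kw: "cmon k \<in> rank_part (mdeg k) (wsum rk k)" by (rule rank_part_cmon[OF kk]) simp_all
  have "?r \<in> rank_part (mdeg k + n) (wsum rk k + n * rk X)"
    using rank_part_mult[OF kw rank_part_power[OF upper_sum_rank_part[of X], of n]] by simp
  then have 1: "?r \<in> rank_part (mdeg m) 0" using rank_part_mono[of 0] deg by auto
  have "rk X \<le> rk (\<Union>T) + n" using J unfolding n_def by simp
  then have "(\<Prod>G\<in>T. cvar G) * upper_sum X ^ n \<in> ID"
    by (rule ID_relation[OF XG fT, rotated]) (use m(1) T_def in auto)
  then have 2: "?r \<in> ID" unfolding ck mult.assoc by (rule ID_mult[OF cmon_G_polys[OF km']])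
  have "cmon m - ?r = - (cmon k * (upper_sum X ^ n - cvar X ^ n))" unfolding cm by (simp add: algebra_simps)
  moreover have "cmon k * (upper_sum X ^ n - cvar X ^ n) \<in> rank_part (mdeg k + n) (wsum rk k + Suc (n * rk X))"
    by (rule rank_part_mult[OF kw upper_sum_power_rank_part[OF XG]])
  ultimately have "cmon m - ?r \<in> rank_part (mdeg m) (Suc (wsum rk m))"
    using deg cpoly.subspace_neg[OF rank_part_subspace] by simp
  then show ?thesis using 1 2 by blast
qed

text \<open>Induction upwards on the total rank, which in degree \<open>i\<close> is at most
  \<open>i * rk E\<close>.\<close>

lemma spanning: assumes "m \<in> rank_mons i 0"
  shows "cmon m \<in> cpoly.span ((rank_part i 0 \<inter> ID) \<union> cmon ` FYs i)"
  using assms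
proof (induction "i * rk E - wsum rk m" arbitrary: m rule: less_induct)
  case less
  let ?V = "cpoly.span ((rank_part i 0 \<inter> ID) \<union> cmon ` FYs i)"
  have m: "keys m \<subseteq> \<G>" "mdeg m = i" using less.prems unfolding rank_mons_def by auto
  consider "FY m" | "\<not> nst (keys m)" | "\<not> FY m" "nst (keys m)" by blast
  then show ?case
  proof cases
    case 1
    then show ?thesis using m(2) by (intro cpoly.span_base) (auto simp: FYs_def)
  next
    case 2
    let ?S = "keys m"
    have "m = (m - indicator_mon ?S) + indicator_mon ?S"
    proof (rule poly_mapping_eqI)
      fix G show "lookup m G = lookup ((m - indicator_mon ?S) + indicator_mon ?S) G"
        by (simp add: lookup_add lookup_minus lookup_indicator_mon in_keys_iff)
    qed
    then have "cmon m = cmon (m - indicator_mon ?S) * (\<Prod>G\<in>?S. cvar G)"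
      by (metis cmon_add prod_cvar finite_keys)
    moreover have "keys (m - indicator_mon ?S) \<subseteq> \<G>" using m(1) by (auto simp: in_keys_iff lookup_minus)
    ultimately have "cmon m \<in> ID" using ID_mult[OF cmon_G_polys ID_nonnested[OF m(1) 2]] by simp
    moreover have "cmon m \<in> rank_part i 0" by (rule rank_part_cmon[OF m]) simp
    ultimately show ?thesis by (intro cpoly.span_base) blast
  next
    case 3
    then obtain r where r: "r \<in> rank_part i 0 \<inter> ID" "cmon m - r \<in> rank_part i (Suc (wsum rk m))"
      using monomial_reduction[OF m(1) 3(2,1)] m(2) by auto
    have "cmon ` rank_mons i (Suc (wsum rk m)) \<subseteq> ?V"
    proof
      fix p assume "p \<in> cmon ` rank_mons i (Suc (wsum rk m))"
      then obtain m' where m': "m' \<in> rank_mons i (Suc (wsum rk m))" "p = cmon m'" by blast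
      then have "wsum rk m < wsum rk m'" "m' \<in> rank_mons i 0" "wsum rk m' \<le> i * rk E"
        using wsum_le unfolding rank_mons_def by auto
      then show "p \<in> ?V" using less.hyps[of m'] m'(2) by simp
    qed
    then have "rank_part i (Suc (wsum rk m)) \<subseteq> ?V"
      unfolding rank_part_def by (rule cpoly.span_minimal[OF _ cpoly.subspace_span])
    then have "cmon m - r \<in> ?V" using r(2) by blast
    moreover have "r \<in> ?V" using r(1) by (intro cpoly.span_base) blast
    ultimately have "(cmon m - r) + r \<in> ?V" by (rule cpoly.span_add)
    then show ?thesis by simp
  qed
qed

lemma dim_upper: "cpoly.dim (rank_part i 0) \<le> cpoly.dim (rank_part i 0 \<inter> ID) + card (FYs i)"
proof (rule cpoly.dim_le_quotient[OF _ _ _ fin_FYs])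
  show "rank_part i 0 \<subseteq> cpoly.span (cmon ` rank_mons i 0)" unfolding rank_part_def ..
  show "finite (cmon ` rank_mons i 0)" using fin_rank_mons by simp
  show "rank_part i 0 \<subseteq> cpoly.span ((rank_part i 0 \<inter> ID) \<union> cmon ` FYs i)"
    unfolding rank_part_def[of i 0] by (rule cpoly.span_minimal) (use spanning in \<open>auto simp: rank_part_def\<close>)
qed blast

end

section \<open>Functionals that vanish on the Chow ideal\<close>

text \<open>Moebius inversion in the poset \<open>\<F>\<close>: a minimal member \<open>M\<close>
  enters no other upper sum, so it can be set aside and its value chosen last.\<close>

lemma ex_upper_sums:
  fixes h :: "'b set \<Rightarrow> 'c::ab_group_add"
  assumes "finite \<F>"
  shows "\<exists>X. \<forall>A\<in>\<F>. (\<Sum>B\<in>{B \<in> \<F>. A \<subseteq> B}. X B) = h A"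
  using assms
proof (induction "card \<F>" arbitrary: \<F>)
  case 0
  then show ?case by simp
next
  case (Suc n)
  then have "\<F> \<noteq> {}" by auto
  then obtain M where M: "M \<in> \<F>" "\<And>A. A \<in> \<F> \<Longrightarrow> A \<subseteq> M \<Longrightarrow> M = A"
    using finite_has_minimal[OF Suc.prems] by auto
  have "n = card (\<F> - {M})" "finite (\<F> - {M})" using Suc M by auto
  from Suc.hyps(1)[OF this] obtain X where
    X: "\<forall>A\<in>\<F> - {M}. (\<Sum>B\<in>{B \<in> \<F> - {M}. A \<subseteq> B}. X B) = h A" by blast
  define Y where "Y = X(M := h M - (\<Sum>B\<in>{B \<in> \<F>. M \<subset> B}. X B))"
  have "(\<Sum>B\<in>{B \<in> \<F>. A \<subseteq> B}. Y B) = h A" if A: "A \<in> \<F>" for A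
  proof (cases "A = M")
    case True
    have "{B \<in> \<F>. A \<subseteq> B} = insert M {B \<in> \<F>. M \<subset> B}" using True M(1) by blast
    then have "(\<Sum>B\<in>{B \<in> \<F>. A \<subseteq> B}. Y B) = Y M + (\<Sum>B\<in>{B \<in> \<F>. M \<subset> B}. Y B)" using Suc.prems by simp
    also have "(\<Sum>B\<in>{B \<in> \<F>. M \<subset> B}. Y B) = (\<Sum>B\<in>{B \<in> \<F>. M \<subset> B}. X B)"
      by (rule sum.cong) (auto simp: Y_def)
    finally show ?thesis using True by (simp add: Y_def)
  next
    case False
    have "\<not> A \<subseteq> M" using M(2)[OF A] False by auto
    then have "{B \<in> \<F>. A \<subseteq> B} = {B \<in> \<F> - {M}. A \<subseteq> B}" by blast
    moreover have "(\<Sum>B\<in>{B \<in> \<F> - {M}. A \<subseteq> B}. Y B) = (\<Sum>B\<in>{B \<in> \<F> - {M}. A \<subseteq> B}. X B)"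
      by (rule sum.cong) (auto simp: Y_def)
    ultimately show ?thesis using X A False by simp
  qed
  then show ?case by blast
qed

definition unit_mon :: "'a set \<Rightarrow> ('a set \<Rightarrow>\<^sub>0 nat)" where "unit_mon A = single A 1"

lemma lookup_unit_mon: "lookup (unit_mon A) H = (if A = H then 1 else 0)"
  unfolding unit_mon_def by (simp add: lookup_single when_def)

lemma cvar_unit_mon: "cvar A = cmon (unit_mon A)" unfolding unit_mon_def by (rule cvar_cmon)

context building_set_matroid
begin

definition nonempty_flats :: "'a set set" where "nonempty_flats = {F. flt F \<and> F \<noteq> {}}"

lemma fin_nonempty_flats: "finite nonempty_flats" unfolding nonempty_flats_def by (rule finite_subset[OF _ fin_flats]) auto

text \<open>The functionals below are prescribed on monomials in the upper sums, so these serve as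
  the coordinates \<open>cvar A\<close>, and the actual variables are recovered by Moebius
  inversion.\<close>

definition flat_var :: "'a set \<Rightarrow> 'a cpoly" where
  "flat_var = (SOME X. \<forall>A\<in>nonempty_flats. (\<Sum>B\<in>{B \<in> nonempty_flats. A \<subseteq> B}. X B) = cvar A)"

lemma flat_var_sum: "A \<in> nonempty_flats \<Longrightarrow> (\<Sum>B\<in>{B \<in> nonempty_flats. A \<subseteq> B}. flat_var B) = cvar A"
  using someI_ex[OF ex_upper_sums[OF fin_nonempty_flats, of "cvar :: 'a set \<Rightarrow> 'a cpoly"]] unfolding flat_var_def by blast

text \<open>The image of \<open>x\<^sub>G\<close> in the Chow ring of the maximal building set, where \<open>flat_var\<close> are the
  variables and \<open>cvar A\<close> now stands for the sum of the variables above \<open>A\<close>.\<close>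

definition gen_var :: "'a set \<Rightarrow> 'a cpoly" where
  "gen_var G = (\<Sum>F\<in>{F \<in> nonempty_flats. G \<in> factors F}. flat_var F)"

text \<open>A flat \<open>F\<close> containing \<open>B\<close> has exactly one factor containing
  \<open>B\<close>, so each \<open>flat_var F\<close> is counted once.\<close>

lemma gen_var_sum: assumes B: "B \<in> \<G>" shows "(\<Sum>G\<in>{G \<in> \<G>. B \<subseteq> G}. gen_var G) = cvar B"
proof -
  have "(\<Sum>G\<in>{G \<in> \<G>. B \<subseteq> G}. gen_var G) =
      (\<Sum>F\<in>nonempty_flats. \<Sum>G\<in>{G \<in> \<G>. B \<subseteq> G}. if G \<in> factors F then flat_var F else 0)"
    unfolding gen_var_def sum.inter_filter[OF fin_nonempty_flats] by (rule sum.swap)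
  also have "\<dots> = (\<Sum>F\<in>nonempty_flats. if B \<subseteq> F then flat_var F else 0)"
  proof (rule sum.cong[OF refl])
    fix F assume "F \<in> nonempty_flats"
    then have F: "flt F" unfolding nonempty_flats_def by simp
    have "(\<Sum>G\<in>{G \<in> \<G>. B \<subseteq> G}. if G \<in> factors F then flat_var F else 0) =
        (\<Sum>G\<in>{G \<in> {G \<in> \<G>. B \<subseteq> G}. G \<in> factors F}. flat_var F)"
      by (rule sum.inter_filter[symmetric]) (use finG in simp)
    also have "\<dots> = (if B \<subseteq> F then flat_var F else 0)"
    proof (cases "B \<subseteq> F")
      case True
      then obtain K where K: "K \<in> factors F" "B \<subseteq> K" using ex_factor[OF B] by blast
      have "{G \<in> {G \<in> \<G>. B \<subseteq> G}. G \<in> factors F} = {K}"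
        using K factors_G[OF K(1)] factors_disjoint[OF F K(1)] G_ne[OF B] by blast
      then show ?thesis using True by simp
    next
      case False
      then have "{G \<in> {G \<in> \<G>. B \<subseteq> G}. G \<in> factors F} = {}" using factors_sub by blast
      then show ?thesis using False by (simp only: sum.empty if_False)
    qed
    finally show "(\<Sum>G\<in>{G \<in> \<G>. B \<subseteq> G}. if G \<in> factors F then flat_var F else 0) =
      (if B \<subseteq> F then flat_var F else 0)" .
  qed
  also have "\<dots> = (\<Sum>F\<in>{F \<in> nonempty_flats. B \<subseteq> F}. flat_var F)" by (rule sum.inter_filter[OF fin_nonempty_flats, symmetric])
  also have "\<dots> = cvar B" by (rule flat_var_sum) (use B G_flat G_ne in \<open>simp add: nonempty_flats_def\<close>)
  finally show ?thesis .
qed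

text \<open>In an antichain choose \<open>G\<close> with \<open>f G\<close> largest. A join in
  \<open>\<G>\<close> lies in \<open>f G\<close> and meets its factor \<open>G\<close>, hence lies
  in \<open>G\<close>, so every other member would be below \<open>G\<close>.\<close>

lemma nst_of_chain:
  assumes T: "T \<subseteq> \<G>" and f: "\<And>G. G \<in> T \<Longrightarrow> flt (f G) \<and> G \<in> factors (f G)"
    and ch: "\<And>G H. G \<in> T \<Longrightarrow> H \<in> T \<Longrightarrow> f G \<subseteq> f H \<or> f H \<subseteq> f G"
  shows "nst T"
proof (rule nstI[OF T])
  fix B assume B: "B \<subseteq> T" "antichain_sets B" "2 \<le> card B"
  show "cl (\<Union>B) \<notin> \<G>"
  proof
    assume J: "cl (\<Union>B) \<in> \<G>"
    have fB: "finite (f ` B)" using B(3) card_ge_0_finite[of B] by simp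
    have "f ` B \<noteq> {}" using B(3) by auto
    then obtain M where M: "M \<in> f ` B" "\<And>A. A \<in> f ` B \<Longrightarrow> M \<subseteq> A \<Longrightarrow> M = A"
      using finite_has_maximal[OF fB] by auto
    then obtain G where G: "G \<in> B" "M = f G" by blast
    have top: "f H \<subseteq> f G" if "H \<in> B" for H
      using ch[of H G] M(2)[of "f H"] that G B(1) by auto
    have GT: "flt (f G)" "G \<in> factors (f G)" using f G B by auto
    have sub: "H \<subseteq> f G" if "H \<in> B" for H
      using factors_sub[of H "f H"] f[of H] top[OF that] that B(1) by auto
    have "cl (\<Union>B) \<subseteq> f G" by (rule cl_least[OF _ GT(1)]) (use sub in blast)
    moreover have BE: "\<Union>B \<subseteq> E" using B(1) T G_sub by blast
    moreover have "G \<subseteq> cl (\<Union>B)" using cl_ext[OF BE] G(1) by blast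
    then have "cl (\<Union>B) \<inter> G \<noteq> {}" using factors_ne[OF GT(2)] by blast
    ultimately have "cl (\<Union>B) \<subseteq> G" using G_in_one_factor[OF GT J] by blast
    then have "\<And>H. H \<in> B \<Longrightarrow> H \<subseteq> G" using cl_ext[OF BE] by blast
    then have "B \<subseteq> {G}" using B(2) G(1) unfolding antichain_sets_def by blast
    then show False using B(3) card_mono[of "{G}" B] by simp
  qed
qed

end

section \<open>Hall-Rado indicator functions on a chain of flats\<close>

locale flat_chain = building_set_matroid +
  fixes F :: "nat \<Rightarrow> 'a set" and N :: nat and d :: "nat \<Rightarrow> nat"
  assumes Ff: "flt (F i)" and F_mono: "i \<le> j \<Longrightarrow> F i \<subseteq> F j" and F0: "F 0 = {}" and FN: "F N = E"
begin

text \<open>A nonempty flat lies in one layer only, the step of the chain that first contains it;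
  there only its join with \<open>F i\<close> matters.\<close>

definition layer :: "nat \<Rightarrow> 'a set set" where "layer i = {H. flt H \<and> H \<subseteq> F (Suc i) \<and> \<not> H \<subseteq> F i}"

definition mass_on :: "('a set \<Rightarrow>\<^sub>0 nat) \<Rightarrow> 'a set set \<Rightarrow> nat" where
  "mass_on m I = (\<Sum>H\<in>I. lookup m H)"

text \<open>The dragon Hall-Rado condition in the interval from \<open>F i\<close> to \<open>F (Suc i)\<close>; a set \<open>I\<close> of flats
  is counted with all its multiplicities in \<open>m\<close>, the most restrictive case.\<close>

definition hall_rado :: "nat \<Rightarrow> ('a set \<Rightarrow>\<^sub>0 nat) \<Rightarrow> bool" where
  "hall_rado i m \<longleftrightarrow> mass_on m (layer i) = d i \<and>
    (\<forall>I\<subseteq>layer i. I \<noteq> {} \<longrightarrow> rk (F i) + 1 + mass_on m I \<le> rk (F i \<union> \<Union>I))"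

definition hall_rado_all :: "('a set \<Rightarrow>\<^sub>0 nat) \<Rightarrow> bool" where "hall_rado_all m \<longleftrightarrow> (\<forall>i<N. hall_rado i m)"

lemma fin_layer: "finite (layer i)" unfolding layer_def by (rule finite_subset[OF _ fin_flats]) auto

lemma mass_on_single: "finite I \<Longrightarrow> mass_on (unit_mon A + m) I = (if A \<in> I then 1 else 0) + mass_on m I"
proof -
  assume I: "finite I"
  have "mass_on (unit_mon A + m) I = (\<Sum>H\<in>I. if A = H then 1 else 0) + mass_on m I"
    unfolding mass_on_def lookup_add sum.distrib by (simp add: lookup_unit_mon)
  then show ?thesis using I by simp
qed

lemma mass_on_mono: "finite J \<Longrightarrow> I \<subseteq> J \<Longrightarrow> mass_on m I \<le> mass_on m J"
  unfolding mass_on_def by (rule sum_mono2) auto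

lemma layer_fin: "I \<subseteq> layer i \<Longrightarrow> finite I" using fin_layer finite_subset by blast

lemma layer_disjoint: assumes "A \<in> layer i" "A \<in> layer j" shows "i = j"
proof -
  have no: "\<not> i < j" if "A \<in> layer i" "A \<in> layer j" for i j
  proof
    assume "i < j"
    then have "F (Suc i) \<subseteq> F j" by (intro F_mono) simp
    then show False using that unfolding layer_def by blast
  qed
  then show ?thesis using no[OF assms] no[OF assms(2,1)] by simp
qed

lemma layer_exists: assumes "A \<in> nonempty_flats" shows "\<exists>i<N. A \<in> layer i"
proof -
  have A: "flt A" "A \<noteq> {}" "A \<subseteq> F N" using assms flat_sub FN unfolding nonempty_flats_def by auto
  define j where "j = (LEAST j. A \<subseteq> F j)"
  have j: "A \<subseteq> F j" "j \<le> N" unfolding j_def using LeastI[of "\<lambda>j. A \<subseteq> F j" N] Least_le[of "\<lambda>j. A \<subseteq> F j" N] A(3) by blast+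
  have "j \<noteq> 0" using j A(2) F0 by auto
  then obtain i where i: "j = Suc i" using not0_implies_Suc by blast
  have "\<not> A \<subseteq> F i" using not_less_Least[of i "\<lambda>j. A \<subseteq> F j"] i unfolding j_def by simp
  then have "A \<in> layer i" using A j i unfolding layer_def by simp
  then show ?thesis using i j(2) by (intro exI[of _ i]) simp
qed

lemma hall_rado_other: assumes "A \<in> layer p" "i \<noteq> p" shows "hall_rado i (unit_mon A + m) \<longleftrightarrow> hall_rado i m"
proof -
  have "mass_on (unit_mon A + m) I = mass_on m I" if "I \<subseteq> layer i" for I
    using mass_on_single[OF layer_fin[OF that], of A m] layer_disjoint[OF assms(1), of i] assms(2) that by auto
  then show ?thesis unfolding hall_rado_def by simp
qed

text \<open>Adding \<open>B\<close> to a set \<open>I\<close> that contains \<open>C\<close> does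
  not raise the rank over \<open>F j\<close>, so the condition for \<open>insert B I\<close> yields
  the one for \<open>I\<close>.\<close>

lemma hall_rado_swap:
  assumes B: "B \<in> layer j" and C: "C \<in> layer j" and sub: "B \<subseteq> cl (F j \<union> C)"
    and h: "hall_rado j (unit_mon B + m)"
  shows "hall_rado j (unit_mon C + m)"
  unfolding hall_rado_def
proof (intro conjI allI impI)
  show "mass_on (unit_mon C + m) (layer j) = d j"
    using h B C unfolding hall_rado_def by (simp add: mass_on_single fin_layer)
  fix I assume I: "I \<subseteq> layer j" "I \<noteq> {}"
  have fI: "finite I" using layer_fin[OF I(1)] .
  show "rk (F j) + 1 + mass_on (unit_mon C + m) I \<le> rk (F j \<union> \<Union>I)"
  proof (cases "C \<in> I")
    case True
    have IE: "F j \<union> \<Union>I \<subseteq> E" using I(1) Ff flat_sub unfolding layer_def by blast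
    have "insert B I \<subseteq> layer j" "insert B I \<noteq> {}" using B I by auto
    then have "rk (F j) + 1 + mass_on (unit_mon B + m) (insert B I) \<le> rk (F j \<union> \<Union>(insert B I))"
      using h unfolding hall_rado_def by blast
    moreover have "mass_on m I \<le> mass_on m (insert B I)" by (rule mass_on_mono) (use fI in auto)
    moreover have "rk (F j \<union> \<Union>(insert B I)) \<le> rk (F j \<union> \<Union>I)"
    proof -
      have "cl (F j \<union> C) \<subseteq> cl (F j \<union> \<Union>I)" by (rule cl_mono) (use True in blast)
      then have "F j \<union> \<Union>(insert B I) \<subseteq> cl (F j \<union> \<Union>I)" using sub cl_ext[OF IE] by blast
      then have "rk (F j \<union> \<Union>(insert B I)) \<le> rk (cl (F j \<union> \<Union>I))" by (rule rk_mono)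
      then show ?thesis by simp
    qed
    ultimately show ?thesis using True fI by (simp add: mass_on_single)
  next
    case False
    have "rk (F j) + 1 + mass_on (unit_mon B + m) I \<le> rk (F j \<union> \<Union>I)"
      using h I unfolding hall_rado_def by blast
    then show ?thesis using False fI by (simp add: mass_on_single)
  qed
qed

lemma hall_rado_all_swap:
  assumes "B \<in> layer j" "C \<in> layer j" "B \<subseteq> cl (F j \<union> C)" "C \<subseteq> cl (F j \<union> B)"
  shows "hall_rado_all (unit_mon B + m) \<longleftrightarrow> hall_rado_all (unit_mon C + m)"
proof -
  have "hall_rado i (unit_mon B + m) \<longleftrightarrow> hall_rado i (unit_mon C + m)" for i
    using hall_rado_swap[of B j C m] hall_rado_swap[of C j B m] hall_rado_other[of B j i m] hall_rado_other[of C j i m] assms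
    by (cases "i = j") auto
  then show ?thesis unfolding hall_rado_all_def by simp
qed

definition base_cond :: "nat \<Rightarrow> ('a set \<Rightarrow>\<^sub>0 nat) \<Rightarrow> bool" where
  "base_cond p m \<longleftrightarrow> (\<forall>I\<subseteq>layer p. I \<noteq> {} \<longrightarrow> rk (F p) + 1 + mass_on m I \<le> rk (F p \<union> \<Union>I))"

text \<open>The constant \<open>k\<close> is one more than the number of flats that \<open>X\<close>
  stands for: 2 for a single flat, 3 for a union of two.\<close>

definition add_cond :: "nat \<Rightarrow> nat \<Rightarrow> 'a set \<Rightarrow> ('a set \<Rightarrow>\<^sub>0 nat) \<Rightarrow> bool" where
  "add_cond k p X m \<longleftrightarrow> (\<forall>I\<subseteq>layer p. rk (F p) + k + mass_on m I \<le> rk (F p \<union> \<Union>I \<union> X))"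

text \<open>The conditions on \<open>I\<close> are sorted by which of \<open>X\<close> and
  \<open>Y\<close> occur in \<open>I\<close>. This separates what depends on \<open>X\<close> alone
  and on \<open>Y\<close> alone from what depends on both together or on neither.\<close>

lemma hall_rado_two:
  assumes X: "X \<in> layer p" and Y: "Y \<in> layer p"
  shows "hall_rado p (unit_mon X + (unit_mon Y + m)) \<longleftrightarrow>
    mass_on m (layer p) + 2 = d p \<and> base_cond p m \<and> add_cond 2 p X m \<and> add_cond 2 p Y m \<and> add_cond 3 p (X \<union> Y) m"
    (is "hall_rado p ?m \<longleftrightarrow> ?R")
proof -
  have ms: "mass_on ?m I = (if X \<in> I then 1 else 0) + ((if Y \<in> I then 1 else 0) + mass_on m I)" if "I \<subseteq> layer p" for I
    using mass_on_single[OF layer_fin[OF that]] by simp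
  have cnt: "mass_on ?m (layer p) = mass_on m (layer p) + 2" using ms[OF order_refl] X Y by simp
  have mono: "mass_on m I \<le> mass_on m J" if "J \<subseteq> layer p" "I \<subseteq> J" for I J using mass_on_mono[OF layer_fin[OF that(1)] that(2)] .
  show ?thesis
  proof
    assume h: "hall_rado p ?m"
    have D: "rk (F p) + 1 + mass_on ?m I \<le> rk (F p \<union> \<Union>I)" if "I \<subseteq> layer p" "I \<noteq> {}" for I
      using h that unfolding hall_rado_def by blast
    have b: "base_cond p m" unfolding base_cond_def
    proof (intro allI impI)
      fix I assume I: "I \<subseteq> layer p" "I \<noteq> {}"
      show "rk (F p) + 1 + mass_on m I \<le> rk (F p \<union> \<Union>I)" using D[OF I] ms[OF I(1)] by linarith
    qed
    have s: "add_cond 2 p Z m" if Z: "Z \<in> {X, Y}" for Z unfolding add_cond_def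
    proof (intro allI impI)
      fix I assume I: "I \<subseteq> layer p"
      have ZI: "insert Z I \<subseteq> layer p" "insert Z I \<noteq> {}" using I X Y Z by auto
      have "F p \<union> \<Union>(insert Z I) = F p \<union> \<Union>I \<union> Z" by blast
      moreover have "1 + mass_on m I \<le> mass_on ?m (insert Z I)"
        using ms[OF ZI(1)] mono[OF ZI(1) subset_insertI] Z by auto
      ultimately show "rk (F p) + 2 + mass_on m I \<le> rk (F p \<union> \<Union>I \<union> Z)" using D[OF ZI] by simp
    qed
    have P: "add_cond 3 p (X \<union> Y) m" unfolding add_cond_def
    proof (intro allI impI)
      fix I assume I: "I \<subseteq> layer p"
      have ZI: "insert X (insert Y I) \<subseteq> layer p" "insert X (insert Y I) \<noteq> {}" using I X Y by auto
      have "F p \<union> \<Union>(insert X (insert Y I)) = F p \<union> \<Union>I \<union> (X \<union> Y)" by blast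
      moreover have "2 + mass_on m I \<le> mass_on ?m (insert X (insert Y I))"
        using ms[OF ZI(1)] mono[OF ZI(1), of I] by (simp add: subset_insertI2 subset_insertI)
      ultimately show "rk (F p) + 3 + mass_on m I \<le> rk (F p \<union> \<Union>I \<union> (X \<union> Y))" using D[OF ZI] by simp
    qed
    show ?R using h cnt b s P unfolding hall_rado_def by simp
  next
    assume R: ?R
    show "hall_rado p ?m" unfolding hall_rado_def
    proof (intro conjI allI impI)
      show "mass_on ?m (layer p) = d p" using cnt R by simp
      fix I assume I: "I \<subseteq> layer p" "I \<noteq> {}"
      have s: "rk (F p) + 2 + mass_on m I \<le> rk (F p \<union> \<Union>I)" if "Z \<in> {X, Y}" "Z \<in> I" for Z
      proof -
        have "F p \<union> \<Union>I \<union> Z = F p \<union> \<Union>I" using that(2) by blast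
        then show ?thesis using R that(1) I(1) unfolding add_cond_def by auto
      qed
      have P: "rk (F p) + 3 + mass_on m I \<le> rk (F p \<union> \<Union>I)" if "X \<in> I" "Y \<in> I"
      proof -
        have "F p \<union> \<Union>I \<union> (X \<union> Y) = F p \<union> \<Union>I" using that by blast
        then show ?thesis using R I(1) unfolding add_cond_def by metis
      qed
      have b: "rk (F p) + 1 + mass_on m I \<le> rk (F p \<union> \<Union>I)" using R I unfolding base_cond_def by blast
      show "rk (F p) + 1 + mass_on ?m I \<le> rk (F p \<union> \<Union>I)"
        using ms[OF I(1)] s[of X] s[of Y] P b by (cases "X \<in> I"; cases "Y \<in> I") auto
    qed
  qed
qed

lemma add_cond_cl: assumes "X \<subseteq> E" "Y \<subseteq> E" "cl X = cl Y" shows "add_cond k p X m \<longleftrightarrow> add_cond k p Y m"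
proof -
  have "rk (F p \<union> \<Union>I \<union> X) = rk (F p \<union> \<Union>I \<union> Y)" if "I \<subseteq> layer p" for I
  proof -
    have IE: "F p \<union> \<Union>I \<subseteq> E" using that Ff flat_sub unfolding layer_def by blast
    have "rk (X \<union> (F p \<union> \<Union>I)) = rk (Y \<union> (F p \<union> \<Union>I))"
      using rk_Un_cl[OF assms(1) IE] rk_Un_cl[OF assms(2) IE] assms(3) by simp
    then show ?thesis by (simp add: Un_commute)
  qed
  then show ?thesis unfolding add_cond_def by simp
qed

text \<open>Failing witnesses \<open>I\<close> for \<open>A\<close> and \<open>J\<close> for
  \<open>B\<close> contradict submodularity, given the condition on \<open>A \<union> B\<close> for
  \<open>I \<union> J\<close> and the base condition for \<open>I \<inter> J\<close>.\<close>

lemma add_cond_or: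
  assumes b: "base_cond p m" and P: "add_cond 3 p (A \<union> B) m"
  shows "add_cond 2 p A m \<or> add_cond 2 p B m"
proof (rule ccontr)
  assume "\<not> ?thesis"
  then obtain I J where I: "I \<subseteq> layer p" "rk (F p \<union> \<Union>I \<union> A) < rk (F p) + 2 + mass_on m I"
    and J: "J \<subseteq> layer p" "rk (F p \<union> \<Union>J \<union> B) < rk (F p) + 2 + mass_on m J"
    unfolding add_cond_def by (meson not_le_imp_less)
  have "(F p \<union> \<Union>I \<union> A) \<union> (F p \<union> \<Union>J \<union> B) = F p \<union> \<Union>(I \<union> J) \<union> (A \<union> B)" by blast
  then have 1: "rk (F p) + 3 + mass_on m (I \<union> J) \<le> rk ((F p \<union> \<Union>I \<union> A) \<union> (F p \<union> \<Union>J \<union> B))"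
    using P I(1) J(1) unfolding add_cond_def by (metis Un_least)
  have "rk (F p) + mass_on m (I \<inter> J) \<le> rk (F p \<union> \<Union>(I \<inter> J))"
  proof (cases "I \<inter> J = {}")
    case False
    have "I \<inter> J \<subseteq> layer p" using I by blast
    then have "rk (F p) + 1 + mass_on m (I \<inter> J) \<le> rk (F p \<union> \<Union>(I \<inter> J))"
      using b False unfolding base_cond_def by blast
    then show ?thesis by simp
  qed (simp add: mass_on_def)
  also have "\<dots> \<le> rk ((F p \<union> \<Union>I \<union> A) \<inter> (F p \<union> \<Union>J \<union> B))" by (rule rk_mono) blast
  finally have 2: "rk (F p) + mass_on m (I \<inter> J) \<le> rk ((F p \<union> \<Union>I \<union> A) \<inter> (F p \<union> \<Union>J \<union> B))" .
  have "mass_on m (I \<union> J) + mass_on m (I \<inter> J) = mass_on m I + mass_on m J"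
    unfolding mass_on_def by (rule sum.union_inter) (use I J layer_fin in auto)
  then show False using 1 2 I(2) J(2) rk_submod[of "F p \<union> \<Union>I \<union> A" "F p \<union> \<Union>J \<union> B"] by linarith
qed

definition dval :: "('a set \<Rightarrow>\<^sub>0 nat) \<Rightarrow> 'a cpoly" where "dval m = (if hall_rado_all m then 1 else 0)"

text \<open>A flat of an earlier layer is contained in \<open>F j\<close>, so \<open>B\<close> and
  its join with \<open>A\<close> have the same join with \<open>F j\<close>.\<close>

lemma dval_join:
  assumes A: "A \<in> layer i" and B: "B \<in> layer j" and ij: "i < j"
  shows "dval (unit_mon B + n) = dval (unit_mon (cl (A \<union> B)) + n)"
proof -
  let ?C = "cl (A \<union> B)"
  have AF: "A \<subseteq> F j" using A F_mono[of "Suc i" j] ij unfolding layer_def by auto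
  have BF: "B \<subseteq> F (Suc j)" "\<not> B \<subseteq> F j" and AB: "A \<union> B \<subseteq> E"
    using A B flat_sub unfolding layer_def by auto
  have sub: "A \<union> B \<subseteq> ?C" using cl_ext[OF AB] .
  have "?C \<subseteq> F (Suc j)" by (rule cl_least[OF _ Ff]) (use AF BF F_mono[of j "Suc j"] in auto)
  then have C: "?C \<in> layer j" using sub BF(2) unfolding layer_def by auto
  have "F j \<union> ?C \<subseteq> E" using Ff flat_sub cl_sub by auto
  from cl_ext[OF this] have s1: "B \<subseteq> cl (F j \<union> ?C)" using sub by auto
  have s2: "?C \<subseteq> cl (F j \<union> B)" by (rule cl_mono) (use AF in blast)
  show ?thesis unfolding dval_def hall_rado_all_swap[OF B C s1 s2] ..
qed

text \<open>This is (h_A - h_C)(h_B - h_C) = 0, evaluated on multiples of a monomial. In different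
  layers the terms cancel in pairs by \<open>dval_join\<close>. In one layer the four terms share
  the condition on \<open>A \<union> B\<close>, which implies the one on \<open>C\<close> alone.
  With \<open>a\<close> and \<open>b\<close> the truth values of the conditions on \<open>A\<close>
  and \<open>B\<close> alone, there remains ab + 1 = a + b, valid because \<open>add_cond_or\<close>
  makes one of them hold.\<close>

lemma quadratic_relation:
  assumes A: "A \<in> nonempty_flats" and B: "B \<in> nonempty_flats"
  defines "C \<equiv> cl (A \<union> B)"
  defines "e \<equiv> unit_mon"
  shows "dval (e A + (e B + m)) + dval (e C + (e C + m)) = dval (e A + (e C + m)) + dval (e C + (e B + m))"
proof -
  have Af: "flt A" "flt B" using A B unfolding nonempty_flats_def by auto
  have AE: "A \<subseteq> E" "B \<subseteq> E" using Af flat_sub by auto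
  have Cf: "flt C" and AC: "A \<subseteq> C" "B \<subseteq> C" using cl_ext[of "A \<union> B"] AE unfolding C_def by auto
  have CF: "C \<subseteq> F k" if "A \<subseteq> F k" "B \<subseteq> F k" for k unfolding C_def using that Ff by (intro cl_least) auto
  obtain i where i: "i < N" "A \<in> layer i" using layer_exists[OF A] by blast
  obtain j where j: "j < N" "B \<in> layer j" using layer_exists[OF B] by blast
  have ij: "A \<subseteq> F (Suc i)" "\<not> A \<subseteq> F i" "B \<subseteq> F (Suc j)" "\<not> B \<subseteq> F j" using i j unfolding layer_def by auto
  consider "i < j" | "j < i" | "i = j" by linarith
  then show ?thesis
  proof cases
    case 1
    have sw: "dval (e B + n) = dval (e C + n)" for n
      unfolding e_def C_def by (rule dval_join[OF i(2) j(2) 1])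
    have "dval (e A + (e B + m)) = dval (e A + (e C + m))"
      using sw[of "e A + m"] by (simp add: add.left_commute)
    moreover have "dval (e C + (e B + m)) = dval (e C + (e C + m))"
      using sw[of "e C + m"] by (simp add: add.left_commute)
    ultimately show ?thesis by simp
  next
    case 2
    have sw: "dval (e A + n) = dval (e C + n)" for n
      using dval_join[OF j(2) i(2) 2] unfolding e_def C_def by (simp add: Un_commute)
    show ?thesis unfolding sw by simp
  next
    case 3
    let ?p = i
    have Ai: "A \<in> layer ?p" "B \<in> layer ?p" using i j 3 by auto
    then have Ci: "C \<in> layer ?p" using CF[of "Suc i"] AC Cf unfolding layer_def by auto
    have rest: "hall_rado k (e X + (e Y + m)) \<longleftrightarrow> hall_rado k m" if "X \<in> layer ?p" "Y \<in> layer ?p" "k \<noteq> ?p" for X Y k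
      unfolding e_def using hall_rado_other[OF that(1,3)] hall_rado_other[OF that(2,3)] by simp
    have all: "hall_rado_all (e X + (e Y + m)) \<longleftrightarrow> hall_rado ?p (e X + (e Y + m)) \<and> (\<forall>k<N. k \<noteq> ?p \<longrightarrow> hall_rado k m)"
      if "X \<in> layer ?p" "Y \<in> layer ?p" for X Y
      unfolding hall_rado_all_def using rest[OF that] i(1) by metis
    have cls: "add_cond 3 ?p (A \<union> C) m \<longleftrightarrow> add_cond 3 ?p (A \<union> B) m" "add_cond 3 ?p (C \<union> B) m \<longleftrightarrow> add_cond 3 ?p (A \<union> B) m"
      "add_cond 3 ?p (C \<union> C) m \<longleftrightarrow> add_cond 3 ?p (A \<union> B) m"
    proof -
      have *: "add_cond 3 ?p C m \<longleftrightarrow> add_cond 3 ?p (A \<union> B) m"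
        by (rule add_cond_cl) (use flat_sub[OF Cf] AE in \<open>auto simp: C_def\<close>)
      have "A \<union> C = C" "C \<union> B = C" "C \<union> C = C" using AC by auto
      then show "add_cond 3 ?p (A \<union> C) m \<longleftrightarrow> add_cond 3 ?p (A \<union> B) m" "add_cond 3 ?p (C \<union> B) m \<longleftrightarrow> add_cond 3 ?p (A \<union> B) m"
        "add_cond 3 ?p (C \<union> C) m \<longleftrightarrow> add_cond 3 ?p (A \<union> B) m" using * by simp_all
    qed
    have sC: "add_cond 2 ?p C m" if "add_cond 3 ?p (A \<union> B) m"
    proof -
      have "add_cond 3 ?p C m" using that cls(3) by simp
      then show ?thesis unfolding add_cond_def by (metis add_leE add_Suc_right add_Suc Suc_leD numeral_3_eq_3 numeral_2_eq_2)
    qed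
    have or: "add_cond 2 ?p A m \<or> add_cond 2 ?p B m" if "base_cond ?p m" "add_cond 3 ?p (A \<union> B) m"
      using add_cond_or[OF that] .
    show ?thesis
      unfolding dval_def all[OF Ai] all[OF Ci Ci] all[OF Ai(1) Ci] all[OF Ci Ai(2)]
      unfolding e_def hall_rado_two[OF Ai] hall_rado_two[OF Ci Ci] hall_rado_two[OF Ai(1) Ci] hall_rado_two[OF Ci Ai(2)] cls
      using sC or
      by (cases "add_cond 3 ?p (A \<union> B) m"; cases "base_cond ?p m"; cases "add_cond 2 ?p A m"; cases "add_cond 2 ?p B m")
         simp_all
  qed
qed

definition dfun :: "'a cpoly \<Rightarrow> 'a cpoly" where "dfun = lin_ext dval"

lemma dfun_mult_eq_0: assumes "\<And>m. dfun (p * cmon m) = 0" shows "dfun (p * q) = 0"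
  by (induction q rule: cpoly_linear_induct)
     (simp_all add: assms dfun_def distrib_left lin_ext_add mult_cscale lin_ext_cscale, simp add: dfun_def[symmetric] assms)

lemma dfun_quadratic:
  assumes A: "A \<in> nonempty_flats" and B: "B \<in> nonempty_flats"
  shows "dfun ((cvar A - cvar (cl (A \<union> B))) * (cvar B - cvar (cl (A \<union> B))) * q) = 0"
proof (rule dfun_mult_eq_0)
  fix m
  let ?C = "cl (A \<union> B)"
  let ?e = unit_mon
  have "(cvar A - cvar ?C) * (cvar B - cvar ?C) * cmon m =
      cvar A * (cvar B * cmon m) + cvar ?C * (cvar ?C * cmon m) - (cvar A * (cvar ?C * cmon m) + cvar ?C * (cvar B * cmon m))"
    by (simp add: algebra_simps)
  also have "\<dots> = cmon (?e A + (?e B + m)) + cmon (?e ?C + (?e ?C + m)) -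
      (cmon (?e A + (?e ?C + m)) + cmon (?e ?C + (?e B + m)))"
    by (simp only: cmon_add cvar_unit_mon)
  finally show "dfun ((cvar A - cvar ?C) * (cvar B - cvar ?C) * cmon m) = 0"
    unfolding dfun_def by (simp only: lin_ext_minus lin_ext_add lin_ext_cmon quadratic_relation[OF A B] diff_self)
qed

text \<open>The set \<open>I = {A}\<close> violates the condition: it would have to raise the rank
  by 2.\<close>

lemma dfun_atom: assumes A: "A \<in> nonempty_flats" "rk A = 1" shows "dfun (cvar A * q) = 0"
proof (rule dfun_mult_eq_0)
  fix m
  obtain i where i: "i < N" "A \<in> layer i" using layer_exists[OF A(1)] by blast
  have "\<not> hall_rado i (unit_mon A + m)"
  proof
    assume "hall_rado i (unit_mon A + m)"
    then have "\<forall>I\<subseteq>layer i. I \<noteq> {} \<longrightarrow> rk (F i) + 1 + mass_on (unit_mon A + m) I \<le> rk (F i \<union> \<Union>I)"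
      unfolding hall_rado_def by blast
    from this[rule_format, of "{A}"] have "rk (F i) + 1 + mass_on (unit_mon A + m) {A} \<le> rk (F i \<union> A)"
      using i(2) by simp
    then show False using rk_Un_le[of "F i" A] A(2) by (simp add: mass_on_single)
  qed
  then have "dval (unit_mon A + m) = 0" unfolding dval_def hall_rado_all_def using i(1) by auto
  then show "dfun (cvar A * cmon m) = 0" unfolding dfun_def cvar_unit_mon cmon_add[symmetric] lin_ext_cmon .
qed

text \<open>Downward induction on the pair. Expanding the quadratic relation gives the products
  \<open>flat_var D * flat_var D'\<close> with \<open>D\<close> above \<open>A\<close> but not
  \<open>B\<close>, and \<open>D'\<close> above \<open>B\<close> but not \<open>A\<close>. Such
  flats are again incomparable, and every pair other than \<open>(A, B)\<close> is larger.\<close>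

lemma dfun_incomparable:
  assumes "A \<in> nonempty_flats" "B \<in> nonempty_flats" "\<not> A \<subseteq> B" "\<not> B \<subseteq> A"
  shows "dfun (flat_var A * flat_var B * q) = 0"
  using assms
proof (induction "card (E - A) + card (E - B)" arbitrary: A B rule: less_induct)
  case less
  note A = less.prems(1) and B = less.prems(2)
  let ?C = "cl (A \<union> B)"
  have AE: "flt A" "flt B" "A \<subseteq> E" "B \<subseteq> E" using A B flat_sub unfolding nonempty_flats_def by auto
  have AC: "A \<union> B \<subseteq> ?C" by (rule cl_ext) (use AE in blast)
  then have C: "?C \<in> nonempty_flats" using A unfolding nonempty_flats_def by auto
  have Ciff: "?C \<subseteq> D \<longleftrightarrow> A \<subseteq> D \<and> B \<subseteq> D" if "D \<in> nonempty_flats" for D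
    using cl_sub_iff[of "A \<union> B" D] AE that unfolding nonempty_flats_def by auto
  let ?U = "{D \<in> nonempty_flats. A \<subseteq> D \<and> \<not> B \<subseteq> D}" and ?V = "{D \<in> nonempty_flats. B \<subseteq> D \<and> \<not> A \<subseteq> D}"
  have fin: "finite ?U" "finite ?V" using fin_nonempty_flats by auto
  have diff: "cvar A - cvar ?C = (\<Sum>D\<in>?U. flat_var D)" "cvar B - cvar ?C = (\<Sum>D\<in>?V. flat_var D)"
  proof -
    have "{D \<in> nonempty_flats. A \<subseteq> D} = {D \<in> nonempty_flats. ?C \<subseteq> D} \<union> ?U" using Ciff by blast
    then have "cvar A = (\<Sum>D\<in>{D \<in> nonempty_flats. ?C \<subseteq> D} \<union> ?U. flat_var D)" using flat_var_sum[OF A] by simp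
    also have "\<dots> = cvar ?C + (\<Sum>D\<in>?U. flat_var D)"
      unfolding flat_var_sum[OF C, symmetric] by (rule sum.union_disjoint) (use fin_nonempty_flats Ciff in auto)
    finally show "cvar A - cvar ?C = (\<Sum>D\<in>?U. flat_var D)" by simp
    have "{D \<in> nonempty_flats. B \<subseteq> D} = {D \<in> nonempty_flats. ?C \<subseteq> D} \<union> ?V" using Ciff by blast
    then have "cvar B = (\<Sum>D\<in>{D \<in> nonempty_flats. ?C \<subseteq> D} \<union> ?V. flat_var D)" using flat_var_sum[OF B] by simp
    also have "\<dots> = cvar ?C + (\<Sum>D\<in>?V. flat_var D)"
      unfolding flat_var_sum[OF C, symmetric] by (rule sum.union_disjoint) (use fin_nonempty_flats Ciff in auto)
    finally show "cvar B - cvar ?C = (\<Sum>D\<in>?V. flat_var D)" by simp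
  qed
  have "(cvar A - cvar ?C) * (cvar B - cvar ?C) * q = (\<Sum>D\<in>?U. \<Sum>D'\<in>?V. flat_var D * flat_var D' * q)"
    unfolding diff sum_product by (simp only: sum_distrib_right)
  also have "\<dots> = (\<Sum>(D, D')\<in>?U \<times> ?V. flat_var D * flat_var D' * q)" by (rule sum.cartesian_product)
  finally have "(cvar A - cvar ?C) * (cvar B - cvar ?C) * q = (\<Sum>(D, D')\<in>?U \<times> ?V. flat_var D * flat_var D' * q)" .
  then have "0 = (\<Sum>(D, D')\<in>?U \<times> ?V. dfun (flat_var D * flat_var D' * q))"
    using dfun_quadratic[OF A B, of q] unfolding dfun_def by (simp add: lin_ext_sum case_prod_beta)
  also have "\<dots> = (\<Sum>(D, D')\<in>{(A, B)}. dfun (flat_var D * flat_var D' * q))"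
  proof (rule sum.mono_neutral_right)
    show "finite (?U \<times> ?V)" using fin by simp
    show "{(A, B)} \<subseteq> ?U \<times> ?V" using less.prems by auto
    show "\<forall>i\<in>?U \<times> ?V - {(A, B)}. (case i of (D, D') \<Rightarrow> dfun (flat_var D * flat_var D' * q)) = 0"
    proof
      fix x assume "x \<in> ?U \<times> ?V - {(A, B)}"
      then obtain D D' where x: "x = (D, D')" and D: "D \<in> nonempty_flats" "A \<subseteq> D" "\<not> B \<subseteq> D"
        and D': "D' \<in> nonempty_flats" "B \<subseteq> D'" "\<not> A \<subseteq> D'" and ne: "\<not> (D = A \<and> D' = B)"
        by (cases x) auto
      have DE: "D \<subseteq> E" "D' \<subseteq> E" using D D' flat_sub unfolding nonempty_flats_def by auto
      have le: "card (E - D) \<le> card (E - A)" "card (E - D') \<le> card (E - B)"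
        using D(2) D'(2) finE by (auto intro!: card_mono)
      have "card (E - D) < card (E - A) \<or> card (E - D') < card (E - B)"
      proof (cases "D = A")
        case True
        then have "E - D' \<subset> E - B" using ne D'(2) DE by blast
        then show ?thesis using psubset_card_mono[of "E - B" "E - D'"] finE by auto
      next
        case False
        then have "E - D \<subset> E - A" using D(2) DE by blast
        then show ?thesis using psubset_card_mono[of "E - A" "E - D"] finE by auto
      qed
      then have "card (E - D) + card (E - D') < card (E - A) + card (E - B)" using le by linarith
      moreover have "\<not> D \<subseteq> D'" "\<not> D' \<subseteq> D" using D D' by auto
      ultimately have "dfun (flat_var D * flat_var D' * q) = 0" using less.hyps D(1) D'(1) by blast
      then show "(case x of (D, D') \<Rightarrow> dfun (flat_var D * flat_var D' * q)) = 0" using x by simp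
    qed
  qed
  finally show ?case by simp
qed

text \<open>Each term of the expanded product picks for every \<open>G\<close> in \<open>T\<close> a
  flat having \<open>G\<close> as a factor. By \<open>nst_of_chain\<close> these flats cannot form a
  chain, so two of them are incomparable.\<close>

lemma dfun_nonnested:
  assumes T: "T \<subseteq> \<G>" "\<not> nst T" shows "dfun ((\<Prod>G\<in>T. gen_var G) * q) = 0"
proof -
  let ?c = "\<lambda>G. {F \<in> nonempty_flats. G \<in> factors F}"
  have fT: "finite T" using finite_subset[OF T(1) finG] .
  have "(\<Prod>G\<in>T. gen_var G) = (\<Sum>f\<in>Pi\<^sub>E T ?c. \<Prod>G\<in>T. flat_var (f G))"
    unfolding gen_var_def by (rule prod_sum_PiE[OF fT]) (use fin_nonempty_flats in simp)
  then have "dfun ((\<Prod>G\<in>T. gen_var G) * q) = (\<Sum>f\<in>Pi\<^sub>E T ?c. dfun ((\<Prod>G\<in>T. flat_var (f G)) * q))"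
    unfolding dfun_def by (simp add: sum_distrib_right lin_ext_sum)
  also have "\<dots> = 0"
  proof (rule sum.neutral, rule ballI)
    fix f assume f: "f \<in> Pi\<^sub>E T ?c"
    have fG: "f G \<in> nonempty_flats" "G \<in> factors (f G)" if "G \<in> T" for G using PiE_mem[OF f that] by auto
    have "\<exists>G\<in>T. \<exists>H\<in>T. \<not> f G \<subseteq> f H \<and> \<not> f H \<subseteq> f G"
    proof (rule ccontr)
      assume "\<not> ?thesis"
      then have "nst T" by (intro nst_of_chain[OF T(1), of f]) (use fG in \<open>auto simp: nonempty_flats_def\<close>)
      then show False using T(2) by simp
    qed
    then obtain G H where GH: "G \<in> T" "H \<in> T" "\<not> f G \<subseteq> f H" "\<not> f H \<subseteq> f G" by blast
    then have "G \<noteq> H" by auto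
    have "(\<Prod>G\<in>T. flat_var (f G)) = flat_var (f G) * (\<Prod>G\<in>T - {G}. flat_var (f G))"
      by (rule prod.remove[OF fT GH(1)])
    also have "(\<Prod>G\<in>T - {G}. flat_var (f G)) = flat_var (f H) * (\<Prod>G\<in>T - {G} - {H}. flat_var (f G))"
      by (rule prod.remove) (use fT GH \<open>G \<noteq> H\<close> in auto)
    finally have "(\<Prod>G\<in>T. flat_var (f G)) * q =
        flat_var (f G) * flat_var (f H) * ((\<Prod>G\<in>T - {G} - {H}. flat_var (f G)) * q)" by (simp only: mult.assoc)
    then show "dfun ((\<Prod>G\<in>T. flat_var (f G)) * q) = 0"
      using dfun_incomparable[OF fG(1)[OF GH(1)] fG(1)[OF GH(2)] GH(3,4)] by simp
  qed
  finally show ?thesis .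
qed

lemma dfun_ideal: assumes "p \<in> ID" shows "dfun (csubst gen_var p) = 0"
  using assms unfolding ID_span
proof (induction rule: cpoly.span_induct_alt)
  case base show ?case by (simp add: dfun_def csubst_def)
next
  case (step c x y)
  obtain m g where g: "x = cmon m * g" "g \<in> chow_gens E indep \<G>"
    using step.hyps(1) unfolding ID_gens_def by blast
  have "dfun (csubst gen_var g * mon_subst gen_var m) = 0"
  proof (cases "\<exists>T. g = (\<Prod>G\<in>T. cvar G) \<and> T \<subseteq> \<G> \<and> \<not> nst T")
    case True
    then obtain T where T: "g = (\<Prod>G\<in>T. cvar G)" "T \<subseteq> \<G>" "\<not> nst T" by blast
    show ?thesis unfolding T(1) csubst_prod csubst_cvar by (rule dfun_nonnested[OF T(2,3)])
  next
    case False
    then obtain A where A: "g = (\<Sum>G\<in>{G \<in> \<G>. A \<subseteq> G}. cvar G)" "atom E indep A"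
      using g(2) unfolding chow_gens_def by blast
    have Af: "flt A" "A \<noteq> {}" and min: "\<And>F. flt F \<Longrightarrow> F \<subseteq> A \<Longrightarrow> F = {} \<or> F = A"
      using A(2) unfolding atom_def by auto
    obtain a where a: "a \<in> A" using Af by blast
    then have aE: "a \<in> E" using flat_sub[OF Af(1)] by blast
    have "cl {a} \<subseteq> A" by (rule cl_least[OF _ Af(1)]) (use a in simp)
    moreover have "cl {a} \<noteq> {}" using cl_ext[of "{a}"] aE by auto
    ultimately have "cl {a} = A" using min[OF flat_cl] by blast
    then have rkA: "rk A = 1" using rk_cl[of "{a}"] rk_singleton[OF aE] by simp
    \<comment> \<open>An atom is its own factor and hence belongs to \<open>\<G>\<close>; so the
      image of the linear form is the single coordinate \<open>cvar A\<close>.\<close>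
    obtain K where K: "K \<in> factors A" using Union_factors[OF Af(1)] Af(2) by blast
    then have "K = A" using min[OF factors_flat[OF K] factors_sub[OF K]] factors_ne[OF K] by blast
    then have "A \<in> \<G>" using factors_G[OF K] by simp
    then have "csubst gen_var g = cvar A" unfolding A(1) csubst_sum csubst_cvar by (rule gen_var_sum)
    then show ?thesis using dfun_atom[OF _ rkA] Af unfolding nonempty_flats_def by simp
  qed
  then have "dfun (csubst gen_var x) = 0" unfolding g(1) csubst_mult csubst_cmon by (simp add: mult.commute)
  then show ?case using step.IH unfolding dfun_def csubst_def lin_ext_add lin_ext_cscale by simp
qed

end

section \<open>Feichtner--Yuzvinsky monomials are independent\<close>

context building_set_matroid
begin

text \<open>The chain is formed by the joins of initial segments of the support of \<open>m0\<close>, listed by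
  increasing cardinality; its \<open>i\<close>-th layer contains, of the building set, only elements below the
  \<open>i\<close>-th listed one.\<close>

lemma ex_dual_functional:
  assumes m0: "FY m0"
  shows "\<exists>P. (\<forall>p\<in>ID. lin_ext (\<lambda>m. if P m then 1 else (0 :: 'a cpoly)) (csubst gen_var p) = 0) \<and> P m0 \<and>
    (\<forall>m. keys m \<subseteq> \<G> \<longrightarrow> P m \<longrightarrow>
      wsum rk m \<le> wsum rk m0 \<and> (wsum rk m = wsum rk m0 \<longrightarrow> m = m0))"
proof -
  let ?S = "keys m0"
  have n: "nst ?S" using m0 unfolding FY_def by simp
  have SG: "?S \<subseteq> \<G>" using nst_G[OF n] by blast
  obtain ys where ys: "set ys = ?S" "distinct ys" using finite_distinct_list[of ?S] by auto
  define xs where "xs = sort_key card ys"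
  have xs: "set xs = ?S" "distinct xs" "sorted (map card xs)" unfolding xs_def using ys by simp_all
  define k where "k = length xs"
  \<comment> \<open>\<open>F k\<close> is the join of the whole support. One more step makes the
    chain end at \<open>E\<close>; in that last layer \<open>e k = E\<close> is a crude upper bound,
    and \<open>m0\<close> has no mass there.\<close>
  define F where "F i = (if i \<le> k then cl (\<Union>(set (take i xs))) else E)" for i
  define e where "e i = (if i < k then xs ! i else E)" for i
  define d where "d i = (\<Sum>H\<in>{H. flt H \<and> H \<subseteq> F (Suc i) \<and> \<not> H \<subseteq> F i}. lookup m0 H)" for i
  have xsS: "xs ! i \<in> ?S" if "i < k" for i using nth_mem[of i xs] that unfolding xs(1) k_def .
  have xsG: "xs ! i \<in> \<G>" if "i < k" for i using xsS[OF that] SG by blast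
  have tS: "set (take i xs) \<subseteq> ?S" for i using set_take_subset[of i xs] xs(1) by simp
  have tE: "\<Union>(set (take i xs)) \<subseteq> E" for i using tS[of i] SG G_sub by blast
  have tn: "nst (set (take i xs))" for i using nst_subset[OF n tS] .
  have card_le: "card (xs ! i) \<le> card (xs ! j)" if "i \<le> j" "j < k" for i j
    using sorted_nth_mono[OF xs(3), of i j] that unfolding k_def by simp
  have fin_xs: "finite (xs ! i)" if "i < k" for i using flat_fin[OF G_flat[OF xsG[OF that]]] .
  have sub_eq: "i = j" if "i \<le> j" "j < k" "xs ! j \<subseteq> xs ! i" for i j
  proof -
    have i: "i < k" using that by simp
    have "xs ! j = xs ! i" using card_seteq[OF fin_xs[OF i] that(3) card_le[OF that(1,2)]] .
    then show ?thesis using nth_eq_iff_index_eq[OF xs(2)] i that(2) unfolding k_def by simp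
  qed
  have in_take: "xs ! j \<in> set (take i xs)" if "j < i" "i \<le> k" for i j
    using that unfolding k_def in_set_conv_nth by (intro exI[of _ j]) simp
  have take_ex: "\<exists>j<i. X = xs ! j" if "X \<in> set (take i xs)" "i \<le> k" for X i
    using that unfolding k_def in_set_conv_nth by auto
  have FU: "F i = \<Union>(set (take i xs))" if "i \<le> k" for i
    using Union_NS[OF flat_cl nst_NS[OF tn[of i]]] that unfolding F_def by simp
  have FNS: "set (take i xs) \<in> NS (F i)" if "i \<le> k" for i
    using nst_NS[OF tn[of i]] that unfolding F_def by simp
  have Ff: "flt (F i)" for i unfolding F_def by simp
  have Fm: "F i \<subseteq> F j" if "i \<le> j" for i j
  proof (cases "j \<le> k")
    case True
    then show ?thesis using cl_mono[OF Union_mono[OF set_take_subset_set_take[OF that, of xs]]] that unfolding F_def by simp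
  next
    case False
    then show ?thesis using flat_sub[OF Ff[of i]] unfolding F_def[of j] by simp
  qed
  interpret flat_chain E indep \<G> F "Suc k" d
  proof
    show "flt (F i)" for i by (rule Ff)
    show "i \<le> j \<Longrightarrow> F i \<subseteq> F j" for i j by (rule Fm)
    show "F 0 = {}" unfolding F_def by simp
    show "F (Suc k) = E" unfolding F_def by simp
  qed
  have dm0: "d i = mass_on m0 (layer i)" for i unfolding d_def mass_on_def layer_def ..
  have ef: "flt (e i)" for i unfolding e_def using G_flat xsG by simp
  \<comment> \<open>The factor of \<open>F (Suc i)\<close> above \<open>H\<close> is among the first
    \<open>i + 1\<close> listed sets, but not among the first \<open>i\<close>, which lie in
    \<open>F i\<close>.\<close>
  have layer_le: "H \<subseteq> e i" if H: "H \<in> \<G>" "H \<in> layer i" for H i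
  proof (cases "i < k")
    case True
    have Hg: "H \<subseteq> F (Suc i)" "\<not> H \<subseteq> F i" using H unfolding layer_def by auto
    obtain K where K: "K \<in> factors (F (Suc i))" "H \<subseteq> K" using ex_factor[OF H(1) Hg(1)] by blast
    have "factors (F (Suc i)) \<subseteq> set (take (Suc i) xs)" by (rule NS_factors[OF FNS]) (use True in simp)
    then have "K \<in> set (take (Suc i) xs)" using K by blast
    moreover have "K \<notin> set (take i xs)" using FU[of i] True K(2) Hg(2) by auto
    ultimately have "K = xs ! i" using True unfolding k_def by (simp add: take_Suc_conv_app_nth)
    then show ?thesis using K(2) True unfolding e_def by simp
  qed (use G_sub[OF H(1)] in \<open>simp add: e_def\<close>)
  \<comment> \<open>A listed set \<open>xs ! j\<close> in layer \<open>i\<close> has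
    \<open>i \<le> j\<close> and is contained in \<open>xs ! i\<close>; since the list is sorted by
    cardinality, the two coincide.\<close>
  have m0_layer: "H = e i \<and> i < k" if H: "H \<in> layer i" "i < Suc k" "lookup m0 H \<noteq> 0" for H i
  proof -
    have "H \<in> set xs" using H(3) xs(1) by (simp add: in_keys_iff)
    then obtain j where j: "j < k" "H = xs ! j" unfolding k_def in_set_conv_nth by auto
    have Hi: "\<not> H \<subseteq> F i" using H unfolding layer_def by simp
    have "\<not> j < i"
    proof
      assume "j < i"
      then have "H \<in> set (take i xs)" using in_take j H(2) by simp
      then show False using FU[of i] H(2) Hi by auto
    qed
    then have ij: "i \<le> j" "i < k" using j by auto
    then have "xs ! j \<subseteq> xs ! i" using layer_le[OF xsG[OF j(1)], of i] H(1) j(2) unfolding e_def by simp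
    then have "i = j" using sub_eq[OF ij(1) j(1)] by simp
    then show ?thesis using j ij unfolding e_def by simp
  qed
  \<comment> \<open>Write \<open>G\<close> for \<open>xs ! i\<close>. Comparing the factors of
    \<open>F (Suc i)\<close> with the traces of \<open>F i\<close> shows that the rank grows by at
    least \<open>rk G - rk (F i \<inter> G)\<close>, and \<open>F i \<inter> G\<close> lies in the
    join of the support below \<open>G\<close>. The strict bound in \<open>FY\<close> supplies the
    additional 1 of the Hall-Rado condition.\<close>
  have rank_gap: "rk (F i) + 1 + lookup m0 (xs ! i) \<le> rk (F i \<union> xs ! i)" if i: "i < k" for i
  proof -
    let ?G = "xs ! i" and ?F = "F (Suc i)"
    have G: "?G \<in> \<G>" using xsG[OF i] .
    have tk: "set (take (Suc i) xs) = insert ?G (set (take i xs))"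
      using i unfolding k_def by (simp add: take_Suc_conv_app_nth)
    have "rk ?F = rk (\<Union>(set (take i xs)) \<union> ?G)" unfolding F_def using i tk by (simp add: Un_commute)
    also have "\<dots> = rk (F i \<union> ?G)" using rk_Un_cl[OF tE[of i] G_sub[OF G]] i unfolding F_def by simp
    finally have rF: "rk ?F = rk (F i \<union> ?G)" .
    have "?G \<subseteq> ?F" using FU[of "Suc i"] i tk by auto
    then obtain K where K: "K \<in> factors ?F" "?G \<subseteq> K" using ex_factor[OF G] by blast
    have "factors ?F \<subseteq> set (take (Suc i) xs)" by (rule NS_factors[OF FNS]) (use i in simp)
    then have "K \<in> set (take (Suc i) xs)" using K by blast
    then obtain j where j: "j < Suc i" "K = xs ! j" using take_ex[of K "Suc i"] i by auto
    then have "j = i" using sub_eq[of j i] K(2) i by simp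
    then have GF: "?G \<in> factors ?F" using K j by simp
    have FF: "F i \<subseteq> ?F" by (rule Fm) simp
    have "rk ?F = rk ?G + (\<Sum>K\<in>factors ?F - {?G}. rk K)"
      unfolding rk_factors[OF Ff[of "Suc i"]] by (rule sum.remove[OF fin_factors GF])
    moreover have "rk (F i) = rk (F i \<inter> ?G) + (\<Sum>K\<in>factors ?F - {?G}. rk (F i \<inter> K))"
      unfolding rk_below[OF Ff[of "Suc i"] Ff[of i] FF] by (rule sum.remove[OF fin_factors GF])
    moreover have "(\<Sum>K\<in>factors ?F - {?G}. rk (F i \<inter> K)) \<le> (\<Sum>K\<in>factors ?F - {?G}. rk K)"
      by (rule sum_mono) (simp add: rk_mono)
    moreover have "rk (F i \<inter> ?G) \<le> rk (Jset E indep ?S ?G)"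
    proof (rule rk_mono, rule subsetI)
      fix x assume x: "x \<in> F i \<inter> ?G"
      then obtain j where j: "j < i" "x \<in> xs ! j" using FU[of i] take_ex[of _ i] i by auto
      have jk: "j < k" using j i by simp
      have S: "xs ! j \<in> ?S" "?G \<in> ?S" using xsS[OF jk] xsS[OF i] by auto
      have "xs ! j \<subseteq> ?G \<or> ?G \<subseteq> xs ! j" by (rule nst_comparable[OF n S]) (use x j in auto)
      moreover have "\<not> ?G \<subseteq> xs ! j" using sub_eq[of j i] j i by auto
      ultimately have "xs ! j \<in> {H \<in> ?S. H \<subset> ?G}" using S by auto
      then have "x \<in> \<Union>{H \<in> ?S. H \<subset> ?G}" using j(2) by blast
      moreover have "\<Union>{H \<in> ?S. H \<subset> ?G} \<subseteq> E" using SG G_sub by blast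
      from cl_ext[OF this] have "\<Union>{H \<in> ?S. H \<subset> ?G} \<subseteq> Jset E indep ?S ?G" unfolding Jset_def fjoin_def .
      ultimately show "x \<in> Jset E indep ?S ?G" by (rule subsetD[rotated])
    qed
    moreover have "?G \<in> ?S" using xsS[OF i] .
    then have "lookup m0 ?G < rk ?G - rk (Jset E indep ?S ?G)" using m0 unfolding FY_def by blast
    ultimately show ?thesis using rF by linarith
  qed
  have P0: "hall_rado_all m0"
    unfolding hall_rado_all_def hall_rado_def
  proof (intro allI impI conjI)
    fix i assume i: "i < Suc k"
    show "mass_on m0 (layer i) = d i" using dm0 by simp
    fix I assume I: "I \<subseteq> layer i" "I \<noteq> {}"
    show "rk (F i) + 1 + mass_on m0 I \<le> rk (F i \<union> \<Union>I)"
    \<comment> \<open>Within the layer \<open>m0\<close> is concentrated on \<open>e i\<close>; sets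
      \<open>I\<close> avoiding it carry no mass and need only a rank increase of 1.\<close>
    proof (cases "i < k \<and> e i \<in> I")
      case True
      have "mass_on m0 I = (\<Sum>H\<in>{e i}. lookup m0 H)"
        unfolding mass_on_def by (rule sum.mono_neutral_right) (use layer_fin[OF I(1)] True m0_layer I(1) i in auto)
      also have "\<dots> = lookup m0 (xs ! i)" using True unfolding e_def by simp
      finally have "rk (F i) + 1 + mass_on m0 I \<le> rk (F i \<union> xs ! i)" using rank_gap True by simp
      also have "\<dots> \<le> rk (F i \<union> \<Union>I)" by (rule rk_mono) (use True in \<open>auto simp: e_def\<close>)
      finally show ?thesis .
    next
      case False
      have "mass_on m0 I = 0" unfolding mass_on_def
        by (rule sum.neutral) (use m0_layer I(1) i False in blast)
      moreover obtain H where H: "H \<in> I" using I(2) by blast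
      then obtain x where x: "x \<in> H" "x \<notin> F i" "flt H" using I(1) unfolding layer_def by blast
      have "x \<in> E" using x flat_sub by blast
      then have "rk (insert x (F i)) = Suc (rk (F i))" using rk_insert_flat[OF Ff] x(2) by blast
      moreover have "rk (insert x (F i)) \<le> rk (F i \<union> \<Union>I)" by (rule rk_mono) (use x H in blast)
      ultimately show ?thesis by simp
    qed
  qed
  have wsum_layer: "wsum rk m = (\<Sum>i<Suc k. \<Sum>H\<in>layer i. lookup m H * rk H)"
    and key_layer: "\<And>H. H \<in> keys m \<Longrightarrow> \<exists>i<Suc k. H \<in> layer i"
    if m: "keys m \<subseteq> \<G>" for m
  proof -
    show kg: "\<exists>i<Suc k. H \<in> layer i" if H: "H \<in> keys m" for H
      by (rule layer_exists) (use H m G_flat G_ne in \<open>auto simp: nonempty_flats_def\<close>)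
    have "wsum rk m = (\<Sum>H\<in>(\<Union>i<Suc k. layer i). lookup m H * rk H)"
      unfolding wsum_def
    proof (rule sum.mono_neutral_left)
      show "finite (\<Union>i<Suc k. layer i)" using fin_layer by blast
      show "keys m \<subseteq> (\<Union>i<Suc k. layer i)" using kg by fastforce
    qed (auto simp: in_keys_iff)
    also have "\<dots> = (\<Sum>i<Suc k. \<Sum>H\<in>layer i. lookup m H * rk H)"
      by (rule sum.UNION_disjoint) (use fin_layer layer_disjoint in auto)
    finally show "wsum rk m = (\<Sum>i<Suc k. \<Sum>H\<in>layer i. lookup m H * rk H)" .
  qed
  have dsum: "d i * rk (e i) = (\<Sum>H\<in>layer i. lookup m H * rk (e i))" if "hall_rado_all m" "i < Suc k" for m i
    using that unfolding hall_rado_all_def hall_rado_def mass_on_def by (simp add: sum_distrib_right[symmetric])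
  have term_le: "lookup m H * rk H \<le> lookup m H * rk (e i)"
    if "keys m \<subseteq> \<G>" "H \<in> layer i" for m H i
  proof (cases "lookup m H = 0")
    case False
    then have "H \<in> \<G>" using that(1) by (auto simp: in_keys_iff)
    then show ?thesis using rk_mono[OF layer_le[OF _ that(2)]] by simp
  qed simp
  have w0: "wsum rk m0 = (\<Sum>i<Suc k. d i * rk (e i))"
    unfolding wsum_layer[OF SG]
  proof (rule sum.cong[OF refl])
    fix i assume "i \<in> {..<Suc k}"
    then have i: "i < Suc k" by simp
    show "(\<Sum>H\<in>layer i. lookup m0 H * rk H) = d i * rk (e i)"
      unfolding dsum[OF P0 i] by (rule sum.cong[OF refl]) (use m0_layer i in fastforce)
  qed
  have mass: "lookup m (e i) = d i"
    if m: "hall_rado_all m" "i < Suc k" "e i \<in> layer i" "\<And>H. H \<in> layer i \<Longrightarrow> lookup m H \<noteq> 0 \<Longrightarrow> H = e i" for m i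
  proof -
    have "d i = (\<Sum>H\<in>layer i. lookup m H)" using m(1,2) unfolding hall_rado_all_def hall_rado_def mass_on_def by simp
    also have "\<dots> = (\<Sum>H\<in>{e i}. lookup m H)"
      by (rule sum.mono_neutral_right) (use fin_layer m(3,4) in auto)
    finally show ?thesis by simp
  qed
  \<comment> \<open>A detected \<open>m\<close> has the same degree as \<open>m0\<close> in every
    layer, and its variables there lie below \<open>e i\<close>. So its total rank is at most that
    of \<open>m0\<close>, with equality only if all its mass sits on the \<open>e i\<close>.\<close>
  have "wsum rk m \<le> wsum rk m0 \<and> (wsum rk m = wsum rk m0 \<longrightarrow> m = m0)"
    if m: "keys m \<subseteq> \<G>" "hall_rado_all m" for m
  proof (intro conjI impI)
    have inner: "(\<Sum>H\<in>layer i. lookup m H * rk H) \<le> d i * rk (e i)" if "i < Suc k" for i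
      unfolding dsum[OF m(2) that] by (rule sum_mono) (rule term_le[OF m(1)])
    show "wsum rk m \<le> wsum rk m0" unfolding wsum_layer[OF m(1)] w0 by (rule sum_mono) (use inner in simp)
    assume "wsum rk m = wsum rk m0"
    then have eq: "(\<Sum>i<Suc k. \<Sum>H\<in>layer i. lookup m H * rk H) = (\<Sum>i<Suc k. d i * rk (e i))"
      unfolding wsum_layer[OF m(1)] w0 .
    have supp: "H = e i" if i: "i < Suc k" and H: "H \<in> layer i" "lookup m H \<noteq> 0" for i H
    proof -
      have "(\<Sum>H\<in>layer i. lookup m H * rk H) = d i * rk (e i)"
        by (rule sum_mono_inv[OF eq]) (use inner i in auto)
      then have eq': "(\<Sum>H\<in>layer i. lookup m H * rk H) = (\<Sum>H\<in>layer i. lookup m H * rk (e i))"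
        unfolding dsum[OF m(2) i] .
      have "lookup m H * rk H = lookup m H * rk (e i)"
        by (rule sum_mono_inv[OF eq' _ H(1) fin_layer]) (rule term_le[OF m(1)])
      then have "rk H = rk (e i)" using H(2) by simp
      moreover have HG: "H \<in> \<G>" using H(2) m(1) by (auto simp: in_keys_iff)
      ultimately show ?thesis using flat_eqI[OF G_flat[OF HG] ef layer_le[OF HG H(1)]] by simp
    qed
    show "m = m0"
    proof (rule poly_mapping_eqI)
      fix H
      show "lookup m H = lookup m0 H"
      proof (cases "\<exists>i<Suc k. H \<in> layer i")
        case False
        then have "H \<notin> keys m" "H \<notin> ?S" using key_layer[OF m(1)] key_layer[OF SG] by blast+
        then show ?thesis by (simp add: in_keys_iff)
      next
        case True
        then obtain i where i: "i < Suc k" "H \<in> layer i" by blast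
        show ?thesis
        proof (cases "H = e i")
          case False
          then have "lookup m H = 0" "lookup m0 H = 0"
            using supp[OF i] m0_layer[OF i(2,1)] by blast+
          then show ?thesis by simp
        next
          case True
          have "lookup m (e i) = d i" by (rule mass[OF m(2) i(1)]) (use i True supp in auto)
          moreover have "lookup m0 (e i) = d i" by (rule mass[OF P0 i(1)]) (use i True m0_layer in auto)
          ultimately show ?thesis using True by simp
        qed
      qed
    qed
  qed
  moreover have "\<forall>p\<in>ID. lin_ext (\<lambda>m. if hall_rado_all m then 1 else (0 :: 'a cpoly)) (csubst gen_var p) = 0"
    using dfun_ideal unfolding dfun_def dval_def[abs_def] by blast
  ultimately show ?thesis using P0 by blast
qed

lemma mon_subst_cvar: "mon_subst cvar m = cmon m"
proof -
  have "(\<Prod>G\<in>A. cvar G ^ lookup m G) = cmon (\<Sum>G\<in>A. single G (lookup m G))" for A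
    by (induction A rule: infinite_finite_induct) (simp_all add: cvar_power cmon_add)
  moreover have "(\<Sum>G\<in>keys m. single G (lookup m G)) = m"
  proof (rule poly_mapping_eqI)
    fix H
    have "lookup (\<Sum>G\<in>keys m. single G (lookup m G)) H =
        (\<Sum>G\<in>keys m. if H = G then lookup m G else 0)"
      unfolding lookup_sum by (rule sum.cong) (auto simp: lookup_single when_def)
    then show "lookup (\<Sum>G\<in>keys m. single G (lookup m G)) H =
      lookup m H" by (simp add: in_keys_iff)
  qed
  ultimately show ?thesis unfolding mon_subst_def by simp
qed

text \<open>The substitution turns products of upper sums into genuine monomials, on which the
  functionals are indicator functions.\<close>

lemma csubst_upper_sum: assumes m: "keys m \<subseteq> \<G>" shows "csubst gen_var (mon_subst upper_sum m) = cmon m"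
proof -
  have "csubst gen_var (upper_sum G) = cvar G" if "G \<in> \<G>" for G
    unfolding upper_sum_def csubst_sum csubst_cvar by (rule gen_var_sum[OF that])
  then have "csubst gen_var (mon_subst upper_sum m) = mon_subst cvar m"
    unfolding mon_subst_def csubst_prod csubst_power using m by (intro prod.cong refl) auto
  then show ?thesis using mon_subst_cvar by simp
qed

lemma upper_sum_mon_rank_part: "mon_subst upper_sum m \<in> rank_part (mdeg m) 0"
proof -
  have "(\<Prod>G\<in>A. upper_sum G ^ f G) \<in> rank_part (\<Sum>G\<in>A. f G) 0" for A :: "'a set set" and f
  proof (induction A rule: infinite_finite_induct)
    case (insert G A)
    have "upper_sum G ^ f G \<in> rank_part (f G) 0"
      using rank_part_power[OF upper_sum_rank_part[of G], of "f G"] rank_part_mono[of 0 "f G * rk G" "f G"] by auto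
    then show ?case using rank_part_mult[OF _ insert.IH] insert.hyps by fastforce
  qed (simp_all add: rank_part_one)
  then show ?thesis unfolding mon_subst_def mdeg_def by blast
qed

text \<open>Choose \<open>m0\<close> of least total rank with nonzero coefficient. Its functional
  detects no other monomial of at least that rank, so applied to the relation it isolates the
  coefficient of \<open>m0\<close>.\<close>

lemma upper_sum_independent:
  assumes s: "(\<Sum>m\<in>FYs i. cscale (c m) (mon_subst upper_sum m)) \<in> ID" shows "\<forall>m\<in>FYs i. c m = 0"
proof (rule ccontr)
  assume "\<not> ?thesis"
  then obtain m1 where "m1 \<in> FYs i \<and> c m1 \<noteq> 0" by blast
  then obtain m0 where m0: "m0 \<in> FYs i \<and> c m0 \<noteq> 0"
    and min: "\<And>m. m \<in> FYs i \<and> c m \<noteq> 0 \<Longrightarrow> wsum rk m0 \<le> wsum rk m"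
    using ex_has_least_nat[of "\<lambda>m. m \<in> FYs i \<and> c m \<noteq> 0" m1 "wsum rk"] by blast
  have keys: "keys m \<subseteq> \<G>" if "m \<in> FYs i" for m using FYs_rank_mons that unfolding rank_mons_def by blast
  have "FY m0" using m0 unfolding FYs_def by simp
  from ex_dual_functional[OF this] obtain P where
    P: "\<forall>p\<in>ID. lin_ext (\<lambda>m. if P m then 1 else (0 :: 'a cpoly)) (csubst gen_var p) = 0" "P m0"
      "\<And>m. keys m \<subseteq> \<G> \<Longrightarrow> P m \<Longrightarrow> wsum rk m \<le> wsum rk m0 \<and> (wsum rk m = wsum rk m0 \<longrightarrow> m = m0)"
    by blast
  let ?v = "\<lambda>m. if P m then 1 else (0 :: 'a cpoly)"
  have sub: "csubst gen_var (\<Sum>m\<in>FYs i. cscale (c m) (mon_subst upper_sum m)) = (\<Sum>m\<in>FYs i. cscale (c m) (cmon m))"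
    unfolding csubst_sum
  proof (rule sum.cong[OF refl])
    fix m assume m: "m \<in> FYs i"
    have "csubst gen_var (cscale (c m) (mon_subst upper_sum m)) = cscale (c m) (csubst gen_var (mon_subst upper_sum m))"
      unfolding csubst_def by (rule lin_ext_cscale)
    then show "csubst gen_var (cscale (c m) (mon_subst upper_sum m)) = cscale (c m) (cmon m)"
      unfolding csubst_upper_sum[OF keys[OF m]] .
  qed
  have "0 = lin_ext ?v (\<Sum>m\<in>FYs i. cscale (c m) (cmon m))" using bspec[OF P(1) s] unfolding sub by (rule sym)
  also have "\<dots> = (\<Sum>m\<in>FYs i. cscale (c m) (?v m))" unfolding lin_ext_sum lin_ext_cscale lin_ext_cmon ..
  also have "\<dots> = (\<Sum>m\<in>{m0}. cscale (c m) (?v m))"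
  proof (rule sum.mono_neutral_right[OF fin_FYs])
    show "\<forall>m\<in>FYs i - {m0}. cscale (c m) (?v m) = 0"
    proof
      fix m assume m: "m \<in> FYs i - {m0}"
      show "cscale (c m) (?v m) = 0"
      proof (cases "c m = 0 \<or> \<not> P m")
        case False
        have mF: "m \<in> FYs i" using m by blast
        then have "wsum rk m0 \<le> wsum rk m" using min[of m] False by simp
        moreover have "wsum rk m \<le> wsum rk m0 \<and> (wsum rk m = wsum rk m0 \<longrightarrow> m = m0)"
          by (rule P(3)[OF keys[OF mF]]) (use False in simp)
        ultimately have "m = m0" by simp
        then show ?thesis using m by blast
      qed auto
    qed
  qed (use m0 in simp)
  finally have "cscale (c m0) (1 :: 'a cpoly) = 0" using P(2) by simp
  then have "lookup (cscale (c m0) (1 :: 'a cpoly)) 0 = 0" by simp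
  then show False using m0 by (simp add: lookup_cscale lookup_one)
qed

lemma chow_dim_FYs: "chow_dim E indep \<G> i = card (FYs i)"
proof -
  have "cpoly.dim (rank_part i 0 \<inter> ID) + card (FYs i) \<le> cpoly.dim (rank_part i 0)"
  proof (rule cpoly.dim_ge_quotient[OF _ _ _ _ fin_FYs])
    show "rank_part i 0 \<subseteq> cpoly.span (cmon ` rank_mons i 0)" unfolding rank_part_def ..
    show "finite (cmon ` rank_mons i 0)" using fin_rank_mons by simp
    show "cpoly.subspace (rank_part i 0 \<inter> ID)" by (rule cpoly.subspace_inter[OF rank_part_subspace ID_subspace])
    show "mon_subst upper_sum ` FYs i \<subseteq> rank_part i 0" using upper_sum_mon_rank_part unfolding FYs_def by auto
    show "\<forall>m\<in>FYs i. c m = 0" if "(\<Sum>m\<in>FYs i. cscale (c m) (mon_subst upper_sum m)) \<in> rank_part i 0 \<inter> ID" for c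
      using upper_sum_independent that by blast
  qed blast
  then show ?thesis using dim_upper[of i] unfolding chow_dim_def hom_part_rank_part by linarith
qed

end

section \<open>The Hilbert series as a polynomial\<close>

lemma tqint_sum: "tqint n = (\<Sum>j\<in>{1..<n}. monom 1 j)"
proof -
  have "tqint n = (\<Sum>i<n - 1. monom 1 (Suc i))"
    unfolding tqint_def qint_def sum_distrib_left by (simp add: monom_Suc)
  also have "\<dots> = (\<Sum>j\<in>Suc ` {..<n - 1}. monom 1 j)" by (simp add: sum.reindex)
  also have "Suc ` {..<n - 1} = {1..<n}"
  proof
    show "{1..<n} \<subseteq> Suc ` {..<n - 1}"
    proof
      fix j assume "j \<in> {1..<n}"
      then show "j \<in> Suc ` {..<n - 1}" by (intro image_eqI[of _ _ "j - 1"]) auto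
    qed
  qed auto
  finally show ?thesis .
qed

lemma prod_monom: "(\<Prod>x\<in>A. monom (1 :: rat) (f x)) = monom 1 (\<Sum>x\<in>A. f x)"
  by (induction A rule: infinite_finite_induct) (simp_all add: mult_monom monom_0 one_pCons)

text \<open>Restriction to \<open>S\<close> identifies these vectors with a box having sides
  \<open>{1..<n X}\<close>; the lower end 1 comes from \<open>keys m = S\<close>.\<close>

lemma sum_exponent_vectors:
  fixes S :: "'a set set" and n :: "'a set \<Rightarrow> nat"
  assumes S: "finite S"
  defines "A \<equiv> {m. keys m = S \<and> (\<forall>X\<in>S. lookup m X < n X)}"
  shows "finite A" and "(\<Sum>m\<in>A. monom 1 (mdeg m)) = (\<Prod>X\<in>S. tqint (n X))"
proof -
  let ?B = "Pi\<^sub>E S (\<lambda>X. {1..<n X})"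
  define mk where "mk f = Abs_poly_mapping (\<lambda>X. if X \<in> S then f X else 0)" for f :: "'a set \<Rightarrow> nat"
  have mk: "lookup (mk f) X = (if X \<in> S then f X else 0)" for f X
  proof -
    have "finite {X. (if X \<in> S then f X else 0) \<noteq> 0}" by (rule finite_subset[OF _ S]) auto
    then show ?thesis unfolding mk_def by simp
  qed
  have bij: "bij_betw (\<lambda>m. \<lambda>X\<in>S. lookup m X) A ?B"
  proof (rule bij_betw_byWitness[where f' = mk])
    show "\<forall>m\<in>A. mk (\<lambda>X\<in>S. lookup m X) = m"
    proof
      fix m assume "m \<in> A"
      then have k: "keys m = S" unfolding A_def by simp
      show "mk (\<lambda>X\<in>S. lookup m X) = m"
      proof (rule poly_mapping_eqI)
        fix X show "lookup (mk (\<lambda>X\<in>S. lookup m X)) X = lookup m X"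
          unfolding mk using k by (auto simp: in_keys_iff)
      qed
    qed
    show "\<forall>f\<in>?B. (\<lambda>X\<in>S. lookup (mk f) X) = f"
    proof
      fix f assume f: "f \<in> ?B"
      show "(\<lambda>X\<in>S. lookup (mk f) X) = f"
      proof
        fix X show "(\<lambda>X\<in>S. lookup (mk f) X) X = f X"
          unfolding mk using PiE_arb[OF f, of X] by simp
      qed
    qed
    show "(\<lambda>m. \<lambda>X\<in>S. lookup m X) ` A \<subseteq> ?B"
    proof
      fix f assume "f \<in> (\<lambda>m. \<lambda>X\<in>S. lookup m X) ` A"
      then obtain m where m: "m \<in> A" "f = (\<lambda>X\<in>S. lookup m X)" by blast
      have "lookup m X \<in> {1..<n X}" if "X \<in> S" for X
      proof -
        have "X \<in> keys m" "lookup m X < n X" using m(1) that unfolding A_def by auto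
        then show ?thesis by (simp add: in_keys_iff)
      qed
      then show "f \<in> ?B" using m(2) by auto
    qed
    show "mk ` ?B \<subseteq> A"
    proof
      fix m assume "m \<in> mk ` ?B"
      then obtain f where f: "f \<in> ?B" "m = mk f" by blast
      have fX: "f X \<in> {1..<n X}" if "X \<in> S" for X using PiE_mem[OF f(1) that] .
      have "X \<in> keys m \<longleftrightarrow> X \<in> S" for X using fX[of X] f(2) by (auto simp: in_keys_iff mk)
      then have "keys m = S" by blast
      then show "m \<in> A" unfolding A_def using fX f(2) by (auto simp: mk)
    qed
  qed
  have "finite ?B" by (rule finite_PiE[OF S]) simp
  then show "finite A" using bij_betw_finite[OF bij] by simp
  have "(\<Prod>X\<in>S. tqint (n X)) = (\<Sum>f\<in>?B. \<Prod>X\<in>S. monom 1 (f X))"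
    unfolding tqint_sum by (rule prod_sum_PiE[OF S]) simp
  also have "\<dots> = (\<Sum>f\<in>?B. monom 1 (\<Sum>X\<in>S. f X))" unfolding prod_monom ..
  also have "\<dots> = (\<Sum>m\<in>A. monom 1 (\<Sum>X\<in>S. (\<lambda>X\<in>S. lookup m X) X))"
    by (rule sum.reindex_bij_betw[OF bij, symmetric])
  also have "\<dots> = (\<Sum>m\<in>A. monom 1 (mdeg m))"
  proof (rule sum.cong[OF refl])
    fix m assume "m \<in> A"
    then have "mdeg m = (\<Sum>X\<in>S. lookup m X)" unfolding A_def mdeg_def by simp
    then show "monom 1 (\<Sum>X\<in>S. (\<lambda>X\<in>S. lookup m X) X) = monom 1 (mdeg m)" by simp
  qed
  finally show "(\<Sum>m\<in>A. monom 1 (mdeg m)) = (\<Prod>X\<in>S. tqint (n X))" ..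
qed

context irreducible_complete
begin

lemma chow_poly_FY_gf: "chow_poly E indep \<G> = FY_gf"
proof -
  let ?n = "\<lambda>S X. rk X - rk (Jset E indep S X)"
  let ?A = "\<lambda>S. {m. keys m = S \<and> (\<forall>X\<in>S. lookup m X < ?n S X)}"
  have fS: "finite {S. nst S}" by (rule finite_subset[of _ "Pow \<G>"]) (use finG nst_G in auto)
  have FYU: "{m. FY m} = (\<Union>S\<in>{S. nst S}. ?A S)" unfolding FY_def by auto
  have fA: "finite (?A S)" if "nst S" for S by (rule sum_exponent_vectors(1)[OF nst_fin[OF that]])
  have fFY: "finite {m. FY m}" unfolding FYU using fS fA by blast
  have "FY_gf = (\<Sum>S\<in>{S. nst S}. \<Sum>m\<in>?A S. monom 1 (mdeg m))"
    unfolding FY_gf_def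
  proof (rule sum.cong[OF refl])
    fix S assume "S \<in> {S. nst S}"
    then have "finite S" using nst_fin by simp
    from sum_exponent_vectors(2)[OF this, of "?n S"]
    show "(\<Prod>X\<in>S. tqint (?n S X)) = (\<Sum>m\<in>?A S. monom 1 (mdeg m))" ..
  qed
  also have "\<dots> = (\<Sum>m\<in>{m. FY m}. monom 1 (mdeg m))"
    unfolding FYU by (rule sum.UNION_disjoint[symmetric]) (use fS fA in auto)
  finally have gf: "FY_gf = (\<Sum>m\<in>{m. FY m}. monom 1 (mdeg m))" .
  have "coeff FY_gf i = of_nat (chow_dim E indep \<G> i)" for i
  proof -
    have "coeff FY_gf i = (\<Sum>m\<in>{m. FY m}. if mdeg m = i then 1 else 0)"
      unfolding gf by (simp add: coeff_sum coeff_monom)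
    also have "\<dots> = (\<Sum>m\<in>{m \<in> {m. FY m}. mdeg m = i}. 1)" by (rule sum.inter_filter[OF fFY, symmetric])
    also have "{m \<in> {m. FY m}. mdeg m = i} = FYs i" unfolding FYs_def by blast
    finally show ?thesis using chow_dim_FYs by simp
  qed
  \<comment> \<open>\<open>Abs_poly\<close> is meaningful here because the dimensions are the
    coefficients of an actual polynomial, so almost all of them are 0.\<close>
  then have "(\<lambda>i. of_nat (chow_dim E indep \<G> i)) = coeff FY_gf" by auto
  then show ?thesis unfolding chow_poly_def by (simp add: coeff_inverse)
qed

end

section \<open>Uniqueness and identification of the gamma expansion\<close>

lemma gamma_expansion_unique:
  fixes g h :: "rat poly"
  assumes eq: "(\<Sum>i\<le>n div 2. smult (coeff g i) (monom 1 i * [:1, 1:] ^ (n - 2 * i))) =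
      (\<Sum>i\<le>n div 2. smult (coeff h i) (monom 1 i * [:1, 1:] ^ (n - 2 * i)))"
    and deg: "degree g \<le> n div 2" "degree h \<le> n div 2"
  shows "g = h"
proof (rule poly_eqI)
  fix i
  \<comment> \<open>The expansion is triangular: the \<open>i\<close>-th basis polynomial starts
    with t^i and coefficient 1, so the coefficient at \<open>j\<close> is \<open>coeff g j\<close>
    plus a combination of earlier ones.\<close>
  have c: "coeff (\<Sum>i\<le>n div 2. smult (coeff g i) (monom 1 i * [:1, 1:] ^ (n - 2 * i))) j =
      (\<Sum>i\<in>{i. i \<le> n div 2 \<and> i < j}. coeff g i * coeff ([:1, 1:] ^ (n - 2 * i)) (j - i)) + coeff g j"
    if "j \<le> n div 2" for j and g :: "rat poly"
  proof -
    have "coeff (\<Sum>i\<le>n div 2. smult (coeff g i) (monom 1 i * [:1, 1:] ^ (n - 2 * i))) j =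
        (\<Sum>i\<le>n div 2. if i \<le> j then coeff g i * coeff ([:1, 1:] ^ (n - 2 * i)) (j - i) else 0)"
      unfolding coeff_sum by (rule sum.cong) (auto simp: coeff_monom_mult)
    also have "\<dots> = (\<Sum>i\<in>{i \<in> {..n div 2}. i \<le> j}. coeff g i * coeff ([:1, 1:] ^ (n - 2 * i)) (j - i))"
      by (rule sum.inter_filter[symmetric]) simp
    also have "{i \<in> {..n div 2}. i \<le> j} = insert j {i. i \<le> n div 2 \<and> i < j}" using that by auto
    also have "(\<Sum>i\<in>insert j {i. i \<le> n div 2 \<and> i < j}. coeff g i * coeff ([:1, 1:] ^ (n - 2 * i)) (j - i)) =
        coeff g j * coeff ([:1, 1:] ^ (n - 2 * j)) (j - j) +
        (\<Sum>i\<in>{i. i \<le> n div 2 \<and> i < j}. coeff g i * coeff ([:1, 1:] ^ (n - 2 * i)) (j - i))"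
      by (rule sum.insert) auto
    also have "coeff ([:1, 1:] ^ (n - 2 * j)) (j - j) = (1 :: rat)" by (simp add: coeff_0_power)
    finally show ?thesis by simp
  qed
  show "coeff g i = coeff h i"
  proof (induction i rule: less_induct)
    case (less i)
    show ?case
    proof (cases "i \<le> n div 2")
      case True
      have "(\<Sum>k\<in>{k. k \<le> n div 2 \<and> k < i}. coeff g k * coeff ([:1, 1:] ^ (n - 2 * k)) (i - k)) =
          (\<Sum>k\<in>{k. k \<le> n div 2 \<and> k < i}. coeff h k * coeff ([:1, 1:] ^ (n - 2 * k)) (i - k))"
        by (rule sum.cong) (use less in auto)
      then show ?thesis using c[OF True, of g] c[OF True, of h] eq by simp
    next
      case False
      then show ?thesis using deg by (simp add: coeff_eq_0)
    qed
  qed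
qed

text \<open>Since \<open>gamma_poly\<close> refers to the degree of \<open>H\<close>, that degree
  must be shown to be \<open>n\<close>. Only the summand \<open>i = 0\<close> of the expansion
  contributes to the coefficients at 0 and at \<open>n\<close>, both times with
  \<open>coeff g 0\<close>, and \<open>H0\<close> makes this 1.\<close>

lemma gamma_poly_eqI:
  fixes H :: "rat poly" and d :: "'s \<Rightarrow> nat"
  assumes St: "finite St" and d: "\<And>s. s \<in> St \<Longrightarrow> 2 * d s \<le> n"
    and H: "H = (\<Sum>s\<in>St. monom 1 (d s) * [:1, 1:] ^ (n - 2 * d s))" and H0: "poly H 0 = 1"
  shows "gamma_poly H = (\<Sum>s\<in>St. monom 1 (d s))"
proof -
  define g :: "rat poly" where "g = (\<Sum>s\<in>St. monom 1 (d s))"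
  let ?T = "\<lambda>i. monom 1 i * [:1, 1:] ^ (n - 2 * i) :: rat poly"
  have dg: "degree g \<le> n div 2" unfolding g_def
  proof (rule degree_sum_le[OF St])
    fix s assume "s \<in> St"
    then show "degree (monom (1 :: rat) (d s)) \<le> n div 2" using d[of s] by (simp add: degree_monom_eq)
  qed
  have exp: "H = (\<Sum>i\<le>n div 2. smult (coeff g i) (?T i))"
  proof -
    have "(\<Sum>i\<le>n div 2. smult (coeff g i) (?T i)) = (\<Sum>i\<le>n div 2. \<Sum>s\<in>St. if i = d s then ?T i else 0)"
    proof (rule sum.cong[OF refl])
      fix i
      have "coeff g i = (\<Sum>s\<in>St. if d s = i then 1 else 0)" unfolding g_def by (simp add: coeff_sum coeff_monom)
      then show "smult (coeff g i) (?T i) = (\<Sum>s\<in>St. if i = d s then ?T i else 0)"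
        by (simp only: smult_sum) (rule sum.cong, auto)
    qed
    also have "\<dots> = (\<Sum>s\<in>St. \<Sum>i\<le>n div 2. if i = d s then ?T i else 0)" by (rule sum.swap)
    also have "\<dots> = H" unfolding H
    proof (rule sum.cong[OF refl])
      fix s assume "s \<in> St"
      then have "d s \<le> n div 2" using d[of s] by simp
      then show "(\<Sum>i\<le>n div 2. if i = d s then ?T i else 0) = monom 1 (d s) * [:1, 1:] ^ (n - 2 * d s)" by simp
    qed
    finally show ?thesis ..
  qed
  have T_deg: "degree (?T i) \<le> n - i" if "i \<le> n div 2" for i
  proof -
    have "degree (?T i) \<le> degree (monom (1 :: rat) i) + degree ([:1, 1:] ^ (n - 2 * i) :: rat poly)" by (rule degree_mult_le)
    also have "\<dots> \<le> n - i" using that degree_power_le[of "[:1, 1:] :: rat poly" "n - 2 * i"] by (simp add: degree_monom_eq)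
    finally show ?thesis .
  qed
  have "coeff g 0 = 1"
  proof -
    have "1 = coeff H 0" using H0 by (simp add: poly_0_coeff_0)
    also have "\<dots> = (\<Sum>i\<le>n div 2. if i = 0 then coeff g 0 else 0)"
      unfolding exp coeff_sum by (rule sum.cong) (auto simp: coeff_monom_mult coeff_0_power)
    finally show ?thesis by simp
  qed
  have top: "coeff H n = 1"
  proof -
    have "coeff H n = (\<Sum>i\<le>n div 2. if i = 0 then coeff g 0 * coeff (?T 0) n else 0)"
      unfolding exp coeff_sum
    proof (rule sum.cong[OF refl])
      fix i assume i: "i \<in> {..n div 2}"
      show "coeff (smult (coeff g i) (?T i)) n = (if i = 0 then coeff g 0 * coeff (?T 0) n else 0)"
      proof (cases "i = 0")
        case False
        then have "degree (?T i) < n" using T_deg[of i] i by auto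
        then show ?thesis using False by (simp add: coeff_eq_0)
      qed simp
    qed
    also have "\<dots> = coeff (([:1, 1:] :: rat poly) ^ n) n" using \<open>coeff g 0 = 1\<close> by (simp add: monom_0)
    also have "\<dots> = 1"
    proof -
      have "lead_coeff (([:1, 1:] :: rat poly) ^ n) = 1" by (simp add: lead_coeff_power)
      moreover have "degree (([:1, 1:] :: rat poly) ^ n) = n" by (simp add: degree_power_eq)
      ultimately show ?thesis by simp
    qed
    finally show ?thesis .
  qed
  have degH: "degree H = n"
  proof (rule antisym)
    show "degree H \<le> n" unfolding exp
    proof (rule degree_sum_le)
      fix i assume "i \<in> {..n div 2}"
      then have "degree (?T i) \<le> n" using T_deg[of i] by simp
      then show "degree (smult (coeff g i) (?T i)) \<le> n" using degree_smult_le[of "coeff g i" "?T i"] by simp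
    qed simp
    show "n \<le> degree H" by (rule le_degree) (use top in simp)
  qed
  show ?thesis unfolding gamma_poly_def degH g_def[symmetric]
  proof (rule the_equality)
    show "degree g \<le> n div 2 \<and> H = (\<Sum>i\<le>n div 2. smult (coeff g i) (?T i))" using dg exp by simp
    fix g' assume g': "degree g' \<le> n div 2 \<and> H = (\<Sum>i\<le>n div 2. smult (coeff g' i) (?T i))"
    show "g' = g"
      by (rule gamma_expansion_unique[OF trans[OF sym[OF conjunct2[OF g']] exp] conjunct1[OF g'] dg])
  qed
qed

theorem theorem5p13:
  fixes E :: "'a set" and indep :: "'a set \<Rightarrow> bool"
    and \<G> :: "'a set set" and lt :: "'a \<Rightarrow> 'a \<Rightarrow> bool"
  assumes "matroid E indep" and "loopless E indep"
    and "building_set E indep \<G>" and "E \<in> \<G>"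
    and "strict_total_on E lt" and "lt_complete E indep \<G> lt"
  shows "gamma_poly (chow_poly E indep \<G>) =
           (\<Sum>S \<in> stable_max_nested E indep \<G> lt. monom 1 (card (Des E indep lt S)))
         \<and> (\<forall>i. coeff (gamma_poly (chow_poly E indep \<G>)) i \<ge> 0)"
proof -
  interpret irreducible_complete E indep \<G> lt
    using assms by unfold_locales
  have "finite (stable_max_nested E indep \<G> lt)" using finite_subset[OF stable_sub fin_MN] .
  moreover have "2 * card (Des E indep lt S) \<le> rk E - 1" if "S \<in> stable_max_nested E indep \<G> lt" for S
  proof -
    have "S \<in> MN E" "\<forall>X\<in>S. dsc S X \<longrightarrow> nondesc_child S X" using that unfolding stable_iff by blast+
    from card_nondesc[OF this] show ?thesis by linarith
  qed
  ultimately have eq: "gamma_poly (chow_poly E indep \<G>) =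
      (\<Sum>S \<in> stable_max_nested E indep \<G> lt. monom 1 (card (Des E indep lt S)))"
    unfolding chow_poly_FY_gf by (rule gamma_poly_eqI[OF _ _ FY_gf_stable FY_gf_0])
  then show ?thesis by (simp add: coeff_sum coeff_monom sum_nonneg)
qed

end
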